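(* Let $\lambda,\mu$ be natural numbers. Then, identifying $\mathrm{Op}_2^*|_{a=0}$ with $\mathrm{Op}_1^*$ via the specialisation isomorphism $\mathrm{Sp}$, so that $\mathrm{Op}_2^{\lambda,\mu}|_{a=0}$ is regarded as a subscheme of $\mathrm{Op}_1^*$, there is an equality of schemes $$\mathrm{Op}_2^{\lambda,\mu}|_{a=0}=\coprod_{\substack{|\mu-\lambda|\le\nu\le\lambda+\mu\\ \nu\equiv\lambda+\mu\bmod 2}}\mathrm{Op}_1^\nu .$$
   Context: Let $A=\mathbb C[[a]]$, $Q=\mathbb C((a))$. For an $A$-algebra $R$ put $R[2]=\varprojlim_nR[t]/((t(t-a))^n)$, $s=t-a$, $R(2)=R[2][\frac1{ts}]$, $u_n=t^ns^n$, $v_n=t^ns^{n+1}$ ($n\in\mathbb Z$). Every element of $R(2)$ is uniquely $\sum_{i\ge-N}(a_iu_i+b_iv_i)$ with $a_i,b_i\in R$. $\mathrm{Op}_2^*$ is the functor $R\mapsto R(2)$ on $A$-algebras, i.e. the ind-scheme $\varinjlim_N(\mathrm{Op}_2^* )_{\ge-N}$ where $(\mathrm{Op}_2^* )_{\ge-N}(R)=(ts)^{-N}R[2]$, $(\mathrm{Op}_2^* )_{\ge-N}=\mathrm{Spec}\,A[a_i,b_i:i\ge-N]$. $\mathrm{Op}_1^*$ is the functor $R\mapsto R((t))$ on $\mathbb C$-algebras, i.e. $\varinjlim_N(\mathrm{Op}_1^* )_{\ge-N}$, $(\mathrm{Op}_1^* )_{\ge-N}=\mathrm{Spec}\,\mathbb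 C[c_i:i\ge-N]$ with $c_i$ the coefficient of $t^i$. $|_{a=0}$ denotes base change along $A\to\mathbb C$, $a\mapsto0$; for $R$ a $\mathbb C$-algebra with $a=0$ the map $\mathrm{Sp}:f(t,s)\mapsto f(t,t)$ is an isomorphism $R(2)\simeq R((t))$, giving $\mathrm{Sp}:\mathrm{Op}_2^*|_{a=0}\simeq\mathrm{Op}_1^*$, under which $a_i$ corresponds to $c_{2i}$ and $b_i$ to $c_{2i+1}$. For $\lambda\in\mathbb N$ put $A_\lambda=\frac{\lambda^2}4+\frac\lambda2$. $\mathrm{Op}_1^\lambda$ is the closed subscheme of $(\mathrm{Op}_1^* )_{\ge-2}$ whose $R$-points are the $f=\sum_{i\ge-2}c_it^i$ with $c_{-2}=A_\lambda$ for which there is $H\in\mathrm{PSL}_2(R((t)))$ with $\begin{pmatrix}0&f\\1&0\end{pmatrix}=-\dot HH^{-1}$; equivalently, the $f$ of the form $\frac{A_\lambda}{t^2}-\frac\lambda t\psi+\psi^2+\dot\psi$ with $\psi\in R[[t]]$. For $Q$-algebras $R$ the expansions $f\mapsto(E_t(f),E_s(f))$ (substituting $s=t-a$ and expanding in $t$, resp. $t=s+a$ and expanding in $s$) give an isomorphism $(ts)^{-2}R[2]\simeq t^{-2}R[[t]]\times s^{-2}R[[s]]$. Let $\mathrm{Op}_t^\lambda=\mathrm{Spec}\,Q\times_{\mathrm{Spec}\,\mathbb C}\mathrm{Op}_1^\lambda$ (variable $t$) and $\mathrm{Op}_s^\mu=\mathrm{Spec}\,Q\times_{\mathrm{Spec}\,\mathbb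 C}\mathrm{Op}_1^\mu$ (variable called $s$). Via the isomorphism, $\mathrm{Op}_t^\lambda\times_{\mathrm{Spec}\,Q}\mathrm{Op}_s^\mu$ is a closed subscheme of $\mathrm{Spec}\,Q[a_i,b_i:i\ge-2]$ with some ideal $I_a^{\lambda,\mu}$; its schematic closure in $\mathrm{Op}_2^*$ is denoted $\mathrm{Op}_2^{\lambda,\mu}$, i.e. $\mathrm{Op}_2^{\lambda,\mu}$ is the closed subscheme of $\mathrm{Spec}\,A[a_i,b_i:i\ge-2]$ defined by $I_a^{\lambda,\mu}\cap A[a_i,b_i:i\ge-2]$. *)

theory Defs
  imports
    "HOL-Library.Poly_Mapping"
    "HOL-Computational_Algebra.Computational_Algebra"
begin

section \<open>Polynomial rings in infinitely many variables\<close>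

text \<open>\<open>('v, 'k) mpoly\<close> is the polynomial ring over \<open>'k\<close> with one variable for each element
  of \<open>'v\<close>.\<close>

type_synonym ('v, 'k) mpoly = "('v \<Rightarrow>\<^sub>0 nat) \<Rightarrow>\<^sub>0 'k"

definition mconst :: "'k::comm_ring_1 \<Rightarrow> ('v, 'k) mpoly" where
  "mconst c = Poly_Mapping.single 0 c"

definition mvar :: "'v \<Rightarrow> ('v, 'k::comm_ring_1) mpoly" where
  "mvar v = Poly_Mapping.single (Poly_Mapping.single v 1) 1"

definition meval ::
  "('k::comm_ring_1 \<Rightarrow> 'r::comm_ring_1) \<Rightarrow> ('v \<Rightarrow> 'r) \<Rightarrow> ('v, 'k) mpoly \<Rightarrow> 'r" where
  "meval \<phi> x p =
     (\<Sum>m\<in>Poly_Mapping.keys p. \<phi> (Poly_Mapping.lookup p m) *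
        (\<Prod>v\<in>Poly_Mapping.keys m. x v ^ Poly_Mapping.lookup m v))"

text \<open>Ideals are the submodules of a ring regarded as a module over itself.\<close>

definition ideal_gen :: "'a::comm_ring_1 set \<Rightarrow> 'a set" where
  "ideal_gen S = module.span (*) S"

text \<open>An algebra over \<open>'k\<close> is a commutative ring together with a ring homomorphism out of
  \<open>'k\<close>.\<close>

definition is_ring_hom :: "('a::comm_ring_1 \<Rightarrow> 'b::comm_ring_1) \<Rightarrow> bool" where
  "is_ring_hom g \<longleftrightarrow>
     g 1 = 1 \<and> (\<forall>x y. g (x + y) = g x + g y) \<and> (\<forall>x y. g (x * y) = g x * g y)"


section \<open>The schemes \<open>Op\<^sub>1\<^sup>\<lambda>\<close>\<close>

definition A_coeff :: "nat \<Rightarrow> complex" where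
  "A_coeff l = (of_nat l)\<^sup>2 / 4 + of_nat l / 2"

text \<open>For a \<open>\<complex>\<close>-algebra \<open>\<phi> :: complex \<Rightarrow> 'r\<close> and \<open>\<psi> \<in> R[[t]]\<close>, this is
  \<open>A\<^sub>\<lambda>/t\<^sup>2 - (\<lambda>/t) \<psi> + \<psi>\<^sup>2 + d\<psi>/dt \<in> R((t))\<close>.\<close>

definition Op1_elem ::
  "(complex \<Rightarrow> 'r::comm_ring_1) \<Rightarrow> nat \<Rightarrow> 'r fps \<Rightarrow> 'r fls" where
  "Op1_elem \<phi> l \<psi> =
     fls_const (\<phi> (A_coeff l)) * fls_X_inv\<^sup>2 - of_nat l * fls_X_inv * fps_to_fls \<psi>
       + (fps_to_fls \<psi>)\<^sup>2 + fls_deriv (fps_to_fls \<psi>)"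

definition Op1_points :: "(complex \<Rightarrow> 'r::comm_ring_1) \<Rightarrow> nat \<Rightarrow> 'r fls set" where
  "Op1_points \<phi> l = range (Op1_elem \<phi> l)"

text \<open>\<open>\<complex>[c\<^sub>i : i \<ge> -N]\<close> is represented as \<open>(nat, complex) mpoly\<close>, the variable number \<open>n\<close> being
  \<open>c\<^bsub>n-N\<^esub>\<close>. The following are the coordinates of a point \<open>f \<in> t\<^bsup>-N\<^esup>R[[t]]\<close>.\<close>

definition Op1_coord :: "nat \<Rightarrow> 'r::comm_ring_1 fls \<Rightarrow> nat \<Rightarrow> 'r" where
  "Op1_coord N f n = fls_nth f (int n - int N)"

text \<open>The ideal of \<open>Op\<^sub>1\<^sup>\<lambda>\<close> as a closed subscheme of \<open>Spec \<complex>[c\<^sub>i : i \<ge> -N]\<close>, for \<open>N \<ge> 2\<close>. A HOL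
  definition cannot range over all \<open>\<complex>\<close>-algebras \<open>R\<close>; it suffices to test on
  \<open>R = \<complex>[\<psi>\<^sub>0, \<psi>\<^sub>1, \<dots>]\<close>, which carries the universal \<open>\<psi>\<close>. That this ideal does cut out exactly
  \<open>Op1_points\<close> over every \<open>\<complex>\<close>-algebra is the lemma \<open>Op1_ideal_points\<close> below.\<close>

definition Op1_ideal :: "nat \<Rightarrow> nat \<Rightarrow> (nat, complex) mpoly set" where
  "Op1_ideal N l =
     {p. \<forall>\<psi> :: (nat, complex) mpoly fps.
           meval mconst (Op1_coord N (Op1_elem mconst l \<psi>)) p = 0}"


section \<open>The schemes \<open>Op\<^sub>2\<^sup>\<lambda>\<^sup>,\<^sup>\<mu>\<close>\<close>

text \<open>\<open>A = \<complex>[[a]]\<close> is \<open>complex fps\<close> and \<open>Q = \<complex>((a))\<close> is \<open>complex fls\<close>, so \<open>a \<in> Q\<close> is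
  \<open>fls_X\<close>. In \<open>A[a\<^sub>i, b\<^sub>i : i \<ge> -2]\<close> the variables are shifted by 2: \<open>Avar n\<close> is
  \<open>a\<^bsub>n-2\<^esub>\<close> and \<open>Bvar n\<close> is \<open>b\<^bsub>n-2\<^esub>\<close>, that is, the coefficients of
  \<open>u\<^bsub>n-2\<^esub> = t\<^bsup>n-2\<^esup> s\<^bsup>n-2\<^esup>\<close> and
  \<open>v\<^bsub>n-2\<^esub> = t\<^bsup>n-2\<^esup> s\<^bsup>n-1\<^esup>\<close>.\<close>

datatype op2_var = Avar nat | Bvar nat

text \<open>Expansions of \<open>u\<^sub>j\<close> and \<open>v\<^sub>j\<close> in \<open>Q((t))\<close>, where \<open>s = t - a\<close>, and in \<open>Q((s))\<close>, where
  \<open>t = s + a\<close>; in both cases the local coordinate is the outer \<open>fls_X\<close>.\<close>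

definition Et_u :: "int \<Rightarrow> complex fls fls" where
  "Et_u j = (fls_X powi j) * ((fls_X - fls_const fls_X) powi j)"

definition Et_v :: "int \<Rightarrow> complex fls fls" where
  "Et_v j = (fls_X powi j) * ((fls_X - fls_const fls_X) powi (j + 1))"

definition Es_u :: "int \<Rightarrow> complex fls fls" where
  "Es_u j = ((fls_X + fls_const fls_X) powi j) * (fls_X powi j)"

definition Es_v :: "int \<Rightarrow> complex fls fls" where
  "Es_v j = ((fls_X + fls_const fls_X) powi j) * (fls_X powi (j + 1))"

text \<open>For a \<open>Q\<close>-algebra \<open>\<phi> :: complex fls \<Rightarrow> 'r\<close>, the expansion of
  \<open>\<Sum>\<^bsub>j \<ge> -2\<^esub> (a\<^sub>j u\<^sub>j + b\<^sub>j v\<^sub>j)\<close> as an element of \<open>t\<^bsup>-2\<^esup>R[[t]]\<close>, given the expansions \<open>U j\<close>, \<open>V j\<close> of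
  \<open>u\<^sub>j\<close>, \<open>v\<^sub>j\<close>. The sum for the coefficient of \<open>t\<^bsup>m-2\<^esup>\<close> stops at \<open>j = m - 2\<close> because \<open>U j\<close> and
  \<open>V j\<close> have order at least \<open>j\<close>.\<close>

definition Op2_expand ::
  "(int \<Rightarrow> complex fls fls) \<Rightarrow> (int \<Rightarrow> complex fls fls) \<Rightarrow>
     (complex fls \<Rightarrow> 'r::comm_ring_1) \<Rightarrow> (op2_var \<Rightarrow> 'r) \<Rightarrow> 'r fls" where
  "Op2_expand U V \<phi> x =
     fls_shift 2 (fps_to_fls (Abs_fps (\<lambda>m. \<Sum>n\<le>m.
        \<phi> (fls_nth (U (int n - 2)) (int m - 2)) * x (Avar n) +
        \<phi> (fls_nth (V (int n - 2)) (int m - 2)) * x (Bvar n))))"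

abbreviation "E_t \<equiv> Op2_expand Et_u Et_v"
abbreviation "E_s \<equiv> Op2_expand Es_u Es_v"

text \<open>The ideal \<open>I\<^sub>a\<^sup>\<lambda>\<^sup>,\<^sup>\<mu>\<close> of \<open>Op\<^sub>t\<^sup>\<lambda> \<times>\<^bsub>Spec Q\<^esub> Op\<^sub>s\<^sup>\<mu>\<close> in \<open>Q[a\<^sub>i, b\<^sub>i : i \<ge> -2]\<close>: it is generated by the
  pullbacks of the two ideals along the two components of the isomorphism
  \<open>f \<mapsto> (E_t f, E_s f)\<close>, evaluated at the universal point \<open>f\<close>.\<close>

definition Op2_generic_ideal :: "nat \<Rightarrow> nat \<Rightarrow> (op2_var, complex fls) mpoly set" where
  "Op2_generic_ideal l m = ideal_gen
     (meval (\<lambda>z. mconst (fls_const z)) (Op1_coord 2 (E_t mconst mvar)) ` Op1_ideal 2 l \<union>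
      meval (\<lambda>z. mconst (fls_const z)) (Op1_coord 2 (E_s mconst mvar)) ` Op1_ideal 2 m)"

text \<open>Its contraction to \<open>A[a\<^sub>i, b\<^sub>i : i \<ge> -2]\<close>, the ideal of \<open>Op\<^sub>2\<^sup>\<lambda>\<^sup>,\<^sup>\<mu>\<close>.\<close>

definition Op2_ideal :: "nat \<Rightarrow> nat \<Rightarrow> (op2_var, complex fps) mpoly set" where
  "Op2_ideal l m =
     {p. meval (\<lambda>z. mconst (fps_to_fls z)) mvar p \<in> Op2_generic_ideal l m}"

text \<open>On the special fibre \<open>Sp\<close> identifies \<open>a\<^sub>i\<close> with \<open>c\<^bsub>2i\<^esub>\<close> and \<open>b\<^sub>i\<close> with \<open>c\<^bsub>2i+1\<^esub>\<close>, so
  that \<open>Spec \<complex>[a\<^sub>i, b\<^sub>i : i \<ge> -2]\<close> becomes \<open>Spec \<complex>[c\<^sub>i : i \<ge> -4]\<close>; after the index shifts, by 2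
  and by 4, this reads as follows.\<close>

fun Sp_var :: "op2_var \<Rightarrow> (nat, complex) mpoly" where
  "Sp_var (Avar n) = mvar (2 * n)"
| "Sp_var (Bvar n) = mvar (2 * n + 1)"

text \<open>The ideal in \<open>\<complex>[c\<^sub>i : i \<ge> -4]\<close> of the base change of \<open>Op\<^sub>2\<^sup>\<lambda>\<^sup>,\<^sup>\<mu>\<close> along \<open>a \<mapsto> 0\<close>.\<close>

definition Op2_special_ideal :: "nat \<Rightarrow> nat \<Rightarrow> (nat, complex) mpoly set" where
  "Op2_special_ideal l m =
     ideal_gen (meval (\<lambda>z. mconst (fps_nth z 0)) Sp_var ` Op2_ideal l m)"


section \<open>Coproducts of closed subschemes\<close>

text \<open>For a finite family of ideals \<open>I i\<close> (\<open>i \<in> S\<close>) of a ring \<open>P\<close>, the canonical map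
  \<open>\<Coprod>\<^sub>i Spec (P/I i) = Spec (\<Prod>\<^sub>i P/I i) \<rightarrow> Spec P\<close> is a closed immersion with image the closed subscheme
  of \<open>J\<close> iff \<open>P \<rightarrow> \<Prod>\<^sub>i P/I i\<close> is surjective with kernel \<open>J\<close>.\<close>

definition is_closed_coproduct :: "'a::comm_ring_1 set \<Rightarrow> 'i set \<Rightarrow> ('i \<Rightarrow> 'a set) \<Rightarrow> bool" where
  "is_closed_coproduct J S I \<longleftrightarrow>
     finite S \<and> J = (\<Inter>i\<in>S. I i) \<and> (\<forall>q. \<exists>p. \<forall>i\<in>S. p - q i \<in> I i)"


section \<open>The functors of points of \<open>Op1_ideal\<close> and \<open>Op2_generic_ideal\<close>\<close>

subsection \<open>Evaluation of polynomials\<close>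

lemma is_ring_homD:
  assumes "is_ring_hom g"
  shows "g 1 = 1" "g (x + y) = g x + g y" "g (x * y) = g x * g y"
    "g 0 = 0" "g (- x) = - g x" "g (x - y) = g x - g y"
    "g (x ^ n) = g x ^ n" "g (sum h X) = (\<Sum>i\<in>X. g (h i))" "g (prod h X) = (\<Prod>i\<in>X. g (h i))"
    "g (of_nat n) = of_nat n"
proof -
  show one: "g 1 = 1" and add: "\<And>x y. g (x + y) = g x + g y" and mult: "\<And>x y. g (x * y) = g x * g y"
    using assms by (auto simp: is_ring_hom_def)
  show zero: "g 0 = 0" using add[of 0 0] by simp
  show minus: "\<And>x. g (- x) = - g x"
  proof -
    fix x show "g (- x) = - g x" using add[of x "- x"] zero by (simp add: eq_neg_iff_add_eq_0 add.commute)
  qed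
  show "g (x - y) = g x - g y" using add[of x "- y"] minus by simp
  show "g (x ^ n) = g x ^ n" by (induction n) (auto simp: one mult)
  show "g (sum h X) = (\<Sum>i\<in>X. g (h i))"
    by (induction X rule: infinite_finite_induct) (auto simp: zero add)
  show "g (prod h X) = (\<Prod>i\<in>X. g (h i))"
    by (induction X rule: infinite_finite_induct) (auto simp: one mult)
  show "g (of_nat n) = of_nat n" by (induction n) (auto simp: zero one add)
qed

lemma is_ring_hom_mconst: "is_ring_hom mconst"
  by (simp add: is_ring_hom_def mconst_def single_add mult_single)

lemma is_ring_hom_fls_const: "is_ring_hom fls_const"
  by (simp add: is_ring_hom_def fls_plus_const fls_const_mult_const)

lemma is_ring_hom_comp: "is_ring_hom f \<Longrightarrow> is_ring_hom g \<Longrightarrow> is_ring_hom (\<lambda>x. g (f x))"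
  by (simp add: is_ring_hom_def)

lemma meval_superset:
  assumes "is_ring_hom \<phi>" "finite K" "Poly_Mapping.keys p \<subseteq> K"
  shows "meval \<phi> x p = (\<Sum>m\<in>K. \<phi> (Poly_Mapping.lookup p m) *
        (\<Prod>v\<in>Poly_Mapping.keys m. x v ^ Poly_Mapping.lookup m v))"
  unfolding meval_def using assms
  by (intro sum.mono_neutral_left) (auto simp: in_keys_iff is_ring_homD(4))

lemma meval_add:
  assumes "is_ring_hom \<phi>"
  shows "meval \<phi> x (p + q) = meval \<phi> x p + meval \<phi> x q"
proof -
  let ?K = "Poly_Mapping.keys p \<union> Poly_Mapping.keys q"
  show ?thesis
    using Poly_Mapping.keys_add[of p q]
    by (simp add: meval_superset[OF assms, of ?K] lookup_add is_ring_homD[OF assms]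
        distrib_right sum.distrib)
qed

lemma meval_single:
  assumes "is_ring_hom \<phi>"
  shows "meval \<phi> x (Poly_Mapping.single m c) =
    \<phi> c * (\<Prod>v\<in>Poly_Mapping.keys m. x v ^ Poly_Mapping.lookup m v)"
  by (subst meval_superset[OF assms, of "{m}"]) auto

lemma meval_sum:
  assumes "is_ring_hom \<phi>"
  shows "meval \<phi> x (sum h X) = (\<Sum>i\<in>X. meval \<phi> x (h i))"
  by (induction X rule: infinite_finite_induct)
    (auto simp: meval_add[OF assms], auto simp: meval_def)

lemma monomial_prod_add:
  fixes x :: "'v \<Rightarrow> 'r::comm_ring_1"
  shows "(\<Prod>v\<in>Poly_Mapping.keys (m + n). x v ^ Poly_Mapping.lookup (m + n) v) =
    (\<Prod>v\<in>Poly_Mapping.keys m. x v ^ Poly_Mapping.lookup m v) *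
    (\<Prod>v\<in>Poly_Mapping.keys n. x v ^ Poly_Mapping.lookup n v)"
proof -
  let ?K = "Poly_Mapping.keys m \<union> Poly_Mapping.keys n"
  have *: "(\<Prod>v\<in>Poly_Mapping.keys k. x v ^ Poly_Mapping.lookup k v) =
      (\<Prod>v\<in>?K. x v ^ Poly_Mapping.lookup k v)" if "Poly_Mapping.keys k \<subseteq> ?K" for k
    using that by (intro prod.mono_neutral_left) (auto simp: in_keys_iff)
  have "(\<Prod>v\<in>Poly_Mapping.keys (m + n). x v ^ Poly_Mapping.lookup (m + n) v) =
      (\<Prod>v\<in>?K. x v ^ Poly_Mapping.lookup (m + n) v)"
    using Poly_Mapping.keys_add[of m n] by (intro *) auto
  then show ?thesis
    by (simp add: *[of m] *[of n] lookup_add power_add prod.distrib)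
qed

lemma mpoly_sum_single: "p = (\<Sum>m\<in>Poly_Mapping.keys p. Poly_Mapping.single m (Poly_Mapping.lookup p m))"
  by (intro poly_mapping_eqI)
    (auto simp: lookup_sum lookup_single when_def in_keys_iff sum.delta)

lemma meval_mult:
  assumes "is_ring_hom \<phi>"
  shows "meval \<phi> x (p * q) = meval \<phi> x p * meval \<phi> x q"
proof -
  have "meval \<phi> x (p * q) = meval \<phi> x
     ((\<Sum>m\<in>Poly_Mapping.keys p. Poly_Mapping.single m (Poly_Mapping.lookup p m)) *
      (\<Sum>m\<in>Poly_Mapping.keys q. Poly_Mapping.single m (Poly_Mapping.lookup q m)))"
    using mpoly_sum_single[of p] mpoly_sum_single[of q] by simp
  also have "\<dots> = (\<Sum>m\<in>Poly_Mapping.keys p. \<Sum>n\<in>Poly_Mapping.keys q.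
      meval \<phi> x (Poly_Mapping.single m (Poly_Mapping.lookup p m)) *
      meval \<phi> x (Poly_Mapping.single n (Poly_Mapping.lookup q n)))"
    by (simp add: sum_product meval_sum[OF assms] mult_single meval_single[OF assms]
        monomial_prod_add is_ring_homD[OF assms] mult_ac)
  also have "\<dots> = meval \<phi> x p * meval \<phi> x q"
    by (simp add: sum_product meval_single[OF assms]) (simp add: meval_def sum_product)
  finally show ?thesis .
qed

lemma is_ring_hom_meval:
  assumes "is_ring_hom \<phi>"
  shows "is_ring_hom (meval \<phi> x)"
  unfolding is_ring_hom_def
  by (auto simp: meval_add[OF assms] meval_mult[OF assms] is_ring_homD[OF assms]
      meval_single[OF assms, of x 0 1, simplified])

lemma meval_mvar: "is_ring_hom \<phi> \<Longrightarrow> meval \<phi> x (mvar v) = x v"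
  by (simp add: mvar_def meval_single is_ring_homD)

lemma meval_mconst: "is_ring_hom \<phi> \<Longrightarrow> meval \<phi> x (mconst c) = \<phi> c"
  by (simp add: mconst_def meval_single)

lemma ring_hom_meval:
  assumes "is_ring_hom g"
  shows "g (meval \<phi> x p) = meval (\<lambda>z. g (\<phi> z)) (\<lambda>v. g (x v)) p"
  by (simp add: meval_def is_ring_homD[OF assms])

subsection \<open>Points of \<open>Op\<^sub>1\<^sup>\<lambda>\<close>\<close>

lemma Op1_elem_eq:
  "Op1_elem \<phi> l \<psi> = fls_shift 2 (fls_const (\<phi> (A_coeff l)))
     - fls_shift 1 (fps_to_fls (of_nat l * \<psi>)) + fps_to_fls (\<psi> * \<psi> + fps_deriv \<psi>)"
proof -
  have "of_nat l * fls_X_inv * fps_to_fls \<psi> = fls_X_inv * fps_to_fls (of_nat l * \<psi>)"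
    by (simp add: fls_times_fps_to_fls fps_to_fls_of_nat mult_ac)
  moreover have "fls_const z * fls_X_inv\<^sup>2 = fls_shift 2 (fls_const z)" for z :: 'a
    by (simp add: fls_X_inv_power_times_conv_shift)
  ultimately show ?thesis
    by (simp add: Op1_elem_def fls_X_inv_times_conv_shift power2_eq_square[of "fps_to_fls \<psi>"]
        fls_times_fps_to_fls fls_deriv_fps_to_fls mult_ac)
qed

lemma Op1_elem_nth:
  "i < -2 \<Longrightarrow> fls_nth (Op1_elem \<phi> l \<psi>) i = 0"
  "fls_nth (Op1_elem \<phi> l \<psi>) (-2) = \<phi> (A_coeff l)"
  "fls_nth (Op1_elem \<phi> l \<psi>) (int k - 1) =
     (of_nat k - of_nat l) * fps_nth \<psi> k + (\<Sum>i<k. fps_nth \<psi> i * fps_nth \<psi> (k - 1 - i))"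
proof -
  show "i < -2 \<Longrightarrow> fls_nth (Op1_elem \<phi> l \<psi>) i = 0"
    "fls_nth (Op1_elem \<phi> l \<psi>) (-2) = \<phi> (A_coeff l)"
    by (auto simp: Op1_elem_eq)
  have *: "fps_nth (of_nat l * \<psi>) k = of_nat l * fps_nth \<psi> k" for k
    by (simp add: fps_of_nat[symmetric])
  show "fls_nth (Op1_elem \<phi> l \<psi>) (int k - 1) =
     (of_nat k - of_nat l) * fps_nth \<psi> k + (\<Sum>i<k. fps_nth \<psi> i * fps_nth \<psi> (k - 1 - i))"
  proof (cases k)
    case 0
    then show ?thesis by (simp add: Op1_elem_eq *)
  next
    case (Suc j)
    have "int k - 1 = int j" using Suc by simp
    moreover have "fps_nth (of_nat l * \<psi>) (nat (int j + 1)) = of_nat l * fps_nth \<psi> k"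
      unfolding * using Suc by (simp add: nat_add_distrib)
    ultimately show ?thesis
      using Suc by (simp add: Op1_elem_eq * fps_mult_nth atLeast0AtMost lessThan_Suc_atMost
          left_diff_distrib distrib_right)
  qed
qed

text \<open>A section of \<open>\<psi> \<mapsto> Op1_elem \<phi> l \<psi>\<close>, solving recursively for the coefficients of \<open>\<psi>\<close>; the
  coefficient of index \<open>l\<close> is free and is chosen to be 0.\<close>

function Op1_section ::
  "(complex \<Rightarrow> 'r::comm_ring_1) \<Rightarrow> nat \<Rightarrow> (int \<Rightarrow> 'r) \<Rightarrow> nat \<Rightarrow> 'r" where
  "Op1_section \<phi> l c k = (if k = l then 0 else \<phi> (1 / (of_nat k - of_nat l)) *
     (c (int k - 1) - (\<Sum>i\<in>{..<k}. Op1_section \<phi> l c i * Op1_section \<phi> l c (k - 1 - i))))"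
  by pat_completeness auto
termination by (relation "measure (\<lambda>(\<phi>, l, c, k). k)") auto

declare Op1_section.simps [simp del]

lemma ring_hom_Op1_section:
  assumes "is_ring_hom g"
  shows "g (Op1_section \<phi> l c k) = Op1_section (\<lambda>z. g (\<phi> z)) l (\<lambda>i. g (c i)) k"
proof (induction k rule: less_induct)
  case (less k)
  have "(\<Sum>i<k. g (Op1_section \<phi> l c i) * g (Op1_section \<phi> l c (k - 1 - i))) =
    (\<Sum>i<k. Op1_section (\<lambda>z. g (\<phi> z)) l (\<lambda>i. g (c i)) i *
       Op1_section (\<lambda>z. g (\<phi> z)) l (\<lambda>i. g (c i)) (k - 1 - i))"
    by (intro sum.cong refl arg_cong2[where f = "(*)"] less) auto
  then show ?case
    by (subst (1 2) Op1_section.simps) (simp add: is_ring_homD[OF assms])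
qed

lemma ring_hom_inverse_of_nat:
  assumes "is_ring_hom (\<phi> :: complex \<Rightarrow> 'r::comm_ring_1)" "k \<noteq> l"
  shows "(of_nat k - of_nat l) * \<phi> (1 / (of_nat k - of_nat l)) = 1"
proof -
  have "(of_nat k - of_nat l :: 'r) = \<phi> (of_nat k - of_nat l)"
    by (simp add: is_ring_homD[OF assms(1)])
  then show ?thesis
    using assms(2) by (simp add: is_ring_homD(1,3)[OF assms(1), symmetric])
qed

lemma Op1_section_elem:
  assumes \<phi>: "is_ring_hom \<phi>" and "k < l"
  shows "Op1_section \<phi> l (fls_nth (Op1_elem \<phi> l \<psi>)) k = fps_nth \<psi> k"
  using \<open>k < l\<close>
proof (induction k rule: less_induct)
  case (less k)
  have "(\<Sum>i<k. Op1_section \<phi> l (fls_nth (Op1_elem \<phi> l \<psi>)) i *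
        Op1_section \<phi> l (fls_nth (Op1_elem \<phi> l \<psi>)) (k - 1 - i)) =
      (\<Sum>i<k. fps_nth \<psi> i * fps_nth \<psi> (k - 1 - i))"
    using less.prems by (intro sum.cong refl arg_cong2[where f = "(*)"] less.IH) auto
  then show ?case
    using less.prems ring_hom_inverse_of_nat[OF \<phi>, of k l]
    by (subst Op1_section.simps) (simp add: Op1_elem_nth mult_ac)
qed

lemma Op1_points_iff:
  assumes \<phi>: "is_ring_hom \<phi>"
  shows "f \<in> Op1_points \<phi> l \<longleftrightarrow>
    (\<forall>i < -2. fls_nth f i = 0) \<and> fls_nth f (-2) = \<phi> (A_coeff l) \<and>
    fls_nth f (int l - 1) = (\<Sum>i<l. Op1_section \<phi> l (fls_nth f) i *
       Op1_section \<phi> l (fls_nth f) (l - 1 - i))" (is "_ \<longleftrightarrow> ?R")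
proof
  assume "f \<in> Op1_points \<phi> l"
  then obtain \<psi> where f: "f = Op1_elem \<phi> l \<psi>" by (auto simp: Op1_points_def)
  have "(\<Sum>i<l. Op1_section \<phi> l (fls_nth f) i * Op1_section \<phi> l (fls_nth f) (l - 1 - i)) =
     (\<Sum>i<l. fps_nth \<psi> i * fps_nth \<psi> (l - 1 - i))"
    unfolding f by (intro sum.cong refl arg_cong2[where f = "(*)"] Op1_section_elem[OF \<phi>]) auto
  then show ?R by (simp add: f Op1_elem_nth)
next
  assume R: ?R
  define \<psi> where "\<psi> = Abs_fps (Op1_section \<phi> l (fls_nth f))"
  have "fls_nth f i = fls_nth (Op1_elem \<phi> l \<psi>) i" for i
  proof -
    have "i \<ge> -1 \<Longrightarrow> i = int (nat (i + 1)) - 1" by simp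
    then consider "i < -2" | "i = -2" | k where "i = int k - 1" by fastforce
    then show ?thesis
    proof cases
      case 3
      show ?thesis
      proof (cases "k = l")
        case True
        then show ?thesis using R 3 by (simp add: Op1_elem_nth \<psi>_def)
      next
        case False
        have "(of_nat k - of_nat l) * Op1_section \<phi> l (fls_nth f) k = fls_nth f (int k - 1) -
           (\<Sum>i<k. Op1_section \<phi> l (fls_nth f) i * Op1_section \<phi> l (fls_nth f) (k - 1 - i))"
          using False ring_hom_inverse_of_nat[OF \<phi> False]
          by (subst Op1_section.simps) (simp flip: mult.assoc)
        then show ?thesis by (simp add: 3 Op1_elem_nth \<psi>_def)
      qed
    qed (use R in \<open>auto simp: Op1_elem_nth\<close>)
  qed
  then show "f \<in> Op1_points \<phi> l" by (auto simp: Op1_points_def fls_eq_iff)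
qed

theorem Op1_ideal_points:
  fixes \<phi> :: "complex \<Rightarrow> 'r::comm_ring_1"
  assumes \<phi>: "is_ring_hom \<phi>" and N: "N \<ge> 2" and f: "\<And>i. i < - int N \<Longrightarrow> fls_nth f i = 0"
  shows "(\<forall>p\<in>Op1_ideal N l. meval \<phi> (Op1_coord N f) p = 0) \<longleftrightarrow> f \<in> Op1_points \<phi> l"
proof
  assume "f \<in> Op1_points \<phi> l"
  then obtain \<psi> where \<psi>: "f = Op1_elem \<phi> l \<psi>" by (auto simp: Op1_points_def)
  define \<Psi> :: "(nat, complex) mpoly fps" where "\<Psi> = Abs_fps mvar"
  define g where "g = meval \<phi> (fps_nth \<psi>)"
  have g: "is_ring_hom g" unfolding g_def by (rule is_ring_hom_meval[OF \<phi>])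
  have gc: "g (mconst z) = \<phi> z" for z by (simp add: g_def meval_mconst[OF \<phi>])
  have gv: "g (fps_nth \<Psi> k) = fps_nth \<psi> k" for k by (simp add: g_def \<Psi>_def meval_mvar[OF \<phi>])
  have gi: "g (fls_nth (Op1_elem mconst l \<Psi>) i) = fls_nth f i" for i
  proof -
    consider "i < -2" | "i = -2" | "i \<ge> -1" by linarith
    then show ?thesis
    proof cases
      case 3
      define k where "k = nat (i + 1)"
      have "i = int k - 1" using 3 by (simp add: k_def)
      then show ?thesis by (simp add: \<psi> Op1_elem_nth is_ring_homD[OF g] gv)
    qed (auto simp: \<psi> Op1_elem_nth is_ring_homD[OF g] gc)
  qed
  show "\<forall>p\<in>Op1_ideal N l. meval \<phi> (Op1_coord N f) p = 0"
  proof
    fix p assume "p \<in> Op1_ideal N l"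
    then have "g (meval mconst (Op1_coord N (Op1_elem mconst l \<Psi>)) p) = 0"
      by (simp add: Op1_ideal_def is_ring_homD[OF g])
    then show "meval \<phi> (Op1_coord N f) p = 0"
      by (simp add: ring_hom_meval[OF g] gc gi Op1_coord_def[abs_def])
  qed
next
  assume *: "\<forall>p\<in>Op1_ideal N l. meval \<phi> (Op1_coord N f) p = 0"
  define c :: "int \<Rightarrow> (nat, complex) mpoly" where
    "c i = (if i < - int N then 0 else mvar (nat (i + int N)))" for i
  define P where "P = c (int l - 1) - (\<Sum>i<l. Op1_section mconst l c i * Op1_section mconst l c (l - 1 - i))"
  have ev: "meval \<rho> (Op1_coord N h) (c i) = fls_nth h i"
    if "is_ring_hom \<rho>" "\<And>i. i < - int N \<Longrightarrow> fls_nth h i = 0"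
    for \<rho> :: "complex \<Rightarrow> 's::comm_ring_1" and h i
    using that
    by (auto simp: c_def meval_mvar Op1_coord_def is_ring_homD(4)[OF is_ring_hom_meval])
  have evP: "meval \<rho> (Op1_coord N h) P = fls_nth h (int l - 1) -
       (\<Sum>i<l. Op1_section \<rho> l (fls_nth h) i * Op1_section \<rho> l (fls_nth h) (l - 1 - i))"
    if \<rho>: "is_ring_hom \<rho>" and h: "\<And>i. i < - int N \<Longrightarrow> fls_nth h i = 0"
    for \<rho> :: "complex \<Rightarrow> 's::comm_ring_1" and h
    by (simp add: P_def is_ring_homD[OF is_ring_hom_meval[OF \<rho>]] meval_mconst[OF \<rho>]
        ring_hom_Op1_section[OF is_ring_hom_meval[OF \<rho>]] ev[OF \<rho> h])
  have pt: "Op1_elem mconst l \<psi> \<in> Op1_points mconst l" for \<psi> :: "(nat, complex) mpoly fps"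
    by (simp add: Op1_points_def)
  note pt = pt[unfolded Op1_points_iff[OF is_ring_hom_mconst]]
  have zero: "fls_nth (Op1_elem mconst l \<psi>) i = 0" if "i < - int N"
    for \<psi> :: "(nat, complex) mpoly fps" and i
    using that N by (simp add: Op1_elem_nth)
  have "c i \<in> Op1_ideal N l" if "i < -2" for i
    using that by (auto simp: Op1_ideal_def ev[OF is_ring_hom_mconst zero] Op1_elem_nth)
  moreover have "c (-2) - mconst (A_coeff l) \<in> Op1_ideal N l"
    by (auto simp: Op1_ideal_def ev[OF is_ring_hom_mconst zero] Op1_elem_nth
        is_ring_homD[OF is_ring_hom_meval[OF is_ring_hom_mconst]] meval_mconst[OF is_ring_hom_mconst])
  moreover have "P \<in> Op1_ideal N l"
    using pt by (auto simp: Op1_ideal_def evP[OF is_ring_hom_mconst zero])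
  ultimately have "\<And>i. i < -2 \<Longrightarrow> meval \<phi> (Op1_coord N f) (c i) = 0"
    "meval \<phi> (Op1_coord N f) (c (-2) - mconst (A_coeff l)) = 0"
    "meval \<phi> (Op1_coord N f) P = 0"
    using * by blast+
  then show "f \<in> Op1_points \<phi> l"
    by (simp add: Op1_points_iff[OF \<phi>] ev[OF \<phi> f] evP[OF \<phi> f]
        is_ring_homD[OF is_ring_hom_meval[OF \<phi>]] meval_mconst[OF \<phi>])
qed

subsection \<open>Points of \<open>Op\<^sub>t\<^sup>\<lambda> \<times> Op\<^sub>s\<^sup>\<mu>\<close>\<close>

lemma ring_hom_ideal_gen_eq_0:
  assumes g: "is_ring_hom g"
  shows "(\<forall>p\<in>ideal_gen S. g p = 0) \<longleftrightarrow> (\<forall>p\<in>S. g p = 0)"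
proof -
  interpret ring_module: module "(*) :: 'a \<Rightarrow> 'a \<Rightarrow> 'a"
    by standard (auto simp: algebra_simps)
  have "ring_module.subspace {p. g p = 0}"
    by (auto simp: ring_module.subspace_def is_ring_homD[OF g])
  then show ?thesis
    using ring_module.span_superset[of S] ring_module.span_minimal[of S "{p. g p = 0}"]
    by (auto simp: ideal_gen_def)
qed

lemma Op2_basis_nth_lt:
  assumes "i < j"
  shows "fls_nth (Et_u j) i = 0" "fls_nth (Et_v j) i = 0"
    "fls_nth (Es_u j) i = 0" "fls_nth (Es_v j) i = 0"
proof -
  have X: "fls_subdegree (fls_X - fls_const fls_X :: complex fls fls) = 0"
    "fls_subdegree (fls_X + fls_const fls_X :: complex fls fls) = 0"
    by (auto intro!: fls_subdegree_eqI)
  have nz: "(fls_X - fls_const fls_X :: complex fls fls) \<noteq> 0"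
    "(fls_X + fls_const fls_X :: complex fls fls) \<noteq> 0"
    by (rule fls_nonzeroI[of _ 0], simp)+
  have *: "fls_nth (f powi p * g powi q) i = 0"
    if "f \<noteq> 0" "g \<noteq> 0" "i < p * fls_subdegree f + q * fls_subdegree g"
    for f g :: "complex fls fls" and p q
    using that by (intro fls_eq0_below_subdegree) simp
  show "fls_nth (Et_u j) i = 0" "fls_nth (Et_v j) i = 0"
    "fls_nth (Es_u j) i = 0" "fls_nth (Es_v j) i = 0"
    unfolding Et_u_def Et_v_def Es_u_def Es_v_def
    by (rule *; use assms nz X in simp)+
qed

lemma Op2_expand_nth_lt: "i < -2 \<Longrightarrow> fls_nth (Op2_expand U V \<phi> x) i = 0"
  by (simp add: Op2_expand_def)

lemma meval_Op2_expand:
  assumes \<phi>: "is_ring_hom \<phi>"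
  shows "meval \<phi> x (Op1_coord 2 (Op2_expand U V mconst mvar) n) =
    Op1_coord 2 (Op2_expand U V \<phi> x) n"
  by (simp add: Op1_coord_def Op2_expand_def is_ring_homD[OF is_ring_hom_meval[OF \<phi>]]
      meval_mvar[OF \<phi>] meval_mconst[OF \<phi>])

theorem Op2_generic_ideal_points:
  fixes \<phi> :: "complex fls \<Rightarrow> 'r::comm_ring_1"
  assumes \<phi>: "is_ring_hom \<phi>"
  shows "(\<forall>p\<in>Op2_generic_ideal l m. meval \<phi> x p = 0) \<longleftrightarrow>
    E_t \<phi> x \<in> Op1_points (\<lambda>z. \<phi> (fls_const z)) l \<and> E_s \<phi> x \<in> Op1_points (\<lambda>z. \<phi> (fls_const z)) m"
proof -
  have \<phi>': "is_ring_hom (\<lambda>z. \<phi> (fls_const z))"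
    by (rule is_ring_hom_comp[OF is_ring_hom_fls_const \<phi>])
  have *: "meval \<phi> x (meval (\<lambda>z. mconst (fls_const z)) (Op1_coord 2 (Op2_expand U V mconst mvar)) p) =
      meval (\<lambda>z. \<phi> (fls_const z)) (Op1_coord 2 (Op2_expand U V \<phi> x)) p" for U V p
    by (simp add: ring_hom_meval[OF is_ring_hom_meval[OF \<phi>]] meval_mconst[OF \<phi>]
        meval_Op2_expand[OF \<phi>])
  show ?thesis
    unfolding Op2_generic_ideal_def ring_hom_ideal_gen_eq_0[OF is_ring_hom_meval[OF \<phi>]]
    by (simp add: ball_Un * Op2_expand_nth_lt flip: Op1_ideal_points[OF \<phi>', of 2])
qed

end

theory Submission
  imports Defs "Jordan_Normal_Form.Determinant"
begin

text \<open>Why the theorem holds. Everything is reduced to points over fields. The ideals of \<open>Op\<^sub>1\<^sup>\<nu>\<close> and of the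
generic fibre are graph-like: at each singular point the leading coefficient is fixed and one further
coefficient is a polynomial in lower ones, while the others are free. Hence there is a polynomial retraction of the ambient affine space onto each of these subschemes, and their
ideals consist of the polynomials that vanish at all points over the infinite fields \<open>\<complex>\<close> and
\<open>Q = \<complex>((a))\<close> (\<open>Op1_ideal_iff\<close>, \<open>Op2_ideal_iff\<close>). By \<open>Op2_points_iff_riccati\<close>, a point of the generic
fibre is an \<open>f\<close> with prescribed \<open>a\<^bsub>-2\<^esub>\<close>, \<open>b\<^bsub>-2\<^esub>\<close> for which
\<open>L = ts\<partial>\<^sup>2 - (\<lambda>s + \<mu>t)\<partial> - G\<close> kills an invertible power series at \<open>t = 0\<close> and one at \<open>s = 0\<close>; here
\<open>G/(ts) = f - A\<^sub>\<lambda>/t\<^sup>2 - A\<^sub>\<mu>/s\<^sup>2 - \<lambda>\<mu>/(2ts)\<close>, and \<open>L\<close> is \<open>ts(\<partial>\<^sup>2 - f)\<close> conjugated by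
\<open>t\<^bsup>-\<lambda>/2\<^esup>s\<^bsup>-\<mu>/2\<^esup>\<close>.

Every \<open>Op\<^sub>1\<^sup>\<nu>\<close> occurs (\<open>Op2_special_ideal_subset\<close>). Let \<open>\<nu> = \<lambda> + \<mu> - 2k\<close>. A point
of \<open>Op\<^sub>1\<^sup>\<nu>\<close> comes from \<open>t\<^bsup>-\<nu>/2\<^esup>exp(\<integral>\<psi>)\<close>, and it lifts to the oper with solution
\<open>t\<^bsup>-\<lambda>/2\<^esup>s\<^bsup>-\<mu>/2\<^esup>P exp(\<integral>\<psi>)\<close>, where \<open>P\<close> is a monic polynomial of degree \<open>k\<close> whose roots satisfy the Bethe
equations. In the scaled coordinate \<open>w = t/a\<close> these equations say that \<open>P\<close> divides a second order
expression in \<open>P\<close>. For \<open>a = 0\<close> the solution is a Jacobi polynomial, and it is continued order by order in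
\<open>a\<close> (\<open>bethe_series_exists\<close>) because the Jacobi operator has distinct eigenvalues in degrees up to
\<open>k \<le> min \<lambda> \<mu>\<close>. The Jacobi polynomial has no root at \<open>w = 0\<close> or \<open>w = 1\<close>, so \<open>\<psi> + P'/P\<close> is regular at
both singular points.

Nothing else occurs (\<open>Op2_special_ideal_superset\<close>). \<open>L\<close> acts on
\<open>R[t]/(t\<^bsup>\<lambda>+1\<^esup>s\<^bsup>\<mu>+1\<^esup>)\<close>, which is free over \<open>A[a\<^sub>i, b\<^sub>i]\<close>. On the generic fibre the two local solutions
give a kernel of rank two (\<open>oper_kernel_vectors\<close>), so the determinant of \<open>L\<close> on the quotient by
\<open>s\<^bsup>\<mu>+1\<^esup>\<close> vanishes, and so does the determinant of \<open>L\<close> plus any matrix with one nonzero entry. These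
determinants lie in the ideal of the closure. For \<open>a = 0\<close> the matrix is
triangular: for \<open>\<mu> \<le> \<lambda>\<close> the first determinant becomes \<open>\<Prod>\<^sub>\<nu>(A\<^sub>\<nu> - c\<^bsub>-2\<^esub>)\<close> over exactly the \<open>\<nu>\<close> of the
theorem, and the others become, where \<open>c\<^bsub>-2\<^esub> = A\<^sub>\<nu>\<close>, nonzero multiples of the equation of \<open>Op\<^sub>1\<^sup>\<nu>\<close>
(\<open>corner_det_value\<close>). For \<open>\<lambda> < \<mu>\<close> the two points exchange roles. Since the numbers \<open>A\<^sub>\<nu>\<close> are distinct,
Lagrange interpolation in \<open>c\<^bsub>-2\<^esub>\<close> separates the components.\<close>

section \<open>Polynomials in infinitely many variables\<close>

lemma module_self: "Modules.module ((*) :: 'a::comm_ring_1 \<Rightarrow> 'a \<Rightarrow> 'a)"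
  by standard (auto simp: algebra_simps)

lemma ideal_gen_base: "x \<in> S \<Longrightarrow> x \<in> ideal_gen S"
  unfolding ideal_gen_def by (rule Modules.module.span_base[OF module_self])

lemma ideal_gen_zero: "0 \<in> ideal_gen S"
  unfolding ideal_gen_def by (rule Modules.module.span_zero[OF module_self])

lemma ideal_gen_add: "x \<in> ideal_gen S \<Longrightarrow> y \<in> ideal_gen S \<Longrightarrow> x + y \<in> ideal_gen S"
  unfolding ideal_gen_def by (rule Modules.module.span_add[OF module_self])

lemma ideal_gen_diff: "x \<in> ideal_gen S \<Longrightarrow> y \<in> ideal_gen S \<Longrightarrow> x - y \<in> ideal_gen S"
  unfolding ideal_gen_def by (rule Modules.module.span_diff[OF module_self])

lemma ideal_gen_mult: "x \<in> ideal_gen S \<Longrightarrow> c * x \<in> ideal_gen S"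
  unfolding ideal_gen_def by (rule Modules.module.span_scale[OF module_self])

lemma ideal_gen_sum: "(\<And>i. i \<in> X \<Longrightarrow> h i \<in> ideal_gen S) \<Longrightarrow> sum h X \<in> ideal_gen S"
  unfolding ideal_gen_def by (rule Modules.module.span_sum[OF module_self])

lemma ideal_gen_minimal:
  assumes "S \<subseteq> ideal_gen T" shows "ideal_gen S \<subseteq> ideal_gen T"
  using assms Modules.module.span_minimal[OF module_self, of S "ideal_gen T"]
    Modules.module.subspace_span[OF module_self, of T]
  by (simp add: ideal_gen_def)

lemma ideal_gen_mult_cong:
  assumes "a - b \<in> ideal_gen S" "c - d \<in> ideal_gen S"
  shows "a * c - b * d \<in> ideal_gen S"
proof -
  have "a * c - b * d = c * (a - b) + b * (c - d)" by (simp add: algebra_simps)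
  then show ?thesis using assms by (simp add: ideal_gen_add ideal_gen_mult)
qed

lemma meval_cong_ideal:
  assumes xy: "\<And>v. x v - y v \<in> ideal_gen S"
  shows "meval \<phi> x p - meval \<phi> y p \<in> ideal_gen S"
proof -
  have pow: "x v ^ n - y v ^ n \<in> ideal_gen S" for v n
    by (induction n) (auto intro!: ideal_gen_mult_cong xy ideal_gen_zero)
  have "(\<Prod>v\<in>V. x v ^ e v) - (\<Prod>v\<in>V. y v ^ e v) \<in> ideal_gen S" for V e
    by (induction V rule: infinite_finite_induct)
      (auto intro!: ideal_gen_mult_cong pow ideal_gen_zero)
  then show ?thesis
    unfolding meval_def sum_subtractf[symmetric] right_diff_distrib[symmetric]
    by (intro ideal_gen_sum ideal_gen_mult) auto
qed

lemma meval_mconst_mvar: "meval mconst mvar p = p"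
proof -
  have *: "(\<Prod>v\<in>V. mvar v ^ e v) = Poly_Mapping.single (\<Sum>v\<in>V. Poly_Mapping.single v (e v)) (1::'b)"
    if "finite V" for V :: "'a set" and e
  proof -
    have pow: "mvar v ^ k = Poly_Mapping.single (Poly_Mapping.single v k) (1::'b)" for v :: 'a and k
      by (induction k) (simp_all add: mvar_def mult_single flip: single_add)
    show ?thesis using that
    proof (induction V rule: finite_induct)
      case empty show ?case by simp
    next
      case (insert v V)
      then show ?case by (simp only: prod.insert sum.insert pow mult_single not_False_eq_True mult_1)
    qed
  qed
  have keys: "(\<Sum>v\<in>Poly_Mapping.keys m. Poly_Mapping.single v (Poly_Mapping.lookup m v)) = m"
    for m :: "'a \<Rightarrow>\<^sub>0 nat"
    by (intro poly_mapping_eqI) (auto simp: lookup_sum lookup_single when_def in_keys_iff sum.delta)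
  show ?thesis
    unfolding meval_def
    by (subst (3) mpoly_sum_single[of p], intro sum.cong refl)
      (simp add: * keys mconst_def mult_single)
qed

text \<open>Modulo the relations that identify each variable with its image, a substitution acts as the
identity. A retraction of affine space onto a subscheme is substituted in this way to compute the ideal
of the subscheme.\<close>

lemma mpoly_substitution_ideal:
  "p - meval mconst \<sigma> p \<in> ideal_gen (range (\<lambda>v. mvar v - \<sigma> v))"
  using meval_cong_ideal[of mvar \<sigma> _ mconst p] by (simp add: meval_mconst_mvar ideal_gen_base)

text \<open>A nonzero polynomial over an infinite field does not vanish at every point; the variables are
  split off one at a time.\<close>

lemma monomial_functions_independent:
  fixes c :: "('v \<Rightarrow> nat) \<Rightarrow> 'k::{idom,ring_char_0}"
  assumes "finite V" "finite K" "\<And>m v. m \<in> K \<Longrightarrow> v \<notin> V \<Longrightarrow> m v = 0"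
    and "\<And>x. (\<Sum>m\<in>K. c m * (\<Prod>v\<in>V. x v ^ m v)) = 0" and "m \<in> K"
  shows "c m = 0"
  using assms
proof (induction V arbitrary: K c m rule: finite_induct)
  case empty
  have "m' = m" if "m' \<in> K" for m'
    by (rule ext) (simp add: empty.prems(2)[OF that] empty.prems(2)[OF empty.prems(4)])
  then have "K = {m}" using empty.prems(4) by blast
  then show ?case using empty.prems(3) by simp
next
  case (insert w V)
  define r where "r m = m(w := 0)" for m :: "'v \<Rightarrow> nat"
  define K' where "K' = {m' \<in> K. m' w = m w}"
  have inj: "inj_on r K'" unfolding inj_on_def r_def K'_def
    by auto (metis fun_upd_idem fun_upd_upd)
  have restore: "(r m')(w := m w) = m'" if "m' \<in> K'" for m' using that by (auto simp: r_def K'_def)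
  have "c ((r m)(w := m w)) = 0"
  proof (rule insert.IH[where K = "r ` K'" and c = "\<lambda>m'. c (m'(w := m w))" and m = "r m"])
    show "finite (r ` K')" using insert.prems(1) by (simp add: K'_def)
    show "m' v = 0" if "m' \<in> r ` K'" "v \<notin> V" for m' v
      using that insert.prems(2) by (auto simp: r_def K'_def)
    show "r m \<in> r ` K'" using insert.prems(4) by (simp add: K'_def)
    fix x :: "'v \<Rightarrow> 'k"
    define P where "P = (\<Sum>m\<in>K. monom (c m * (\<Prod>v\<in>V. x v ^ m v)) (m w))"
    have "poly P z = 0" for z
    proof -
      have eq: "(\<Prod>v\<in>V. (x(w := z)) v ^ m v) = (\<Prod>v\<in>V. x v ^ m v)" for m :: "'v \<Rightarrow> nat"
        using insert.hyps by (intro prod.cong) auto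
      have same: "(x(w := z)) w = z" by simp
      have "poly P z = (\<Sum>m\<in>K. c m * (\<Prod>v\<in>insert w V. (x(w := z)) v ^ m v))"
        using insert.hyps
        by (simp add: P_def poly_sum poly_monom eq same mult_ac del: fun_upd_apply)
      then show ?thesis using insert.prems(3) by simp
    qed
    then have "P = 0" using poly_all_0_iff_0 by blast
    then have "0 = coeff P (m w)" by simp
    also have "\<dots> = (\<Sum>m'\<in>K. if m' w = m w then c m' * (\<Prod>v\<in>V. x v ^ m' v) else 0)"
      by (simp add: P_def coeff_sum)
    also have "\<dots> = (\<Sum>m'\<in>K'. c m' * (\<Prod>v\<in>V. x v ^ m' v))"
      using insert.prems(1) by (simp add: K'_def sum.inter_filter)
    also have "\<dots> = (\<Sum>m'\<in>K'. c ((r m')(w := m w)) * (\<Prod>v\<in>V. x v ^ r m' v))"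
      using insert.hyps
      by (intro sum.cong refl arg_cong2[where f = "(*)"] prod.cong) (auto simp: restore[unfolded r_def, simplified] r_def)
    finally show "(\<Sum>m'\<in>r ` K'. c (m'(w := m w)) * (\<Prod>v\<in>V. x v ^ m' v)) = 0"
      by (simp add: sum.reindex[OF inj])
  qed
  moreover have "m \<in> K'" using insert.prems(4) by (simp add: K'_def)
  ultimately show ?case using restore by simp
qed

lemma mpoly_eq_0_if_vanishes:
  fixes p :: "('v, 'k::{idom,ring_char_0}) mpoly"
  assumes "\<And>x. meval id x p = 0"
  shows "p = 0"
proof (rule ccontr)
  assume "p \<noteq> 0"
  define V where "V = (\<Union>m\<in>Poly_Mapping.keys p. Poly_Mapping.keys m)"
  define c where "c e = Poly_Mapping.lookup p (Abs_poly_mapping e)" for e :: "'v \<Rightarrow> nat"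
  have fin: "finite V" by (simp add: V_def)
  have cl: "c (Poly_Mapping.lookup m) = Poly_Mapping.lookup p m" for m
    by (simp add: c_def lookup_inverse)
  have inj: "inj Poly_Mapping.lookup" by (simp add: lookup_inject inj_def)
  obtain m where m: "m \<in> Poly_Mapping.keys p" using \<open>p \<noteq> 0\<close> by (auto simp flip: keys_eq_empty)
  have "c (Poly_Mapping.lookup m) = 0"
  proof (rule monomial_functions_independent[OF fin])
    show "finite (Poly_Mapping.lookup ` Poly_Mapping.keys p)" by simp
    show "Poly_Mapping.lookup m \<in> Poly_Mapping.lookup ` Poly_Mapping.keys p" using m by simp
    show "e v = 0" if "e \<in> Poly_Mapping.lookup ` Poly_Mapping.keys p" "v \<notin> V" for e v
      using that by (auto simp: V_def in_keys_iff)
    fix x :: "'v \<Rightarrow> 'k"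
    have "(\<Sum>e\<in>Poly_Mapping.lookup ` Poly_Mapping.keys p. c e * (\<Prod>v\<in>V. x v ^ e v)) =
        (\<Sum>m\<in>Poly_Mapping.keys p. Poly_Mapping.lookup p m * (\<Prod>v\<in>V. x v ^ Poly_Mapping.lookup m v))"
      by (subst sum.reindex) (auto simp: cl intro: inj_on_subset[OF inj])
    also have "\<dots> = meval id x p"
      unfolding meval_def
      by (intro sum.cong refl arg_cong2[where f = "(*)"] prod.mono_neutral_right)
        (auto simp: fin V_def in_keys_iff)
    finally show "(\<Sum>e\<in>Poly_Mapping.lookup ` Poly_Mapping.keys p. c e * (\<Prod>v\<in>V. x v ^ e v)) = 0"
      using assms by simp
  qed
  then show False using m by (simp add: cl in_keys_iff)
qed

lemma is_ring_hom_id: "is_ring_hom id" by (simp add: is_ring_hom_def)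

section \<open>Opers with one singularity\<close>

text \<open>The value that the equation of \<open>Op\<^sub>1\<^sup>\<lambda>\<close> forces on \<open>c\<^bsub>\<lambda>-1\<^esub>\<close>.\<close>

definition Op1_value :: "(complex \<Rightarrow> 'r::comm_ring_1) \<Rightarrow> nat \<Rightarrow> (int \<Rightarrow> 'r) \<Rightarrow> 'r" where
  "Op1_value \<phi> l c = (\<Sum>i<l. Op1_section \<phi> l c i * Op1_section \<phi> l c (l - 1 - i))"

text \<open>A retraction of the space of coefficient sequences onto \<open>Op\<^sub>1\<^sup>\<lambda>\<close>: the coefficients that are not
free coordinates of \<open>Op\<^sub>1\<^sup>\<lambda>\<close> are overwritten by the values that they take there.\<close>

definition Op1_retract :: "(complex \<Rightarrow> 'r::comm_ring_1) \<Rightarrow> nat \<Rightarrow> (int \<Rightarrow> 'r) \<Rightarrow> int \<Rightarrow> 'r" where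
  "Op1_retract \<phi> l c i =
     (if i < -2 then 0 else if i = -2 then \<phi> (A_coeff l) else
      if i = int l - 1 then Op1_value \<phi> l c else c i)"

lemma Op1_section_cong:
  assumes "\<And>i. -1 \<le> i \<Longrightarrow> i < int k \<Longrightarrow> c i = d i"
  shows "Op1_section \<phi> l c k = Op1_section \<phi> l d k"
  using assms
proof (induction k rule: less_induct)
  case (less k)
  have "(\<Sum>i<k. Op1_section \<phi> l c i * Op1_section \<phi> l c (k - 1 - i)) =
      (\<Sum>i<k. Op1_section \<phi> l d i * Op1_section \<phi> l d (k - 1 - i))"
    by (intro sum.cong refl arg_cong2[where f = "(*)"] less.IH less.prems) auto
  then show ?case using less.prems[of "int k - 1"]
    by (subst (1 2) Op1_section.simps) simp
qed

text \<open>The forced value depends only on the coefficients strictly between \<open>c\<^bsub>-2\<^esub>\<close> and \<open>c\<^bsub>\<lambda>-1\<^esub>\<close>, so it is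
the same before and after the retraction.\<close>

lemma Op1_value_cong:
  assumes "\<And>i. -1 \<le> i \<Longrightarrow> i < int l - 1 \<Longrightarrow> c i = d i"
  shows "Op1_value \<phi> l c = Op1_value \<phi> l d"
  unfolding Op1_value_def
  by (intro sum.cong refl arg_cong2[where f = "(*)"] Op1_section_cong assms) auto

lemma ring_hom_Op1_value:
  assumes "is_ring_hom g"
  shows "g (Op1_value \<phi> l c) = Op1_value (\<lambda>z. g (\<phi> z)) l (\<lambda>i. g (c i))"
  by (simp add: Op1_value_def is_ring_homD[OF assms] ring_hom_Op1_section[OF assms])

lemma ring_hom_Op1_retract:
  assumes "is_ring_hom g"
  shows "g (Op1_retract \<phi> l c i) = Op1_retract (\<lambda>z. g (\<phi> z)) l (\<lambda>i. g (c i)) i"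
  by (simp add: Op1_retract_def ring_hom_Op1_value[OF assms] is_ring_homD[OF assms])

lemma Op1_points_iff_retract:
  assumes "is_ring_hom \<phi>"
  shows "f \<in> Op1_points \<phi> l \<longleftrightarrow> (\<forall>i. Op1_retract \<phi> l (fls_nth f) i = fls_nth f i)"
proof -
  have "(\<forall>i. Op1_retract \<phi> l (fls_nth f) i = fls_nth f i) \<longleftrightarrow>
    (\<forall>i < -2. fls_nth f i = 0) \<and> fls_nth f (-2) = \<phi> (A_coeff l) \<and>
    fls_nth f (int l - 1) = Op1_value \<phi> l (fls_nth f)" (is "?L \<longleftrightarrow> ?R")
  proof
    assume L: ?L
    have "fls_nth f i = 0" if "i < -2" for i using L[rule_format, of i] that by (simp add: Op1_retract_def)
    then show ?R using L[rule_format, of "-2"] L[rule_format, of "int l - 1"]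
      by (simp add: Op1_retract_def)
  next
    assume ?R then show ?L by (auto simp: Op1_retract_def)
  qed
  then show ?thesis unfolding Op1_points_iff[OF assms] Op1_value_def[symmetric] by blast
qed

lemma retract_in_Op1_points:
  assumes "is_ring_hom \<phi>" "\<And>i. fls_nth f i = Op1_retract \<phi> l c i"
  shows "f \<in> Op1_points \<phi> l"
proof -
  have "Op1_value \<phi> l (fls_nth f) = Op1_value \<phi> l c"
    by (rule Op1_value_cong) (auto simp: assms(2) Op1_retract_def)
  then show ?thesis
    unfolding Op1_points_iff_retract[OF assms(1)] by (auto simp: assms(2) Op1_retract_def)
qed

text \<open>A Laurent series with given coefficients from \<open>-2\<close> on.\<close>

definition fls_of_coeffs :: "(int \<Rightarrow> 'r::comm_ring_1) \<Rightarrow> 'r fls" where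
  "fls_of_coeffs c = fls_shift 2 (fps_to_fls (Abs_fps (\<lambda>n. c (int n - 2))))"

lemma fls_of_coeffs_nth: "fls_nth (fls_of_coeffs c) i = (if i < -2 then 0 else c i)"
  by (simp add: fls_of_coeffs_def)

lemma fls_of_retract_nth: "fls_nth (fls_of_coeffs (Op1_retract \<phi> l c)) i = Op1_retract \<phi> l c i"
  by (simp add: fls_of_coeffs_nth Op1_retract_def)

text \<open>The coordinate function \<open>c\<^sub>i\<close>, extended by zero to \<open>i < -N\<close>.\<close>

definition Op1_var :: "nat \<Rightarrow> int \<Rightarrow> (nat, complex) mpoly" where
  "Op1_var N i = (if i < - int N then 0 else mvar (nat (i + int N)))"

lemma meval_Op1_var:
  assumes "is_ring_hom \<phi>" "\<And>i. i < - int N \<Longrightarrow> c i = 0"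
  shows "meval \<phi> (\<lambda>n. c (int n - int N)) (Op1_var N i) = c i"
  using assms by (simp add: Op1_var_def meval_mvar is_ring_homD[OF is_ring_hom_meval])

lemma Op1_retract_in_ideal:
  assumes N: "N \<ge> 2"
  shows "Op1_var N i - Op1_retract mconst l (Op1_var N) i \<in> Op1_ideal N l"
proof -
  have "meval mconst (Op1_coord N f) (Op1_var N i - Op1_retract mconst l (Op1_var N) i) = 0"
    if f: "f = Op1_elem mconst l \<psi>" for f and \<psi> :: "(nat, complex) mpoly fps"
  proof -
    have pt: "f \<in> Op1_points mconst l" by (simp add: Op1_points_def f)
    have z: "fls_nth f i = 0" if "i < - int N" for i using that N by (simp add: f Op1_elem_nth)
    have "meval mconst (Op1_coord N f) (Op1_var N i) = fls_nth f i" for i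
      unfolding Op1_coord_def[abs_def] by (rule meval_Op1_var[OF is_ring_hom_mconst z])
    then show ?thesis
      using pt unfolding Op1_points_iff_retract[OF is_ring_hom_mconst]
      by (simp add: is_ring_homD[OF is_ring_hom_meval[OF is_ring_hom_mconst]]
          ring_hom_Op1_retract[OF is_ring_hom_meval[OF is_ring_hom_mconst]]
          meval_mconst[OF is_ring_hom_mconst])
  qed
  then show ?thesis by (auto simp: Op1_ideal_def)
qed

text \<open>Complex points suffice: a polynomial evaluated at the universal \<open>\<psi>\<close> is a polynomial over \<open>\<complex>\<close> in
the coefficients of \<open>\<psi>\<close>, which is zero once it vanishes at all complex values of them.\<close>

lemma Op1_ideal_iff:
  assumes N: "N \<ge> 2"
  shows "q \<in> Op1_ideal N l \<longleftrightarrow> (\<forall>f\<in>Op1_points id l. meval id (Op1_coord N f) q = 0)"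
proof
  assume "q \<in> Op1_ideal N l"
  moreover have "fls_nth f i = 0" if "f \<in> Op1_points id l" "i < - int N" for f :: "complex fls" and i
    using that N by (simp add: Op1_points_iff[OF is_ring_hom_id])
  ultimately show "\<forall>f\<in>Op1_points id l. meval id (Op1_coord N f) q = 0"
    using Op1_ideal_points[OF is_ring_hom_id N] by blast
next
  assume *: "\<forall>f\<in>Op1_points id l. meval id (Op1_coord N f) q = 0"
  have "meval mconst (Op1_coord N (Op1_elem mconst l \<psi>)) q = 0" for \<psi> :: "(nat, complex) mpoly fps"
  proof (rule mpoly_eq_0_if_vanishes)
    fix x :: "nat \<Rightarrow> complex"
    define g where "g = meval id x"
    have g: "is_ring_hom g" unfolding g_def by (rule is_ring_hom_meval[OF is_ring_hom_id])
    have gc: "g (mconst z) = z" for z by (simp add: g_def meval_mconst[OF is_ring_hom_id])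
    define f where "f = fls_of_coeffs (\<lambda>i. g (fls_nth (Op1_elem mconst l \<psi>) i))"
    have f: "fls_nth f i = g (fls_nth (Op1_elem mconst l \<psi>) i)" for i
      by (simp add: f_def fls_of_coeffs_nth Op1_elem_nth is_ring_homD(4)[OF g])
    have "Op1_elem mconst l \<psi> \<in> Op1_points mconst l" by (simp add: Op1_points_def)
    then have "g (Op1_retract mconst l (fls_nth (Op1_elem mconst l \<psi>)) i) =
        g (fls_nth (Op1_elem mconst l \<psi>) i)" for i
      unfolding Op1_points_iff_retract[OF is_ring_hom_mconst] by simp
    then have "f \<in> Op1_points id l"
      unfolding Op1_points_iff_retract[OF is_ring_hom_id] f
      by (simp add: ring_hom_Op1_retract[OF g] gc id_def)
    then have "meval id (Op1_coord N f) q = 0" using * by blast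
    then show "meval id x (meval mconst (Op1_coord N (Op1_elem mconst l \<psi>)) q) = 0"
      unfolding g_def[symmetric] by (simp add: ring_hom_meval[OF g] gc Op1_coord_def[abs_def] f id_def)
  qed
  then show "q \<in> Op1_ideal N l" by (simp add: Op1_ideal_def)
qed

text \<open>Substituting the retraction into \<open>q\<close> gives a polynomial whose values are values of \<open>q\<close> on
\<open>Op\<^sub>1\<^sup>\<lambda>\<close>, hence the zero polynomial; the difference from \<open>q\<close> lies in the ideal of the relations.\<close>

lemma Op1_ideal_generators:
  assumes N: "N \<ge> 2" and q: "q \<in> Op1_ideal N l"
  shows "q \<in> ideal_gen (range (\<lambda>n. mvar n - Op1_retract mconst l (Op1_var N) (int n - int N)))"
proof -
  define \<sigma> where "\<sigma> n = Op1_retract mconst l (Op1_var N) (int n - int N)" for n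
  have "meval mconst \<sigma> q = 0"
  proof (rule mpoly_eq_0_if_vanishes)
    fix x :: "nat \<Rightarrow> complex"
    define g where "g = meval id x"
    have g: "is_ring_hom g" unfolding g_def by (rule is_ring_hom_meval[OF is_ring_hom_id])
    have gc: "g (mconst z) = z" for z by (simp add: g_def meval_mconst[OF is_ring_hom_id])
    define f where "f = fls_of_coeffs (Op1_retract id l (\<lambda>i. g (Op1_var N i)))"
    have "f \<in> Op1_points id l"
      by (rule retract_in_Op1_points[OF is_ring_hom_id]) (simp add: f_def fls_of_retract_nth)
    then have "meval id (Op1_coord N f) q = 0" using q Op1_ideal_iff[OF N] by blast
    then show "meval id x (meval mconst \<sigma> q) = 0"
      unfolding g_def[symmetric]
      by (simp add: ring_hom_meval[OF g] gc Op1_coord_def[abs_def] f_def fls_of_retract_nth \<sigma>_def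
          ring_hom_Op1_retract[OF g] id_def)
  qed
  then show ?thesis using mpoly_substitution_ideal[of q \<sigma>] by (simp add: \<sigma>_def)
qed

section \<open>Opers with two singularities over the generic point\<close>

lemma fls_X_powi_times_nth:
  fixes g :: "'k::field fls"
  shows "fls_nth (fls_X powi j * g) i = fls_nth g (i - j)"
proof -
  have "fls_X powi j = (fls_X_intpow j :: 'k fls)" by (simp add: fls_X_power_int)
  then show ?thesis by (simp add: fls_X_intpow_times_conv_shift)
qed

lemma fls_powi_unit_nth:
  fixes h :: "'k::field fps"
  assumes "h $ 0 \<noteq> 0"
  shows "fls_nth (fps_to_fls h powi j) 0 = (h $ 0) powi j" "i < 0 \<Longrightarrow> fls_nth (fps_to_fls h powi j) i = 0"
proof -
  have "\<exists>g. fps_to_fls h powi j = fps_to_fls g \<and> g $ 0 = (h $ 0) powi j"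
  proof (cases "j \<ge> 0")
    case True
    have "fps_to_fls h powi j = fps_to_fls (h ^ nat j)"
      using True by (simp add: power_int_def fps_to_fls_power)
    then show ?thesis using True by (intro exI[of _ "h ^ nat j"]) (simp add: power_int_def fps_nth_power_0)
  next
    case False
    have "fps_to_fls h powi j = fps_to_fls (inverse h ^ nat (- j))"
      using False assms by (simp add: power_int_def fps_to_fls_power fls_inverse_fps_to_fls)
    then show ?thesis using False
      by (intro exI[of _ "inverse h ^ nat (- j)"]) (simp add: power_int_def fps_nth_power_0)
  qed
  then show "fls_nth (fps_to_fls h powi j) 0 = (h $ 0) powi j"
    "i < 0 \<Longrightarrow> fls_nth (fps_to_fls h powi j) i = 0" by auto
qed

lemma Op2_basis_leading_coeffs:
  "fls_nth (Et_u j) j = (- fls_X) powi j" "fls_nth (Et_v j) j = (- fls_X) powi (j + 1)"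
  "fls_nth (Es_u j) j = fls_X powi j" "fls_nth (Es_v j) j = 0"
proof -
  have m: "fls_X - fls_const fls_X = fps_to_fls (fps_X - fps_const fls_X :: complex fls fps)"
    and p: "fls_X + fls_const fls_X = fps_to_fls (fps_X + fps_const fls_X :: complex fls fps)"
    by simp_all
  show "fls_nth (Et_u j) j = (- fls_X) powi j" "fls_nth (Et_v j) j = (- fls_X) powi (j + 1)"
    unfolding Et_u_def Et_v_def m
    by (simp_all only: fls_X_powi_times_nth) (simp_all add: fls_powi_unit_nth del: fps_to_fls_minus)
  show "fls_nth (Es_u j) j = fls_X powi j" "fls_nth (Es_v j) j = 0"
    unfolding Es_u_def Es_v_def p mult.commute[of _ "fls_X powi _"]
    by (simp_all only: fls_X_powi_times_nth)
      (simp_all add: fls_powi_unit_nth fls_X_power_int del: fps_to_fls_plus)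
qed

lemma Op2_expand_nth:
  "fls_nth (Op2_expand U V \<phi> x) (int m - 2) = (\<Sum>n\<le>m.
      \<phi> (fls_nth (U (int n - 2)) (int m - 2)) * x (Avar n) +
      \<phi> (fls_nth (V (int n - 2)) (int m - 2)) * x (Bvar n))"
  by (simp add: Op2_expand_def)

lemma Op2_expand_diff:
  "fls_nth (Op2_expand U V \<phi> (\<lambda>v. x v - y v)) (int m - 2) =
    fls_nth (Op2_expand U V \<phi> x) (int m - 2) - fls_nth (Op2_expand U V \<phi> y) (int m - 2)"
  by (simp add: Op2_expand_nth sum_subtractf algebra_simps sum.distrib)

lemma ring_hom_Op2_expand:
  assumes "is_ring_hom g"
  shows "g (fls_nth (Op2_expand U V \<phi> x) (int m - 2)) =
    fls_nth (Op2_expand U V (\<lambda>z. g (\<phi> z)) (\<lambda>v. g (x v))) (int m - 2)"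
  by (simp add: Op2_expand_nth is_ring_homD[OF assms])

text \<open>The part of the coefficient of order \<open>m - 2\<close> that comes from \<open>a\<^sub>i\<close>, \<open>b\<^sub>i\<close> with \<open>i < m - 2\<close>.\<close>

definition Op2_lower ::
  "(int \<Rightarrow> complex fls fls) \<Rightarrow> (int \<Rightarrow> complex fls fls) \<Rightarrow>
     (complex fls \<Rightarrow> 'r::comm_ring_1) \<Rightarrow> (op2_var \<Rightarrow> 'r) \<Rightarrow> nat \<Rightarrow> 'r" where
  "Op2_lower U V \<phi> x m = (\<Sum>n<m.
      \<phi> (fls_nth (U (int n - 2)) (int m - 2)) * x (Avar n) +
      \<phi> (fls_nth (V (int n - 2)) (int m - 2)) * x (Bvar n))"

lemma Op2_expand_split:
  assumes "is_ring_hom \<phi>"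
  shows "fls_nth (E_t \<phi> x) (int m - 2) = Op2_lower Et_u Et_v \<phi> x m +
      \<phi> ((- fls_X) powi (int m - 2)) * x (Avar m) + \<phi> ((- fls_X) powi (int m - 1)) * x (Bvar m)"
    "fls_nth (E_s \<phi> x) (int m - 2) = Op2_lower Es_u Es_v \<phi> x m +
      \<phi> (fls_X powi (int m - 2)) * x (Avar m)"
  by (simp_all add: Op2_expand_nth Op2_lower_def lessThan_Suc_atMost[symmetric]
      Op2_basis_leading_coeffs is_ring_homD(4)[OF assms] add.assoc)

lemma Op2_lower_cong:
  "(\<And>n. n < m \<Longrightarrow> x (Avar n) = y (Avar n) \<and> x (Bvar n) = y (Bvar n)) \<Longrightarrow>
    Op2_lower U V \<phi> x m = Op2_lower U V \<phi> y m"
  unfolding Op2_lower_def by (intro sum.cong) auto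

lemma ring_hom_powi_inverse:
  assumes "is_ring_hom (\<phi> :: 'k::field \<Rightarrow> 'r::comm_ring_1)" "z \<noteq> 0"
  shows "\<phi> (z powi i) * \<phi> (z powi (- i)) = 1"
proof -
  have "z powi i * z powi (- i) = 1" using assms(2) by (simp add: power_int_minus)
  then show ?thesis by (metis is_ring_homD(1,3)[OF assms(1)])
qed

text \<open>Over a \<open>Q\<close>-algebra the two expansions together are bijective: at each order the coefficients
  \<open>a\<^sub>i\<close>, \<open>b\<^sub>i\<close> enter through an invertible \<open>2 \<times> 2\<close> matrix.\<close>

lemma Op2_expand_surj:
  assumes \<phi>: "is_ring_hom (\<phi> :: complex fls \<Rightarrow> 'r::comm_ring_1)"
  shows "\<exists>x. \<forall>m. fls_nth (E_t \<phi> x) (int m - 2) = \<alpha> m \<and> fls_nth (E_s \<phi> x) (int m - 2) = \<beta> m"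
proof -
  define pt :: "(nat \<Rightarrow> 'r \<times> 'r) \<Rightarrow> op2_var \<Rightarrow> 'r" where
    "pt f v = (case v of Avar n \<Rightarrow> fst (f n) | Bvar n \<Rightarrow> snd (f n))" for f v
  define P where "P f m r \<longleftrightarrow> Op2_lower Et_u Et_v \<phi> (pt f) m +
      \<phi> ((- fls_X) powi (int m - 2)) * fst r + \<phi> ((- fls_X) powi (int m - 1)) * snd r = \<alpha> m \<and>
      Op2_lower Es_u Es_v \<phi> (pt f) m + \<phi> (fls_X powi (int m - 2)) * fst r = \<beta> m"
    for f :: "nat \<Rightarrow> 'r \<times> 'r" and m :: nat and r :: "'r \<times> 'r"
  have "\<exists>f. \<forall>m. P f m (f m)"
  proof (rule dependent_wf_choice[OF wf_less_than])
    fix f g :: "nat \<Rightarrow> 'r \<times> 'r" and m r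
    assume "\<And>n. (n, m) \<in> less_than \<Longrightarrow> f n = g n"
    then have "Op2_lower U V \<phi> (pt f) m = Op2_lower U V \<phi> (pt g) m" for U V
      by (intro Op2_lower_cong) (simp add: pt_def)
    then show "P f m r = P g m r" by (simp add: P_def)
  next
    fix m and f :: "nat \<Rightarrow> 'r \<times> 'r"
    define u where "u = \<phi> (fls_X powi - (int m - 2)) * (\<beta> m - Op2_lower Es_u Es_v \<phi> (pt f) m)"
    define v where "v = \<phi> ((- fls_X) powi - (int m - 1)) * (\<alpha> m - Op2_lower Et_u Et_v \<phi> (pt f) m -
       \<phi> ((- fls_X) powi (int m - 2)) * u)"
    have "P f m (u, v)"
      using ring_hom_powi_inverse[OF \<phi>, of fls_X "int m - 2"]
        ring_hom_powi_inverse[OF \<phi>, of "- fls_X" "int m - 1"]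
      by (simp add: P_def u_def v_def flip: mult.assoc)
    then show "\<exists>r. P f m r" ..
  qed
  then obtain f where "\<forall>m. P f m (f m)" ..
  then show ?thesis
    by (intro exI[of _ "pt f"]) (auto simp: Op2_expand_split[OF \<phi>] P_def, auto simp: pt_def)
qed

text \<open>The same triangular system, now solved modulo an ideal: the two expansions together are injective
on the coefficients.\<close>

lemma Op2_expand_in_ideal:
  assumes \<phi>: "is_ring_hom (\<phi> :: complex fls \<Rightarrow> 'r::comm_ring_1)"
    and t: "\<And>m. fls_nth (E_t \<phi> x) (int m - 2) \<in> ideal_gen S"
    and s: "\<And>m. fls_nth (E_s \<phi> x) (int m - 2) \<in> ideal_gen S"
  shows "x v \<in> ideal_gen S"
proof -
  have solve: "c = w * (e - L)" if "z * w = 1" "e = L + z * c" for z w c e L :: 'r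
  proof -
    have "w * (e - L) = (z * w) * c" using that(2) by (simp add: mult_ac)
    then show ?thesis using that(1) by simp
  qed
  have "x (Avar m) \<in> ideal_gen S \<and> x (Bvar m) \<in> ideal_gen S" for m
  proof (induction m rule: less_induct)
    case (less m)
    have low: "Op2_lower U V \<phi> x m \<in> ideal_gen S" for U V
      unfolding Op2_lower_def
      by (intro ideal_gen_sum ideal_gen_add ideal_gen_mult) (auto simp: less.IH)
    have "x (Avar m) = \<phi> (fls_X powi - (int m - 2)) *
        (fls_nth (E_s \<phi> x) (int m - 2) - Op2_lower Es_u Es_v \<phi> x m)"
      by (rule solve[OF ring_hom_powi_inverse[OF \<phi>] Op2_expand_split(2)[OF \<phi>]]) simp
    then have A: "x (Avar m) \<in> ideal_gen S"
      by (metis ideal_gen_mult ideal_gen_diff s low)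
    have "x (Bvar m) = \<phi> ((- fls_X) powi - (int m - 1)) *
        (fls_nth (E_t \<phi> x) (int m - 2) - Op2_lower Et_u Et_v \<phi> x m -
          \<phi> ((- fls_X) powi (int m - 2)) * x (Avar m))"
      by (rule solve[OF ring_hom_powi_inverse[OF \<phi>]]) (simp_all add: Op2_expand_split[OF \<phi>])
    then have "x (Bvar m) \<in> ideal_gen S"
      by (metis ideal_gen_mult ideal_gen_diff t low A)
    with A show ?case ..
  qed
  then show ?thesis by (cases v) auto
qed

text \<open>The retractions at the two points correspond, through the bijectivity of the expansions, to a
substitution \<open>\<sigma>\<close> of the \<open>a\<^sub>i\<close>, \<open>b\<^sub>i\<close>. It is trivial modulo the ideal, and it maps all of affine space to
\<open>Op\<^sub>t\<^sup>\<lambda> \<times> Op\<^sub>s\<^sup>\<mu>\<close>; so a polynomial that vanishes there over \<open>Q\<close> becomes zero under \<open>\<sigma>\<close>.\<close>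

lemma Op2_generic_ideal_iff:
  "p \<in> Op2_generic_ideal l m \<longleftrightarrow>
    (\<forall>x. E_t id x \<in> Op1_points fls_const l \<and> E_s id x \<in> Op1_points fls_const m \<longrightarrow> meval id x p = 0)"
    (is "_ \<longleftrightarrow> ?R")
proof
  assume "p \<in> Op2_generic_ideal l m"
  then show ?R using Op2_generic_ideal_points[OF is_ring_hom_id, of l m] by auto
next
  assume R: ?R
  let ?P = "\<lambda>z. mconst (fls_const z) :: (op2_var, complex fls) mpoly"
  let ?I = "Op2_generic_ideal l m"
  have P: "is_ring_hom ?P" by (rule is_ring_hom_comp[OF is_ring_hom_fls_const is_ring_hom_mconst])
  define et where "et = fls_nth (E_t mconst mvar)"
  define es where "es = fls_nth (E_s mconst mvar)"
  obtain \<sigma> where \<sigma>: "\<And>k. fls_nth (E_t mconst \<sigma>) (int k - 2) = Op1_retract ?P l et (int k - 2)"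
      "\<And>k. fls_nth (E_s mconst \<sigma>) (int k - 2) = Op1_retract ?P m es (int k - 2)"
    using Op2_expand_surj[OF is_ring_hom_mconst, of "\<lambda>k. Op1_retract ?P l et (int k - 2)"
        "\<lambda>k. Op1_retract ?P m es (int k - 2)"] by blast
  have ev: "meval ?P (Op1_coord 2 f) (Op1_var 2 i - Op1_retract mconst k (Op1_var 2) i) =
      fls_nth f i - Op1_retract ?P k (fls_nth f) i" if "\<And>i. i < -2 \<Longrightarrow> fls_nth f i = 0" for f k i
  proof -
    have "meval ?P (Op1_coord 2 f) (Op1_var 2 i) = fls_nth f i" for i
      unfolding Op1_coord_def[abs_def] by (rule meval_Op1_var[OF P]) (use that in simp)
    then show ?thesis
      by (simp add: is_ring_homD[OF is_ring_hom_meval[OF P]]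
          ring_hom_Op1_retract[OF is_ring_hom_meval[OF P]] meval_mconst[OF P])
  qed
  have t: "et i - Op1_retract ?P l et i \<in> ?I" for i
  proof -
    have "et i - Op1_retract ?P l et i =
        meval ?P (Op1_coord 2 (E_t mconst mvar)) (Op1_var 2 i - Op1_retract mconst l (Op1_var 2) i)"
      unfolding et_def by (rule ev[symmetric]) (rule Op2_expand_nth_lt)
    then show ?thesis unfolding Op2_generic_ideal_def
      by (intro ideal_gen_base UnI1) (auto intro!: imageI Op1_retract_in_ideal)
  qed
  have s: "es i - Op1_retract ?P m es i \<in> ?I" for i
  proof -
    have "es i - Op1_retract ?P m es i =
        meval ?P (Op1_coord 2 (E_s mconst mvar)) (Op1_var 2 i - Op1_retract mconst m (Op1_var 2) i)"
      unfolding es_def by (rule ev[symmetric]) (rule Op2_expand_nth_lt)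
    then show ?thesis unfolding Op2_generic_ideal_def
      by (intro ideal_gen_base UnI2) (auto intro!: imageI Op1_retract_in_ideal)
  qed
  have "mvar v - \<sigma> v \<in> ?I" for v
    unfolding Op2_generic_ideal_def
    by (rule Op2_expand_in_ideal[OF is_ring_hom_mconst])
      (use t s in \<open>simp_all add: Op2_expand_diff \<sigma> flip: et_def es_def Op2_generic_ideal_def\<close>)
  then have "p - meval mconst \<sigma> p \<in> ?I"
    using mpoly_substitution_ideal[of p \<sigma>]
      ideal_gen_minimal[of "range (\<lambda>v. mvar v - \<sigma> v)"] unfolding Op2_generic_ideal_def by blast
  moreover have "meval mconst \<sigma> p = 0"
  proof (rule mpoly_eq_0_if_vanishes)
    fix x :: "op2_var \<Rightarrow> complex fls"
    define g where "g = meval id x"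
    have g: "is_ring_hom g" unfolding g_def by (rule is_ring_hom_meval[OF is_ring_hom_id])
    have gc: "g (mconst z) = z" for z by (simp add: g_def meval_mconst[OF is_ring_hom_id])
    define y where "y v = g (\<sigma> v)" for v
    have y: "fls_nth (Op2_expand U V id y) (int k - 2) = g (fls_nth (Op2_expand U V mconst \<sigma>) (int k - 2))"
      for U V k by (simp add: ring_hom_Op2_expand[OF g] gc y_def[abs_def] id_def)
    have pt: "Op2_expand U V id y \<in> Op1_points fls_const k"
      if "\<And>n. fls_nth (Op2_expand U V mconst \<sigma>) (int n - 2) = Op1_retract ?P k c (int n - 2)"
      for U V k c
    proof (rule retract_in_Op1_points[OF is_ring_hom_fls_const])
      fix i
      show "fls_nth (Op2_expand U V id y) i = Op1_retract fls_const k (\<lambda>i. g (c i)) i"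
      proof (cases "i < -2")
        case True then show ?thesis by (simp add: Op2_expand_nth_lt Op1_retract_def)
      next
        case False
        then have i: "i = int (nat (i + 2)) - 2" by simp
        show ?thesis
          by (subst (1 2) i) (simp only: y that ring_hom_Op1_retract[OF g] gc)
      qed
    qed
    have "meval id y p = 0" using R pt[OF \<sigma>(1)] pt[OF \<sigma>(2)] by blast
    then show "meval id x (meval mconst \<sigma> p) = 0"
      unfolding g_def[symmetric] by (simp add: ring_hom_meval[OF g] gc y_def[abs_def] id_def)
  qed
  ultimately show "p \<in> ?I" by simp
qed

lemma is_ring_hom_fps_to_fls: "is_ring_hom (fps_to_fls :: 'a::comm_ring_1 fps \<Rightarrow> 'a fls)"
  by (simp add: is_ring_hom_def fls_times_fps_to_fls)

lemma Op2_ideal_iff: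
  "p \<in> Op2_ideal l m \<longleftrightarrow>
    (\<forall>x. E_t id x \<in> Op1_points fls_const l \<and> E_s id x \<in> Op1_points fls_const m \<longrightarrow>
      meval fps_to_fls x p = 0)"
proof -
  have "meval id x (meval (\<lambda>z. mconst (fps_to_fls z)) mvar p) = meval fps_to_fls x p" for x
    by (simp add: ring_hom_meval[OF is_ring_hom_meval[OF is_ring_hom_id]]
        meval_mconst[OF is_ring_hom_id] meval_mvar[OF is_ring_hom_id])
  then show ?thesis by (simp add: Op2_ideal_def Op2_generic_ideal_iff)
qed

no_notation vec_index (infixl "$" 100)

section \<open>The Riccati equation at the two singular points\<close>

lemma fls_X_inv_mult_X: "fls_X_inv * fls_X = (1 :: 'k::comm_ring_1 fls)"
  by (rule fls_eqI) (simp add: fls_X_inv_times_conv_shift)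

text \<open>\<open>\<Sum>\<^sub>n (\<alpha>\<^sub>n + \<beta>\<^sub>n s)(ts)\<^sup>n\<close> in the local coordinate at one of the singular points. The composition is
defined because \<open>Z = ts\<close> vanishes at that point.\<close>

definition pair_series :: "'k::comm_ring_1 fps \<Rightarrow> 'k fps \<Rightarrow> (nat \<Rightarrow> 'k) \<Rightarrow> (nat \<Rightarrow> 'k) \<Rightarrow> 'k fps" where
  "pair_series Z S \<alpha> \<beta> = (Abs_fps \<alpha> oo Z) + S * (Abs_fps \<beta> oo Z)"

lemma fps_compose_nth_truncate:
  fixes F Z :: "'k::comm_ring_1 fps"
  assumes "Z $ 0 = 0" "i \<le> m"
  shows "(F oo Z) $ i = (\<Sum>n\<le>m. fps_const (F $ n) * Z ^ n) $ i"
proof -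
  have "Z ^ n $ i = 0" if "i < n" for n using startsby_zero_power_prefix[OF assms(1)] that by blast
  then have "(\<Sum>n\<in>{0..i}. F $ n * (Z ^ n $ i)) = (\<Sum>n\<le>m. F $ n * (Z ^ n $ i))"
    using assms(2) by (intro sum.mono_neutral_left) auto
  then show ?thesis by (simp add: fps_compose_nth fps_sum_nth)
qed

lemma pair_series_nth_truncate:
  fixes Z :: "'k::comm_ring_1 fps"
  assumes "Z $ 0 = 0" "i \<le> m"
  shows "pair_series Z S \<alpha> \<beta> $ i = (\<Sum>n\<le>m. (fps_const (\<alpha> n) + fps_const (\<beta> n) * S) * Z ^ n) $ i"
proof -
  have "(S * (Abs_fps \<beta> oo Z)) $ i = (S * (\<Sum>n\<le>m. fps_const (\<beta> n) * Z ^ n)) $ i"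
    unfolding fps_mult_nth
    by (intro sum.cong refl arg_cong2[where f = "(*)"])
      (use assms(2) in \<open>simp add: fps_compose_nth_truncate[OF assms(1), of _ m]\<close>)
  then have "pair_series Z S \<alpha> \<beta> $ i =
      ((\<Sum>n\<le>m. fps_const (\<alpha> n) * Z ^ n) + S * (\<Sum>n\<le>m. fps_const (\<beta> n) * Z ^ n)) $ i"
    by (simp add: pair_series_def fps_compose_nth_truncate[OF assms])
  also have "(\<Sum>n\<le>m. fps_const (\<alpha> n) * Z ^ n) + S * (\<Sum>n\<le>m. fps_const (\<beta> n) * Z ^ n) =
      (\<Sum>n\<le>m. (fps_const (\<alpha> n) + fps_const (\<beta> n) * S) * Z ^ n)"
    by (simp only: sum_distrib_left sum.distrib[symmetric]) (simp add: algebra_simps)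
  finally show ?thesis .
qed

lemma pair_series_Suc:
  fixes Z :: "'k::idom fps"
  assumes "Z $ 0 = 0"
  shows "pair_series Z S \<alpha> \<beta> =
    fps_const (\<alpha> 0) + fps_const (\<beta> 0) * S + Z * pair_series Z S (\<lambda>n. \<alpha> (Suc n)) (\<lambda>n. \<beta> (Suc n))"
proof -
  have *: "Abs_fps \<gamma> oo Z = fps_const (\<gamma> 0) + Z * (Abs_fps (\<lambda>n. \<gamma> (Suc n)) oo Z)" for \<gamma> :: "nat \<Rightarrow> 'k"
  proof -
    have "Abs_fps \<gamma> = fps_const (\<gamma> 0) + fps_X * Abs_fps (\<lambda>n. \<gamma> (Suc n))"
      by (rule fps_ext) (auto simp: fps_X_mult_nth)
    then have "Abs_fps \<gamma> oo Z = (fps_const (\<gamma> 0) + fps_X * Abs_fps (\<lambda>n. \<gamma> (Suc n))) oo Z" by simp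
    then show ?thesis
      by (simp add: fps_compose_add_distrib fps_compose_mult_distrib[OF assms]
          fps_X_fps_compose_startby0[OF assms])
  qed
  show ?thesis
    unfolding pair_series_def *[of \<alpha>] *[of \<beta>] by (simp add: algebra_simps)
qed

text \<open>Division by \<open>(ts)\<^sup>2\<close> turns \<open>(ts)\<^sup>n\<close> and \<open>(ts)\<^sup>n s\<close> into \<open>u\<^bsub>n-2\<^esub>\<close> and \<open>v\<^bsub>n-2\<^esub>\<close>, of which only those
with \<open>n \<le> m\<close> contribute to order \<open>m - 2\<close>.\<close>

lemma Op2_expand_eq_pair_series:
  fixes T S :: "complex fls fps"
  assumes Z: "T * S = fps_X * z" "z $ 0 \<noteq> 0"
    and U: "\<And>j. U j = fps_to_fls T powi j * fps_to_fls S powi j"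
    and V: "\<And>j. V j = fps_to_fls T powi j * fps_to_fls S powi (j + 1)"
  shows "Op2_expand U V id x * (fps_to_fls (T * S))\<^sup>2 =
    fps_to_fls (pair_series (T * S) S (\<lambda>n. x (Avar n)) (\<lambda>n. x (Bvar n)))"
proof -
  define y where "y = (inverse z)\<^sup>2"
  define Y where "Y = fls_shift 2 (fps_to_fls y)"
  let ?F = "pair_series (T * S) S (\<lambda>n. x (Avar n)) (\<lambda>n. x (Bvar n))"
  have z0: "z \<noteq> 0" using Z(2) by auto
  have TS: "T \<noteq> 0" "S \<noteq> 0" using Z(1) z0 by auto
  have nz: "fps_to_fls T \<noteq> 0" "fps_to_fls S \<noteq> 0" using TS by simp_all
  have Y: "Y * (fps_to_fls (T * S))\<^sup>2 = 1"
  proof -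
    have 1: "(fps_to_fls (T * S))\<^sup>2 = fls_X\<^sup>2 * fps_to_fls (z\<^sup>2)"
      by (simp add: Z(1) fls_times_fps_to_fls fps_to_fls_power power_mult_distrib)
    have 2: "Y = fls_X_inv\<^sup>2 * fps_to_fls y"
      by (simp add: Y_def fls_X_inv_power_times_conv_shift)
    have 3: "fls_X_inv\<^sup>2 * fls_X\<^sup>2 = (1 :: complex fls fls)"
      by (simp add: fls_X_inv_mult_X flip: power_mult_distrib)
    have 4: "fps_to_fls y * fps_to_fls (z\<^sup>2) = 1"
      using Z(2) by (simp add: y_def inverse_mult_eq_1 flip: fls_times_fps_to_fls power_mult_distrib)
    have "Y * (fps_to_fls (T * S))\<^sup>2 =
        (fls_X_inv\<^sup>2 * fls_X\<^sup>2) * (fps_to_fls y * fps_to_fls (z\<^sup>2))"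
      unfolding 1 2 by (simp only: mult_ac)
    then show ?thesis unfolding 3 4 by simp
  qed
  have "Y = inverse ((fps_to_fls (T * S))\<^sup>2)" using Y by (simp add: inverse_unique mult.commute)
  then have Y2: "Y = fps_to_fls T powi (-2) * fps_to_fls S powi (-2)"
    by (simp add: fls_times_fps_to_fls power_int_minus power_mult_distrib)
  have UY: "U (int n - 2) = fps_to_fls ((T * S) ^ n) * Y"
    "V (int n - 2) = fps_to_fls (S * (T * S) ^ n) * Y" for n
  proof -
    have p: "c powi (int n - 2) = c ^ n * c powi (-2)" "c powi (int n - 2 + 1) = c * (c ^ n * c powi (-2))"
      if "c \<noteq> 0" for c :: "complex fls fls"
      using that power_int_add[of c "int n" "-2"] power_int_add_1'[of c "int n - 2"] by simp_all
    show "U (int n - 2) = fps_to_fls ((T * S) ^ n) * Y"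
      "V (int n - 2) = fps_to_fls (S * (T * S) ^ n) * Y"
      unfolding U V p[OF nz(1)] p[OF nz(2)] Y2
      by (simp_all only: fls_times_fps_to_fls fps_to_fls_power power_mult_distrib mult_ac)
  qed
  have nth: "fls_nth (fps_to_fls F * Y) (int m - 2) = (F * y) $ m" for F m
    by (simp add: Y_def fls_shifted_times_simps flip: fls_times_fps_to_fls)
  have "fls_nth (Op2_expand U V id x) i = fls_nth (fps_to_fls ?F * Y) i" for i
  proof (cases "i < -2")
    case True
    then show ?thesis by (simp add: Op2_expand_nth_lt Y_def fls_shifted_times_simps flip: fls_times_fps_to_fls)
  next
    case False
    define m where "m = nat (i + 2)"
    have i: "i = int m - 2" using False by (simp add: m_def)
    let ?G = "\<Sum>n\<le>m. (fps_const (x (Avar n)) + fps_const (x (Bvar n)) * S) * (T * S) ^ n"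
    have "(?F * y) $ m = (?G * y) $ m"
      unfolding fps_mult_nth
      by (intro sum.cong refl arg_cong2[where f = "(*)"] pair_series_nth_truncate) (auto simp: Z(1))
    also have "\<dots> = fls_nth (fps_to_fls ?G * Y) (int m - 2)" by (simp add: nth)
    also have "fps_to_fls ?G * Y =
        (\<Sum>n\<le>m. fls_const (x (Avar n)) * U (int n - 2) + fls_const (x (Bvar n)) * V (int n - 2))"
      unfolding is_ring_homD(8)[OF is_ring_hom_fps_to_fls] sum_distrib_right
      by (intro sum.cong refl) (simp add: UY fls_times_fps_to_fls algebra_simps)
    also have "fls_nth \<dots> (int m - 2) = fls_nth (Op2_expand U V id x) (int m - 2)"
      by (simp add: Op2_expand_nth fls_nth_sum mult.commute)
    finally show ?thesis by (simp add: i nth)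
  qed
  then have "Op2_expand U V id x = fps_to_fls ?F * Y" by (rule fls_eqI)
  then show ?thesis using Y by (simp add: mult.assoc)
qed

text \<open>The number \<open>A\<^sub>\<lambda>\<close> in an arbitrary field of characteristic 0.\<close>

definition oper_exponent :: "nat \<Rightarrow> 'k::field_char_0" where
  "oper_exponent l = (of_nat l)\<^sup>2 / 4 + of_nat l / 2"

lemma oper_exponent_add:
  "oper_exponent (l + m) = oper_exponent l + oper_exponent m + of_nat l * of_nat m / 2"
  by (simp add: oper_exponent_def power2_eq_square field_simps)

lemma fls_const_A_coeff: "fls_const (A_coeff l) = oper_exponent l"
proof -
  have n: "(numeral k :: complex fls) = fls_const (numeral k)" for k
    by (simp add: fls_const_numeral)
  show ?thesis
    by (simp only: A_coeff_def oper_exponent_def n fls_of_nat fls_const_power[symmetric]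
        fls_const_divide_const fls_plus_const)
qed

text \<open>If \<open>y' = \<eta>y\<close>, this is \<open>(ts y'' - (\<lambda>s + \<mu>t)y')/y\<close>.\<close>

definition riccati :: "nat \<Rightarrow> nat \<Rightarrow> 'k::field_char_0 fps \<Rightarrow> 'k fps \<Rightarrow> 'k fps \<Rightarrow> 'k fps" where
  "riccati l m T S \<eta> =
     T * S * (fps_deriv \<eta> + \<eta>\<^sup>2) - (of_nat l * S + of_nat m * T) * \<eta>"

text \<open>Membership says \<open>f = \<chi>\<^sup>2 + \<chi>'\<close> with \<open>\<chi> = \<psi> - l/(2t)\<close> and \<open>\<psi>\<close> regular. Substituting
\<open>\<psi> = \<eta> - m/(2S)\<close>, which is allowed since \<open>S\<close> is a unit, gives \<open>\<chi> = \<eta> - l/(2t) - m/(2S)\<close>; this is symmetric in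
the two points, and the polar terms of \<open>\<chi>\<^sup>2 + \<chi>'\<close> are those split off from \<open>f\<close>.\<close>

lemma Op1_points_iff_riccati:
  fixes S G :: "complex fls fps"
  assumes S: "S $ 0 \<noteq> 0" "fps_deriv S = 1"
    and f: "f * (fps_to_fls (fps_X * S))\<^sup>2 = fps_to_fls (fps_const (oper_exponent l) * S\<^sup>2 +
      fps_const (oper_exponent m) * fps_X\<^sup>2 + fps_const (of_nat l * of_nat m / 2) * (fps_X * S) +
      fps_X * S * G)"
  shows "f \<in> Op1_points fls_const l \<longleftrightarrow> (\<exists>\<eta>. riccati l m fps_X S \<eta> = G)"
proof -
  define W where "W = fps_const (of_nat m / 2) * inverse S"
  have S0: "S \<noteq> 0" using S(1) by auto
  have iS: "inverse S * S = 1" using S(1) by (rule inverse_mult_eq_1)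
  have SW: "S * W = fps_const (of_nat m / 2)" using iS by (simp add: W_def mult_ac)
  have W': "S\<^sup>2 * fps_deriv W = - fps_const (of_nat m / 2)"
  proof -
    have "fps_deriv (S * W) = 0" by (simp add: SW)
    then have "S * (S * fps_deriv W) + S * W = 0" using S(2)
      by (simp add: distrib_left[symmetric])
    then have "S * (S * fps_deriv W) = - (S * W)" by (simp only: eq_neg_iff_add_eq_0)
    then show ?thesis by (simp only: SW power2_eq_square mult.assoc)
  qed
  have elem: "Op1_elem fls_const l \<psi> * (fps_to_fls (fps_X * S))\<^sup>2 =
      fps_to_fls (fps_const (oper_exponent l) * S\<^sup>2 - of_nat l * fps_X * S\<^sup>2 * \<psi> +
        fps_X\<^sup>2 * S\<^sup>2 * (\<psi>\<^sup>2 + fps_deriv \<psi>))" for \<psi>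
  proof -
    have inv: "fls_X_inv\<^sup>2 * fls_X\<^sup>2 = (1 :: complex fls fls)" "fls_X_inv * fls_X\<^sup>2 = (fls_X :: complex fls fls)"
      by (simp only: power_mult_distrib[symmetric] fls_X_inv_mult_X power_one)
        (simp only: power2_eq_square mult.assoc[symmetric] fls_X_inv_mult_X mult_1)
    have "Op1_elem fls_const l \<psi> * (fps_to_fls (fps_X * S))\<^sup>2 =
      fls_const (oper_exponent l) * (fls_X_inv\<^sup>2 * fls_X\<^sup>2) * (fps_to_fls S)\<^sup>2
      - of_nat l * (fls_X_inv * fls_X\<^sup>2) * fps_to_fls \<psi> * (fps_to_fls S)\<^sup>2
      + fls_X\<^sup>2 * (fps_to_fls S)\<^sup>2 * ((fps_to_fls \<psi>)\<^sup>2 + fps_to_fls (fps_deriv \<psi>))"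
      by (simp add: Op1_elem_def fls_const_A_coeff fls_times_fps_to_fls power_mult_distrib
          fls_deriv_fps_to_fls algebra_simps)
    also have "\<dots> = fps_to_fls (fps_const (oper_exponent l) * S\<^sup>2 - of_nat l * fps_X * S\<^sup>2 * \<psi> +
        fps_X\<^sup>2 * S\<^sup>2 * (\<psi>\<^sup>2 + fps_deriv \<psi>))"
      unfolding inv by (simp add: fls_times_fps_to_fls fps_to_fls_power fps_to_fls_of_nat algebra_simps)
    finally show ?thesis .
  qed
  have key: "fps_const (oper_exponent l) * S\<^sup>2 - of_nat l * fps_X * S\<^sup>2 * (\<eta> - W) +
        fps_X\<^sup>2 * S\<^sup>2 * ((\<eta> - W)\<^sup>2 + fps_deriv (\<eta> - W)) =
      fps_const (oper_exponent l) * S\<^sup>2 + fps_const (oper_exponent m) * fps_X\<^sup>2 +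
      fps_const (of_nat l * of_nat m / 2) * (fps_X * S) + fps_X * S * riccati l m fps_X S \<eta>" for \<eta>
  proof -
    define M where "M = fps_const (of_nat m / 2 :: complex fls)"
    have mM: "of_nat m = 2 * M"
      by (simp add: M_def fps_of_nat[symmetric] numeral_fps_const)
    have em: "fps_const (oper_exponent m) = M * M + M"
      by (simp add: M_def oper_exponent_def power2_eq_square)
    have lm: "fps_const (of_nat l * of_nat m / 2) = of_nat l * M"
      by (simp add: M_def fps_of_nat[symmetric])
    have "fps_const (oper_exponent l) * S\<^sup>2 - of_nat l * fps_X * S\<^sup>2 * (\<eta> - W) +
        fps_X\<^sup>2 * S\<^sup>2 * ((\<eta> - W)\<^sup>2 + fps_deriv (\<eta> - W)) =
      fps_const (oper_exponent l) * S\<^sup>2 - of_nat l * fps_X * S * (S * \<eta> - S * W) +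
        fps_X\<^sup>2 * ((S * \<eta> - S * W)\<^sup>2 + S\<^sup>2 * fps_deriv \<eta> - S\<^sup>2 * fps_deriv W)"
      by (simp add: power2_eq_square algebra_simps)
    also have "\<dots> = fps_const (oper_exponent l) * S\<^sup>2 - of_nat l * fps_X * S * (S * \<eta> - M) +
        fps_X\<^sup>2 * ((S * \<eta> - M)\<^sup>2 + S\<^sup>2 * fps_deriv \<eta> + M)"
      unfolding SW W' M_def by simp
    also have "\<dots> = fps_const (oper_exponent l) * S\<^sup>2 + (M * M + M) * fps_X\<^sup>2 +
      (of_nat l * M) * (fps_X * S) + fps_X * S * riccati l m fps_X S \<eta>"
      unfolding riccati_def mM by (simp add: power2_eq_square algebra_simps)
    finally show ?thesis unfolding em lm .
  qed
  have nz: "(fps_to_fls (fps_X * S))\<^sup>2 \<noteq> 0" using S0 by simp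
  have iff: "f = Op1_elem fls_const l (\<eta> - W) \<longleftrightarrow> riccati l m fps_X S \<eta> = G" for \<eta>
  proof -
    have "f = Op1_elem fls_const l (\<eta> - W) \<longleftrightarrow>
        f * (fps_to_fls (fps_X * S))\<^sup>2 = Op1_elem fls_const l (\<eta> - W) * (fps_to_fls (fps_X * S))\<^sup>2"
      using nz by simp
    also have "\<dots> \<longleftrightarrow> fps_X * S * G = fps_X * S * riccati l m fps_X S \<eta>"
      unfolding f elem key fps_to_fls_eq_iff by simp
    also have "\<dots> \<longleftrightarrow> riccati l m fps_X S \<eta> = G" using S0 by auto
    finally show ?thesis .
  qed
  show ?thesis
  proof
    assume "f \<in> Op1_points fls_const l"
    then obtain \<psi> where "f = Op1_elem fls_const l \<psi>" by (auto simp: Op1_points_def)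
    then show "\<exists>\<eta>. riccati l m fps_X S \<eta> = G" using iff[of "\<psi> + W"] by auto
  next
    assume "\<exists>\<eta>. riccati l m fps_X S \<eta> = G"
    then show "f \<in> Op1_points fls_const l" using iff by (auto simp: Op1_points_def)
  qed
qed

text \<open>The series \<open>G\<close> for which \<open>f = A\<^sub>\<lambda>/t\<^sup>2 + A\<^sub>\<mu>/s\<^sup>2 + \<lambda>\<mu>/(2ts) + G/(ts)\<close>, once \<open>a\<^bsub>-2\<^esub>\<close> and \<open>b\<^bsub>-2\<^esub>\<close> have the
values that a point of the generic fibre must have.\<close>

definition Op2_tail ::
  "nat \<Rightarrow> nat \<Rightarrow> (op2_var \<Rightarrow> complex fls) \<Rightarrow> complex fls fps \<Rightarrow> complex fls fps \<Rightarrow> complex fls fps" where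
  "Op2_tail l m x T S = pair_series (T * S) S (\<lambda>n. x (Avar (Suc n))) (\<lambda>n. x (Bvar (Suc n)))
     - fps_const (oper_exponent (l + m))"

text \<open>The leading coefficients \<open>A\<^sub>\<lambda>\<close> and \<open>A\<^sub>\<mu>\<close> at the two points determine \<open>a\<^bsub>-2\<^esub>\<close> and \<open>b\<^bsub>-2\<^esub>\<close>, both divisible
by \<open>a\<close>; each point then contributes one Riccati equation with the same right-hand side.\<close>

lemma Op2_points_iff_riccati:
  "E_t id x \<in> Op1_points fls_const l \<and> E_s id x \<in> Op1_points fls_const m \<longleftrightarrow>
    x (Avar 0) = fls_X\<^sup>2 * oper_exponent m \<and>
    x (Bvar 0) = fls_X * (oper_exponent m - oper_exponent l) \<and>
    (\<exists>\<eta>. riccati l m fps_X (fps_X - fps_const fls_X) \<eta> =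
       Op2_tail l m x fps_X (fps_X - fps_const fls_X)) \<and>
    (\<exists>\<eta>. riccati l m (fps_X + fps_const fls_X) fps_X \<eta> =
       Op2_tail l m x (fps_X + fps_const fls_X) fps_X)" (is "?L \<longleftrightarrow> ?A \<and> ?B \<and> ?t \<and> ?s")
proof -
  let ?a = "fls_X :: complex fls"
  have lead: "?A \<and> ?B" if ?L
  proof -
    have e: "fls_nth (E_t id x) (-2) = oper_exponent l" "fls_nth (E_s id x) (-2) = oper_exponent m"
      using that by (auto simp: Op1_points_iff[OF is_ring_hom_fls_const] fls_const_A_coeff)
    have p: "(- ?a) powi (-2) = inverse (?a\<^sup>2)" "(- ?a) powi (-1) = - inverse ?a" "?a powi (-2) = inverse (?a\<^sup>2)"
      by (simp_all add: power_int_minus)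
    have 1: "oper_exponent l = inverse (?a\<^sup>2) * x (Avar 0) + - inverse ?a * x (Bvar 0)"
      using Op2_expand_split(1)[OF is_ring_hom_id, of x 0]
      by (simp only: of_nat_0 diff_0 e p Op2_lower_def lessThan_0 sum.empty add_0 id_apply)
    have 2: "oper_exponent m = inverse (?a\<^sup>2) * x (Avar 0)"
      using Op2_expand_split(2)[OF is_ring_hom_id, of x 0]
      by (simp only: of_nat_0 diff_0 e p Op2_lower_def lessThan_0 sum.empty add_0 id_apply)
    have solve: "u = a\<^sup>2 * p \<and> v = a * (p - q)"
      if "q = inverse (a\<^sup>2) * u + - inverse a * v" "p = inverse (a\<^sup>2) * u" "a \<noteq> 0"
      for a p q u v :: "complex fls"
    proof -
      have "a * (v + a * q) = a * (a * p)" "u = a\<^sup>2 * p"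
        using that by (simp_all add: field_simps power2_eq_square)
      then have "v + a * q = a * p" using that(3) by simp
      then show ?thesis using \<open>u = _\<close> by (simp add: algebra_simps)
    qed
    show ?thesis using solve[OF 1 2] by simp
  qed
  have main: "?L \<longleftrightarrow> ?t \<and> ?s" if A: ?A and B: ?B
  proof -
    have pair: "pair_series (T * S) S (\<lambda>n. x (Avar n)) (\<lambda>n. x (Bvar n)) =
        fps_const (oper_exponent l) * S\<^sup>2 + fps_const (oper_exponent m) * T\<^sup>2 +
        fps_const (of_nat l * of_nat m / 2) * (T * S) + T * S * Op2_tail l m x T S"
      if TS: "T = S + fps_const ?a" "(T * S) $ 0 = 0" for T S
    proof -
      have 1: "fps_const (x (Avar 0)) = fps_const ?a * fps_const ?a * fps_const (oper_exponent m)"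
        by (simp add: A power2_eq_square)
      have 2: "fps_const (x (Bvar 0)) = fps_const ?a * (fps_const (oper_exponent m) - fps_const (oper_exponent l))"
        by (simp add: B)
      have 3: "fps_const (oper_exponent (l + m)) = fps_const (oper_exponent l) + fps_const (oper_exponent m)
          + fps_const (of_nat l * of_nat m / 2 :: complex fls)"
        by (simp add: oper_exponent_add)
      have identity: "(T - S) * (T - S) * M + (T - S) * (M - L) * S + T * S * G =
          L * S\<^sup>2 + M * T\<^sup>2 + N * (T * S) + T * S * (G - (L + M + N))"
        for L M N G :: "complex fls fps"
        by (simp add: power2_eq_square algebra_simps)
      have S: "fps_const ?a = T - S" using TS(1) by simp
      show ?thesis
        unfolding pair_series_Suc[OF TS(2), of S "\<lambda>n. x (Avar n)" "\<lambda>n. x (Bvar n)"] Op2_tail_def 1 2 3 S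
        by (rule identity)
    qed
    have X: "fls_X = (fps_to_fls fps_X :: complex fls fls)"
      "fls_X - fls_const ?a = fps_to_fls (fps_X - fps_const ?a)"
      "fls_X + fls_const ?a = fps_to_fls (fps_X + fps_const ?a)" by simp_all
    have "E_t id x \<in> Op1_points fls_const l \<longleftrightarrow> ?t"
    proof (rule Op1_points_iff_riccati)
      have "E_t id x * (fps_to_fls (fps_X * (fps_X - fps_const ?a)))\<^sup>2 =
        fps_to_fls (pair_series (fps_X * (fps_X - fps_const ?a)) (fps_X - fps_const ?a)
          (\<lambda>n. x (Avar n)) (\<lambda>n. x (Bvar n)))"
        by (rule Op2_expand_eq_pair_series[OF refl])
          (simp_all only: Et_u_def Et_v_def X, simp_all)
      then show "E_t id x * (fps_to_fls (fps_X * (fps_X - fps_const ?a)))\<^sup>2 = fps_to_fls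
         (fps_const (oper_exponent l) * (fps_X - fps_const ?a)\<^sup>2 + fps_const (oper_exponent m) * fps_X\<^sup>2 +
          fps_const (of_nat l * of_nat m / 2) * (fps_X * (fps_X - fps_const ?a)) +
          fps_X * (fps_X - fps_const ?a) * Op2_tail l m x fps_X (fps_X - fps_const ?a))"
        by (subst (asm) pair) simp_all
    qed simp_all
    moreover have "E_s id x \<in> Op1_points fls_const m \<longleftrightarrow>
       (\<exists>\<eta>. riccati m l fps_X (fps_X + fps_const ?a) \<eta> = Op2_tail l m x (fps_X + fps_const ?a) fps_X)"
    proof (rule Op1_points_iff_riccati)
      have "E_s id x * (fps_to_fls ((fps_X + fps_const ?a) * fps_X))\<^sup>2 =
        fps_to_fls (pair_series ((fps_X + fps_const ?a) * fps_X) fps_X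
          (\<lambda>n. x (Avar n)) (\<lambda>n. x (Bvar n)))"
        by (rule Op2_expand_eq_pair_series[OF mult.commute])
          (simp_all only: Es_u_def Es_v_def X, simp_all)
      then show "E_s id x * (fps_to_fls (fps_X * (fps_X + fps_const ?a)))\<^sup>2 = fps_to_fls
         (fps_const (oper_exponent m) * (fps_X + fps_const ?a)\<^sup>2 + fps_const (oper_exponent l) * fps_X\<^sup>2 +
          fps_const (of_nat m * of_nat l / 2) * (fps_X * (fps_X + fps_const ?a)) +
          fps_X * (fps_X + fps_const ?a) * Op2_tail l m x (fps_X + fps_const ?a) fps_X)"
        by (subst (asm) pair) (simp_all add: mult_ac add_ac)
    qed simp_all
    moreover have "riccati m l fps_X (fps_X + fps_const ?a) \<eta> =
        riccati l m (fps_X + fps_const ?a) fps_X \<eta>" for \<eta>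
      by (simp add: riccati_def algebra_simps)
    ultimately show ?thesis by simp
  qed
  show ?thesis using lead main by blast
qed

hide_const (open) Module.smult

section \<open>Jacobi polynomials\<close>

text \<open>The eigenvalue of \<open>t\<^sup>2\<partial>\<^sup>2 - (\<lambda> + \<mu>)t\<partial>\<close> on \<open>t\<^sup>j\<close>, which is also the leading term of
\<open>ts\<partial>\<^sup>2 - (\<lambda>s + \<mu>t)\<partial>\<close> on polynomials of degree \<open>j\<close>.\<close>

definition oper_diag :: "nat \<Rightarrow> nat \<Rightarrow> nat \<Rightarrow> 'r::comm_ring_1" where
  "oper_diag l m j = of_nat j * (of_nat j - 1 - of_nat l - of_nat m)"

text \<open>This is how the components are labelled: a solution of leading term \<open>t\<^sup>n\<close> at \<open>a = 0\<close> has exponent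
\<open>n - (\<lambda> + \<mu>)/2 = -\<nu>/2\<close>.\<close>

lemma oper_diag_eq_A_coeff:
  assumes "\<nu> + 2 * n = l + m"
  shows "oper_diag l m n + oper_exponent (l + m) = A_coeff \<nu>"
proof -
  have "of_nat l + of_nat m = (of_nat \<nu> + 2 * of_nat n :: complex)"
    using arg_cong[OF assms, of "of_nat :: nat \<Rightarrow> complex"] by simp
  then have "of_nat l = (of_nat \<nu> + 2 * of_nat n - of_nat m :: complex)" by (simp add: algebra_simps)
  then show ?thesis
    by (simp add: oper_diag_def oper_exponent_def A_coeff_def power2_eq_square field_simps)
qed

lemma oper_diag_eq_iff:
  "oper_diag l m i = (oper_diag l m j :: complex) \<longleftrightarrow> i = j \<or> i + j = l + m + 1"
proof -
  have "oper_diag l m i = (oper_diag l m j :: complex) \<longleftrightarrow>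
      (of_nat i - of_nat j) * (of_nat (i + j) - of_nat (l + m + 1)) = (0 :: complex)"
    by (auto simp: oper_diag_def algebra_simps)
  also have "\<dots> \<longleftrightarrow> i = j \<or> i + j = l + m + 1"
    unfolding mult_eq_0_iff right_minus_eq of_nat_eq_iff ..
  finally show ?thesis .
qed

text \<open>The operator \<open>ts\<partial>\<^sup>2 - (\<lambda>s + \<mu>t)\<partial>\<close> in the coordinate \<open>w = t/a\<close>, where \<open>s/a = w - 1\<close>.\<close>

definition jacobi_op :: "nat \<Rightarrow> nat \<Rightarrow> complex poly \<Rightarrow> complex poly" where
  "jacobi_op l m p = [:0, 1:] * [:-1, 1:] * pderiv (pderiv p) -
     (of_nat l * [:-1, 1:] + of_nat m * [:0, 1:]) * pderiv p"

lemma coeff_second_order_op: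
  fixes p :: "complex poly"
  shows "coeff ([:0, 1:] * [:e, 1:] * pderiv (pderiv p) - [:u, v:] * pderiv p) n =
    of_nat n * (of_nat n - 1 - v) * coeff p n + of_nat (n + 1) * (e * of_nat n - u) * coeff p (n + 1)"
proof -
  have "[:0, 1:] * [:e, 1:] * pderiv (pderiv p) - [:u, v:] * pderiv p =
      pCons 0 (pCons 0 (pderiv (pderiv p))) + smult e (pCons 0 (pderiv (pderiv p)))
      - (smult u (pderiv p) + smult v (pCons 0 (pderiv p)))"
    by (simp add: algebra_simps)
  then show ?thesis
    by (simp only:)
      (simp add: coeff_pCons coeff_pderiv algebra_simps split: nat.split)
qed

lemma coeff_jacobi_op:
  "coeff (jacobi_op l m p) n = oper_diag l m n * coeff p n +
     of_nat (n + 1) * (of_nat l - of_nat n) * coeff p (n + 1)"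
proof -
  have "of_nat l * [:-1, 1:] + of_nat m * [:0, 1:] = [:- of_nat l, of_nat l + of_nat m :: complex:]"
    by (simp add: of_nat_poly)
  then show ?thesis
    unfolding jacobi_op_def
    by (simp only: coeff_second_order_op) (simp add: oper_diag_def algebra_simps)
qed

text \<open>The operator is triangular on monomials. Its diagonal entries in degrees below \<open>k \<le> min l m\<close> differ
from the one in degree \<open>k\<close>, because the other index with the same entry is \<open>l + m + 1 - k > k\<close>.\<close>

lemma jacobi_op_solve:
  assumes "d \<le> k" "k \<le> l" "k \<le> m" "\<And>n. n \<ge> d \<Longrightarrow> coeff r n = 0"
  shows "\<exists>p. (\<forall>n\<ge>d. coeff p n = 0) \<and> jacobi_op l m p - smult (oper_diag l m k) p = r"
  using assms(1,4)
proof (induction d arbitrary: r)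
  case 0
  then have "r = 0" by (intro poly_eqI) simp
  then show ?case by (intro exI[of _ 0]) (simp add: jacobi_op_def)
next
  case (Suc d)
  let ?e = "oper_diag l m"
  define c where "c = coeff r d / (?e d - ?e k)"
  have c: "c * (?e d - ?e k) = coeff r d"
    using oper_diag_eq_iff[of l m d k] Suc.prems assms(2,3) by (simp add: c_def)
  let ?r = "r - (jacobi_op l m (monom c d) - smult (?e k) (monom c d))"
  have "coeff ?r n = 0" if "n \<ge> d" for n
    using that c Suc.prems(2)[of n] by (cases "n = d") (simp_all add: coeff_jacobi_op algebra_simps)
  then obtain p where p: "\<forall>n\<ge>d. coeff p n = 0" "jacobi_op l m p - smult (?e k) p = ?r"
    using Suc.IH[of ?r] Suc.prems(1) by auto
  have "jacobi_op l m (p + monom c d) - smult (?e k) (p + monom c d) = r"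
    using p(2) by (simp add: jacobi_op_def pderiv_add algebra_simps smult_add_right)
  then show ?case using p(1) by (intro exI[of _ "p + monom c d"]) auto
qed

lemma jacobi_polynomial_exists:
  assumes "k \<le> l" "k \<le> m"
  shows "\<exists>J. jacobi_op l m J = smult (oper_diag l m k) J \<and> degree J \<le> k \<and> coeff J k = 1 \<and>
    poly J 0 \<noteq> 0 \<and> poly J 1 \<noteq> 0"
proof -
  let ?e = "oper_diag l m"
  define r where "r = - (jacobi_op l m (monom 1 k) - smult (?e k) (monom 1 k))"
  have "coeff r n = 0" if "n \<ge> k" for n
    using that by (cases "n = k") (simp_all add: r_def coeff_jacobi_op)
  then obtain p where p: "\<forall>n\<ge>k. coeff p n = 0" "jacobi_op l m p - smult (?e k) p = r"
    using jacobi_op_solve[OF order_refl assms] by blast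
  define J where "J = monom 1 k + p"
  have J: "jacobi_op l m J = smult (?e k) J"
    using p(2) by (simp add: J_def r_def jacobi_op_def pderiv_add algebra_simps smult_add_right)
  have top: "coeff J k = 1" "coeff J n = 0" if "n > k" for n
    using p(1) that by (simp_all add: J_def)
  have top: "coeff J k = 1" using p(1) by (simp add: J_def)
  have deg: "degree J \<le> k" by (rule degree_le) (use p(1) in \<open>simp add: J_def\<close>)
  \<comment> \<open>At a root the three-term recursion would force all coefficients up to the degree to vanish.\<close>
  have vanish: "coeff q n = 0"
    if "coeff q 0 = 0" "n \<le> N" and rec: "\<And>n. n < N \<Longrightarrow> u n * coeff q n = v n * coeff q (n + 1)"
      and v: "\<And>n. n < N \<Longrightarrow> v n \<noteq> 0" for q :: "complex poly" and n N u v
    using that(2)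
  proof (induction n)
    case (Suc n)
    then show ?case using rec[of n] v[of n] by simp
  qed (use that in simp)
  have 0: "poly J 0 \<noteq> 0"
  proof
    assume "poly J 0 = 0"
    then have "coeff J 0 = 0" by (simp add: poly_0_coeff_0)
    then have "coeff J k = 0"
    proof (rule vanish[OF _ order_refl])
      fix n assume n: "n < k"
      show "(?e k - ?e n) * coeff J n = of_nat (n + 1) * (of_nat l - of_nat n) * coeff J (n + 1)"
        using arg_cong[OF J, of "\<lambda>p. coeff p n"] unfolding coeff_jacobi_op by (simp add: algebra_simps)
      have "(of_nat l :: complex) \<noteq> of_nat n" using n assms unfolding of_nat_eq_iff by simp
      then show "of_nat (n + 1) * (of_nat l - of_nat n) \<noteq> (0 :: complex)"
        by (simp only: mult_eq_0_iff of_nat_eq_0_iff right_minus_eq) simp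
    qed
    with top show False by simp
  qed
  have 1: "poly J 1 \<noteq> 0"
  proof
    assume J1: "poly J 1 = 0"
    define q where "q = pcompose J [:1, 1:]"
    have "pcompose (jacobi_op l m J) [:1, 1:] = smult (?e k) q" by (simp add: J q_def pcompose_smult)
    moreover have "pcompose (jacobi_op l m J) [:1, 1:] =
        [:0, 1:] * [:1, 1:] * pderiv (pderiv q) - [:of_nat m, of_nat l + of_nat m:] * pderiv q"
      unfolding jacobi_op_def
      by (simp add: q_def pderiv_pcompose pderiv_pCons pcompose_diff pcompose_mult pcompose_add
          pcompose_pCons pcompose_smult of_nat_poly smult_add_right smult_add_left algebra_simps)
    ultimately have rec: "[:0, 1:] * [:1, 1:] * pderiv (pderiv q) - [:of_nat m, of_nat l + of_nat m:] * pderiv q =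
        smult (?e k) q" by simp
    have "coeff q 0 = 0" using J1 by (simp add: q_def poly_pcompose flip: poly_0_coeff_0)
    then have "coeff q k = 0"
    proof (rule vanish[OF _ order_refl])
      fix n assume n: "n < k"
      show "(?e k - ?e n) * coeff q n = of_nat (n + 1) * (of_nat n - of_nat m) * coeff q (n + 1)"
        using arg_cong[OF rec, of "\<lambda>p. coeff p n"] unfolding coeff_second_order_op
        by (simp add: oper_diag_def algebra_simps)
      have "(of_nat n :: complex) \<noteq> of_nat m" using n assms unfolding of_nat_eq_iff by simp
      then show "of_nat (n + 1) * (of_nat n - of_nat m) \<noteq> (0 :: complex)"
        by (simp only: mult_eq_0_iff of_nat_eq_0_iff right_minus_eq) simp
    qed
    moreover have "degree J = k" using deg top by (metis le_antisym le_degree zero_neq_one)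
    then have "coeff q k = 1"
      using top lead_coeff_comp[of "[:1, 1:]" J] by (simp add: q_def degree_pcompose)
    ultimately show False by simp
  qed
  show ?thesis using J deg top 0 1 by blast
qed

section \<open>Expansion of scaled power series\<close>

text \<open>A series \<open>\<Sum>\<^sub>i F\<^sub>i(w) h\<^sup>i\<close> with polynomial coefficients stands for a function of \<open>t = aw\<close> with \<open>h = a\<close>.
In the local coordinate \<open>\<tau> = t - ca\<close> one has \<open>w = c + \<tau>/a\<close>, so the coefficient of \<open>\<tau>\<^sup>m\<close> carries the
factor \<open>a\<^sup>-\<^sup>m\<close>. The points \<open>t = 0\<close> and \<open>s = 0\<close> are \<open>c = 0\<close> and \<open>c = 1\<close>.\<close>

definition scaled_expand :: "complex \<Rightarrow> complex poly fps \<Rightarrow> complex fls fps" where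
  "scaled_expand c F = Abs_fps (\<lambda>m. fls_shift (int m)
     (fps_to_fls (Abs_fps (\<lambda>i. coeff (pcompose (F $ i) [:c, 1:]) m))))"

lemma scaled_expand_add: "scaled_expand c (F + G) = scaled_expand c F + scaled_expand c G"
  by (rule fps_ext, rule fls_eqI) (simp add: scaled_expand_def pcompose_add)

lemma scaled_expand_mult: "scaled_expand c (F * G) = scaled_expand c F * scaled_expand c G"
proof (rule fps_ext)
  fix m
  define f where "f q = Abs_fps (\<lambda>i. coeff (pcompose (F $ i) [:c, 1:]) q)" for q
  define g where "g q = Abs_fps (\<lambda>i. coeff (pcompose (G $ i) [:c, 1:]) q)" for q
  have "Abs_fps (\<lambda>i. coeff (pcompose ((F * G) $ i) [:c, 1:]) m) = (\<Sum>q\<le>m. f q * g (m - q))"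
  proof (rule fps_ext)
    fix i
    have "coeff (pcompose ((F * G) $ i) [:c, 1:]) m =
        (\<Sum>p=0..i. \<Sum>q\<le>m. coeff (pcompose (F $ p) [:c, 1:]) q * coeff (pcompose (G $ (i - p)) [:c, 1:]) (m - q))"
      by (simp add: fps_mult_nth pcompose_sum pcompose_mult coeff_sum coeff_mult)
    also have "\<dots> = (\<Sum>q\<le>m. \<Sum>p=0..i. f q $ p * g (m - q) $ (i - p))"
      by (subst sum.swap) (simp add: f_def g_def)
    finally show "Abs_fps (\<lambda>i. coeff (pcompose ((F * G) $ i) [:c, 1:]) m) $ i =
        (\<Sum>q\<le>m. f q * g (m - q)) $ i"
      by (simp add: fps_sum_nth fps_mult_nth)
  qed
  then have "scaled_expand c (F * G) $ m = fls_shift (int m) (\<Sum>q\<le>m. fps_to_fls (f q) * fps_to_fls (g (m - q)))"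
    by (simp add: scaled_expand_def is_ring_homD(8)[OF is_ring_hom_fps_to_fls] fls_times_fps_to_fls)
  also have "\<dots> = (\<Sum>q\<le>m. fls_shift (int m) (fps_to_fls (f q) * fps_to_fls (g (m - q))))"
    by (rule fls_eqI) (simp add: fls_nth_sum)
  also have "\<dots> = (\<Sum>q\<le>m. fls_shift (int q) (fps_to_fls (f q)) * fls_shift (int (m - q)) (fps_to_fls (g (m - q))))"
    by (intro sum.cong refl) (simp add: fls_shifted_times_simps of_nat_diff)
  finally show "scaled_expand c (F * G) $ m = (scaled_expand c F * scaled_expand c G) $ m"
    by (simp add: scaled_expand_def f_def g_def fps_mult_nth atLeast0AtMost)
qed

lemma scaled_expand_const:
  "scaled_expand c (fps_const p) $ m = fls_shift (int m) (fls_const (coeff (pcompose p [:c, 1:]) m))"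
proof -
  have "Abs_fps (\<lambda>i. coeff (pcompose (fps_const p $ i) [:c, 1:]) m) = fps_const (coeff (pcompose p [:c, 1:]) m)"
    by (rule fps_ext) simp
  then show ?thesis by (simp add: scaled_expand_def)
qed

lemma scaled_expand_one: "scaled_expand c 1 = 1"
proof (rule fps_ext, rule fls_eqI)
  fix m n
  show "fls_nth (scaled_expand c 1 $ m) n = fls_nth (1 $ m) n"
    using scaled_expand_const[of c 1 m] by (auto simp: pcompose_1)
qed

lemma is_ring_hom_scaled_expand: "is_ring_hom (scaled_expand c)"
  by (simp add: is_ring_hom_def scaled_expand_one scaled_expand_add scaled_expand_mult)

lemma scaled_expand_X: "scaled_expand c fps_X = fps_const fls_X"
proof (rule fps_ext, rule fls_eqI)
  fix m n
  show "fls_nth (scaled_expand c fps_X $ m) n = fls_nth (fps_const fls_X $ m) n"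
    by (cases m) (auto simp: scaled_expand_def pcompose_1)
qed

lemma scaled_expand_linear:
  "fps_const fls_X * scaled_expand c (fps_const [:e, 1:]) = fps_X + fps_const (fls_const (c + e) * fls_X)"
proof (rule fps_ext)
  fix m
  have "fls_X * fls_shift 1 1 = (1 :: complex fls)"
    by (rule fls_eqI) (simp add: fls_X_times_conv_shift)
  then show "(fps_const fls_X * scaled_expand c (fps_const [:e, 1:])) $ m =
      (fps_X + fps_const (fls_const (c + e) * fls_X)) $ m"
    by (cases m; cases "m - 1") (auto simp: scaled_expand_const pcompose_pCons mult.commute add.commute)
qed

lemma scaled_expand_deriv:
  "scaled_expand c (Abs_fps (\<lambda>i. pderiv (F $ i))) = fps_const fls_X * fps_deriv (scaled_expand c F)"
proof (rule fps_ext, rule fls_eqI)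
  fix m n
  have *: "pcompose (pderiv p) [:c, 1:] = pderiv (pcompose p [:c, 1:])" for p
    by (simp add: pderiv_pcompose pderiv_pCons)
  have "fls_nth ((1 + of_nat m :: complex fls) * f) k = (1 + of_nat m) * fls_nth f k" for f k
    by (simp add: distrib_right)
  then show "fls_nth (scaled_expand c (Abs_fps (\<lambda>i. pderiv (F $ i))) $ m) n =
      fls_nth ((fps_const fls_X * fps_deriv (scaled_expand c F)) $ m) n"
    by (simp add: scaled_expand_def * coeff_pderiv fls_X_times_conv_shift algebra_simps)
qed

text \<open>The functions \<open>(ts)\<^sup>n\<close> and \<open>(ts)\<^sup>n s\<close> in the coordinate \<open>w\<close>, divided by \<open>a\<^bsup>2n\<^esup>\<close> and \<open>a\<^bsup>2n+1\<^esup>\<close>.\<close>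

definition pair_basis :: "nat \<Rightarrow> complex poly" where
  "pair_basis j = ([:0, 1:] * [:-1, 1:]) ^ (j div 2) * [:-1, 1:] ^ (j mod 2)"

lemma pair_basis_degree: "degree (pair_basis j) = j"
  by (simp add: pair_basis_def degree_mult_eq degree_power_eq) presburger

lemma pair_basis_top: "coeff (pair_basis j) j = 1"
proof -
  have "lead_coeff (pair_basis j) = 1"
    by (simp add: pair_basis_def lead_coeff_mult lead_coeff_power)
  then show ?thesis by (simp add: pair_basis_degree)
qed

lemma pair_basis_span:
  assumes "degree p \<le> i"
  shows "\<exists>\<gamma>. p = (\<Sum>j\<le>i. smult (\<gamma> j) (pair_basis j)) \<and> \<gamma> i = coeff p i"
  using assms
proof (induction i arbitrary: p)
  case 0
  then have "p = [:coeff p 0:]" by (simp add: degree_0_id)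
  then show ?case by (intro exI[of _ "\<lambda>_. coeff p 0"]) (simp add: pair_basis_def)
next
  case (Suc i)
  let ?q = "p - smult (coeff p (Suc i)) (pair_basis (Suc i))"
  have "degree ?q \<le> i"
  proof (rule degree_le, intro allI impI)
    fix n assume n: "i < n"
    show "coeff ?q n = 0"
    proof (cases "n = Suc i")
      case True then show ?thesis by (simp add: pair_basis_top)
    next
      case False
      then show ?thesis using n Suc.prems by (simp add: coeff_eq_0 pair_basis_degree)
    qed
  qed
  then obtain \<gamma> where \<gamma>: "?q = (\<Sum>j\<le>i. smult (\<gamma> j) (pair_basis j))" using Suc.IH by blast
  have "(\<Sum>j\<le>i. smult ((\<gamma>(Suc i := coeff p (Suc i))) j) (pair_basis j)) = ?q"
    unfolding \<gamma> by (intro sum.cong) auto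
  then show ?case by (intro exI[of _ "\<gamma>(Suc i := coeff p (Suc i))"]) simp
qed

lemma pcompose_power: "pcompose (p ^ n) q = pcompose p q ^ n"
  for p q :: "'a::comm_ring_1 poly"
  by (induction n) (simp_all add: pcompose_1 pcompose_mult)

lemma pair_basis_vanishing_order:
  assumes "c = 0 \<or> c = 1" "2 * m + 1 < j"
  shows "coeff (pcompose (pair_basis j) [:c, 1:]) m = 0"
proof -
  have "\<exists>s. pcompose (pair_basis j) [:c, 1:] = [:0, 1:] ^ (j div 2) * s"
    using assms(1)
  proof
    assume "c = 0"
    then show ?thesis
      by (intro exI[of _ "[:-1, 1:] ^ (j div 2) * [:-1, 1:] ^ (j mod 2)"])
        (simp only: pair_basis_def pcompose_mult pcompose_power power_mult_distrib mult.assoc, simp add: pcompose_pCons)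
  next
    assume "c = 1"
    then show ?thesis
      by (intro exI[of _ "[:1, 1:] ^ (j div 2) * [:0, 1:] ^ (j mod 2)"])
        (simp only: pair_basis_def pcompose_mult pcompose_power power_mult_distrib mult.assoc mult.left_commute, simp add: pcompose_pCons)
  qed
  then obtain s where s: "pcompose (pair_basis j) [:c, 1:] = monom 1 (j div 2) * s"
    by (auto simp: monom_altdef)
  have "m < j div 2" using assms(2) by linarith
  then show ?thesis by (simp add: s coeff_monom_mult)
qed

lemma sum_even_odd:
  fixes h :: "nat \<Rightarrow> 'b::comm_monoid_add"
  shows "(\<Sum>n\<le>m. h (2 * n) + h (2 * n + 1)) = (\<Sum>j\<le>2 * m + 1. h j)"
  by (induction m) (simp_all add: add.assoc)

text \<open>A polynomial of degree at most \<open>i\<close> times \<open>a\<^sup>i\<close> involves the \<open>j\<close>th basis function only for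
\<open>j \<le> i\<close>, so that after rescaling its coefficient is a multiple of \<open>a\<^bsup>i-j\<^esup>\<close>. Series with this degree bound are
therefore expansions of elements with coefficients \<open>g\<^sub>j \<in> \<complex>[[a]]\<close>, and \<open>g\<^sub>j(0)\<close> is the top coefficient
\<open>\<gamma> j j\<close>.\<close>

lemma pair_series_eq_scaled_expand:
  assumes c: "c = 0 \<or> c = 1"
    and G: "\<And>i. G $ i = (\<Sum>j\<le>i. smult (\<gamma> i j) (pair_basis j))"
    and T: "T = fps_X + fps_const (fls_const c * fls_X)"
    and S: "S = fps_X + fps_const (fls_const (c - 1) * fls_X)"
    and g: "\<And>j. g j = fps_to_fls (Abs_fps (\<lambda>n. \<gamma> (n + j) j))"
  shows "pair_series (T * S) S (\<lambda>n. g (2 * n)) (\<lambda>n. g (2 * n + 1)) = scaled_expand c G"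
proof (rule fps_ext)
  fix m
  let ?sc = "\<lambda>p. scaled_expand c (fps_const p)"
  note hom = is_ring_homD[OF is_ring_hom_comp[OF _ is_ring_hom_scaled_expand], of fps_const c]
  have fc: "is_ring_hom (fps_const :: complex poly \<Rightarrow> _)" by (simp add: is_ring_hom_def)
  define E where "E j = fps_const (fls_X ^ j) * ?sc (pair_basis j)" for j
  have T': "T = fps_const fls_X * ?sc [:0, 1:]" and S': "S = fps_const fls_X * ?sc [:-1, 1:]"
    unfolding scaled_expand_linear T S by simp_all
  have TS: "T * S = fps_const (fls_X\<^sup>2) * ?sc ([:0, 1:] * [:-1, 1:])"
    unfolding T' S' hom(3)[OF fc] fps_const_power[symmetric] by (simp only: power2_eq_square mult_ac)
  have TSn: "(T * S) ^ n = E (2 * n)" for n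
    unfolding TS E_def pair_basis_def power_mult_distrib hom(7)[OF fc, symmetric]
    by (simp add: power_mult)
  have e1: "S * (T * S) ^ n = fps_const (fls_X * fls_X ^ (2 * n)) * ?sc ([:-1, 1:] * pair_basis (2 * n))" for n
  proof -
    have "S * (T * S) ^ n = fps_const fls_X * ?sc [:-1, 1:] * E (2 * n)" unfolding TSn by (simp only: S')
    then show ?thesis
      unfolding E_def hom(3)[OF fc] fps_const_mult[where 'a = "complex fls", symmetric] by (simp only: mult_ac)
  qed
  have e2: "[:-1, 1:] * pair_basis (2 * n) = pair_basis (2 * n + 1)" for n
  proof -
    have d: "(2 * n + 1) div 2 = n" "(2 * n + 1) mod 2 = 1" "2 * n div 2 = n" "2 * n mod 2 = 0" by simp_all
    show ?thesis unfolding pair_basis_def d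
      by (simp only: power_0 power_one_right mult_1_right mult_1_left mult.commute)
  qed
  have STSn: "S * (T * S) ^ n = E (2 * n + 1)" for n
    unfolding e1 e2 E_def by simp
  have TS0: "(T * S) $ 0 = 0" using c by (auto simp: T S)
  have "pair_series (T * S) S (\<lambda>n. g (2 * n)) (\<lambda>n. g (2 * n + 1)) $ m =
      (\<Sum>n\<le>m. (fps_const (g (2 * n)) + fps_const (g (2 * n + 1)) * S) * (T * S) ^ n) $ m"
    by (rule pair_series_nth_truncate[OF TS0 order_refl])
  also have "\<dots> = (\<Sum>n\<le>m. fps_const (g (2 * n)) * E (2 * n) + fps_const (g (2 * n + 1)) * E (2 * n + 1)) $ m"
    by (simp only: distrib_right mult.assoc TSn STSn[unfolded TSn])
  also have "\<dots> = (\<Sum>j\<le>2 * m + 1. fps_const (g j) * E j) $ m"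
    by (subst sum_even_odd[of "\<lambda>j. fps_const (g j) * E j"]) (rule refl)
  also have "\<dots> = (\<Sum>j\<le>2 * m + 1. g j * (fls_X ^ j *
      fls_shift (int m) (fls_const (coeff (pcompose (pair_basis j) [:c, 1:]) m))))"
    by (simp add: fps_sum_nth E_def scaled_expand_const)
  also have "\<dots> = scaled_expand c G $ m"
  proof (rule fls_eqI)
    fix k
    let ?C = "\<lambda>j. coeff (pcompose (pair_basis j) [:c, 1:]) m"
    have X: "fls_nth (g j * (fls_X ^ j * fls_shift (int m) (fls_const z))) k =
       (if k + int m < int j then 0 else \<gamma> (nat (k + int m)) j) * z" for j z
    proof -
      have "g j * (fls_X ^ j * fls_shift (int m) (fls_const z)) =
          fls_shift (int m - int j) (g j * fls_const z)"
        by (simp add: fls_X_power_times_conv_shift fls_shifted_times_simps)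
      also have "fls_nth \<dots> k = fls_nth (g j) (k + int m - int j) * z"
        by (simp add: algebra_simps)
      also have "fls_nth (g j) (k + int m - int j) = (if k + int m < int j then 0 else \<gamma> (nat (k + int m)) j)"
      proof (cases "k + int m < int j")
        case True then show ?thesis by (simp add: g)
      next
        case False
        then have "nat (k + int m - int j) + j = nat (k + int m)" by linarith
        then show ?thesis using False by (simp add: g)
      qed
      finally show ?thesis .
    qed
    show "fls_nth (\<Sum>j\<le>2 * m + 1. g j * (fls_X ^ j * fls_shift (int m) (fls_const (?C j)))) k =
        fls_nth (scaled_expand c G $ m) k"
    proof (cases "k + int m < 0")
      case True
      then have "k + int m < int j" for j by linarith
      then show ?thesis unfolding fls_nth_sum X using True by (simp add: scaled_expand_def)
    next
      case False
      define i where "i = nat (k + int m)"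
      have i: "k + int m = int i" using False by (simp add: i_def)
      have "fls_nth (\<Sum>j\<le>2 * m + 1. g j * (fls_X ^ j * fls_shift (int m) (fls_const (?C j)))) k =
          (\<Sum>j\<le>2 * m + 1. (if j \<le> i then \<gamma> i j * ?C j else 0))"
        unfolding fls_nth_sum X i by (intro sum.cong) auto
      also have "\<dots> = (\<Sum>j\<in>{..2 * m + 1} \<inter> {..i}. \<gamma> i j * ?C j)"
        by (subst sum.inter_restrict, rule finite_atMost, simp only: atMost_iff)
      also have "\<dots> = (\<Sum>j\<le>i. \<gamma> i j * ?C j)"
        using pair_basis_vanishing_order[OF c] by (intro sum.mono_neutral_left) auto
      also have "\<dots> = coeff (pcompose (G $ i) [:c, 1:]) m"
        by (simp add: G pcompose_sum coeff_sum pcompose_smult)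
      also have "\<dots> = fls_nth (scaled_expand c G $ m) k"
        by (simp add: scaled_expand_def i)
      finally show ?thesis .
    qed
  qed
  finally show "pair_series (T * S) S (\<lambda>n. g (2 * n)) (\<lambda>n. g (2 * n + 1)) $ m = scaled_expand c G $ m" .
qed

section \<open>Deforming the Jacobi polynomial\<close>

definition fps_pderiv :: "complex poly fps \<Rightarrow> complex poly fps" where
  "fps_pderiv F = Abs_fps (\<lambda>i. pderiv (F $ i))"

lemma fps_pderiv_nth [simp]: "fps_pderiv F $ i = pderiv (F $ i)"
  by (simp add: fps_pderiv_def)

lemma coeff_mult_top:
  fixes p q :: "'a::comm_ring_1 poly"
  assumes "degree p \<le> a" "degree q \<le> b"
  shows "coeff (p * q) (a + b) = coeff p a * coeff q b"
proof -
  have "coeff (p * q) (a + b) = (\<Sum>i\<le>a + b. coeff p i * coeff q (a + b - i))" by (rule coeff_mult)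
  also have "\<dots> = (\<Sum>i\<in>{a}. coeff p i * coeff q (a + b - i))"
  proof (intro sum.mono_neutral_right ballI)
    fix i assume "i \<in> {..a + b} - {a}"
    then have "a < i \<or> b < a + b - i" by auto
    then show "coeff p i * coeff q (a + b - i) = 0" using assms by (auto simp: coeff_eq_0)
  qed auto
  finally show ?thesis by simp
qed

text \<open>Order by order in \<open>h\<close>. At order \<open>i > 0\<close> the unknowns \<open>P\<^sub>i\<close> (of degree below \<open>k\<close>) and \<open>W\<^sub>i\<close> satisfy
\<open>(jacobi_op - e)P\<^sub>i + R\<^sub>i = W\<^sub>i J\<close>, where \<open>R\<^sub>i\<close> depends on earlier orders and \<open>J\<close> is the Jacobi polynomial. Take
for \<open>W\<^sub>i\<close> the quotient of \<open>R\<^sub>i\<close> by \<open>J\<close>; the remainder has degree below \<open>k\<close> and is absorbed by \<open>P\<^sub>i\<close>. The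
degree of \<open>R\<^sub>i\<close> is at most \<open>k + i\<close>, with top coefficient \<open>2k\<psi>\<^bsub>i-1\<^esub>\<close>, which controls \<open>W\<^sub>i\<close>.\<close>

lemma bethe_series_exists:
  fixes \<psi> :: "complex fps"
  assumes k: "k \<le> l" "k \<le> m"
  shows "\<exists>P W :: complex poly fps.
    fps_const ([:0, 1:] * [:-1, 1:]) * fps_pderiv (fps_pderiv P) -
      fps_const (of_nat l * [:-1, 1:] + of_nat m * [:0, 1:]) * fps_pderiv P +
      fps_X * (fps_const (2 * ([:0, 1:] * [:-1, 1:])) * (fps_pderiv P * Abs_fps (\<lambda>i. monom (\<psi> $ i) i))) =
      W * P \<and>
    (\<forall>i. degree (W $ i) \<le> i) \<and>
    (\<forall>i. coeff (W $ i) i = (if i = 0 then oper_diag l m k else 2 * of_nat k * \<psi> $ (i - 1))) \<and>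
    poly (P $ 0) 0 \<noteq> 0 \<and> poly (P $ 0) 1 \<noteq> 0"
proof -
  define A :: "complex poly" where "A = [:0, 1:] * [:-1, 1:]"
  define B :: "complex poly" where "B = of_nat l * [:-1, 1:] + of_nat m * [:0, 1:]"
  let ?e = "oper_diag l m k"
  have jac: "jacobi_op l m p = A * pderiv (pderiv p) - B * pderiv p" for p
    by (simp add: jacobi_op_def A_def B_def)
  obtain J where J: "jacobi_op l m J = smult ?e J" "degree J \<le> k" "coeff J k = 1"
    "poly J 0 \<noteq> 0" "poly J 1 \<noteq> 0"
    using jacobi_polynomial_exists[OF k] by blast
  have J0: "J \<noteq> 0" using J(3) by auto
  have degJ: "degree J = k" using J(2,3) by (metis le_antisym le_degree zero_neq_one)
  define R :: "(nat \<Rightarrow> complex poly \<times> complex poly) \<Rightarrow> nat \<Rightarrow> complex poly" where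
    "R f i = 2 * A * (\<Sum>q<i. pderiv (fst (f q)) * monom (\<psi> $ (i - 1 - q)) (i - 1 - q)) -
       (\<Sum>q\<in>{1..<i}. snd (f q) * fst (f (i - q)))" for f i
  (* r is an admissible value at order i, given the values f j for j < i *)
  define good where "good f i r \<longleftrightarrow> (if i = 0 then r = (J, [:?e:]) else
     (\<forall>n\<ge>k. coeff (fst r) n = 0) \<and> degree (snd r) \<le> i \<and> coeff (snd r) i = 2 * of_nat k * \<psi> $ (i - 1) \<and>
     jacobi_op l m (fst r) - smult ?e (fst r) + R f i = snd r * J)"
    for f :: "nat \<Rightarrow> complex poly \<times> complex poly" and i :: nat and r :: "complex poly \<times> complex poly"
  have "\<exists>f. \<forall>i. good f i (f i)"
  proof (rule dependent_wf_choice[OF wf_less_than])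
    fix f g :: "nat \<Rightarrow> complex poly \<times> complex poly" and i r
    assume "\<And>j. (j, i) \<in> less_than \<Longrightarrow> f j = g j"
    then have "R f i = R g i" unfolding R_def by (auto intro!: arg_cong2[where f = "(-)"] sum.cong)
    then show "good f i r = good g i r" by (simp add: good_def)
  next
    fix i and f :: "nat \<Rightarrow> complex poly \<times> complex poly"
    assume f: "\<And>j. (j, i) \<in> less_than \<Longrightarrow> good f j (f j)"
    show "\<exists>r. good f i r"
    proof (cases "i = 0")
      case True
      then show ?thesis by (simp add: good_def)
    next
      case i: False
      have low: "coeff (fst (f q)) n = 0" if "0 < q" "q < i" "n \<ge> k" for q n
        using f[of q] that by (auto simp: good_def)
      have f0: "f 0 = (J, [:?e:])" using f[of 0] i by (simp add: good_def)
      have degP: "degree (fst (f q)) \<le> k" if "q < i" for q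
      proof (cases "q = 0")
        case True then show ?thesis by (simp add: f0 J(2))
      next
        case False
        then show ?thesis using low that by (intro degree_le) auto
      qed
      have degW: "degree (snd (f q)) \<le> q" if "q < i" for q
        using f[of q] that by (auto simp: good_def f0 split: if_splits)
      have degA: "degree (2 * A) \<le> 2" "coeff (2 * A) 2 = 2"
      proof -
        have "2 * A = [:0, -2, 2:]" by (simp add: A_def numeral_poly)
        then show "degree (2 * A) \<le> 2" "coeff (2 * A) 2 = 2" by (simp_all add: numeral_2_eq_2)
      qed
      let ?tm = "\<lambda>q. pderiv (fst (f q)) * monom (\<psi> $ (i - 1 - q)) (i - 1 - q)"
      have lead: "coeff (2 * A * ?tm q) n = (if q = 0 \<and> n = k + i then 2 * of_nat k * \<psi> $ (i - 1) else 0)"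
        if q: "q < i" and n: "n \<ge> k + i" for q n
      proof (cases "k = 0")
        case True
        then have "pderiv (fst (f q)) = 0" using degP[OF q] by (simp add: pderiv_eq_0_iff)
        then show ?thesis using True by simp
      next
        case False
        have d1: "degree (pderiv (fst (f q))) \<le> k - 1" using degP[OF q] by (simp add: degree_pderiv)
        have d2: "degree (monom (\<psi> $ (i - 1 - q)) (i - 1 - q)) \<le> i - 1 - q" by (rule degree_monom_le)
        have d3: "degree (?tm q) \<le> (k - 1) + (i - 1 - q)"
          using degree_mult_le[of "pderiv (fst (f q))" "monom (\<psi> $ (i - 1 - q)) (i - 1 - q)"] d1 d2 by linarith
        have d4: "degree (2 * A * ?tm q) \<le> 2 + ((k - 1) + (i - 1 - q))"
          using degree_mult_le[of "2 * A" "?tm q"] d3 degA(1) by linarith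
        have d5: "2 + ((k - 1) + (i - 1 - q)) = k + i - q" using False q by linarith
        show ?thesis
        proof (cases "q = 0 \<and> n = k + i")
          case True
          have "coeff (2 * A * ?tm q) (k + i - q) =
             coeff (2 * A) 2 * (coeff (pderiv (fst (f q))) (k - 1) * \<psi> $ (i - 1 - q))"
            by (subst d5[symmetric], subst coeff_mult_top[OF degA(1) d3], subst coeff_mult_top[OF d1 d2]) simp
          moreover have "coeff (pderiv (fst (f q))) (k - 1) = of_nat k"
            using False True by (simp add: f0 coeff_pderiv J(3))
          ultimately show ?thesis using True degA(2) by simp
        next
          case False
          have "degree (2 * A * ?tm q) < n" using False d4 d5 n q by linarith
          then show ?thesis unfolding if_not_P[OF False] by (rule coeff_eq_0)
        qed
      qed
      have lead2: "coeff (snd (f q) * fst (f (i - q))) n = 0"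
        if q: "q \<in> {1..<i}" and n: "n \<ge> k + i" for q n
      proof (cases "k = 0")
        case True
        then have "fst (f (i - q)) = 0" using low[of "i - q"] q by (intro poly_eqI) auto
        then show ?thesis by simp
      next
        case False
        have "degree (fst (f (i - q))) \<le> k - 1" using low[of "i - q"] q by (intro degree_le) auto
        then have "degree (snd (f q) * fst (f (i - q))) \<le> q + (k - 1)"
          using degree_mult_le[of "snd (f q)" "fst (f (i - q))"] degW[of q] q by fastforce
        then show ?thesis using n q False by (intro coeff_eq_0) auto
      qed
      have Rc: "coeff (R f i) n = (if n = k + i then 2 * of_nat k * \<psi> $ (i - 1) else 0)" if n: "n \<ge> k + i" for n
      proof -
        have "coeff (R f i) n = (\<Sum>q<i. coeff (2 * A * ?tm q) n) - (\<Sum>q\<in>{1..<i}. coeff (snd (f q) * fst (f (i - q))) n)"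
          by (simp add: R_def sum_distrib_left coeff_sum)
        also have "(\<Sum>q\<in>{1..<i}. coeff (snd (f q) * fst (f (i - q))) n) = 0"
          using lead2 n by (intro sum.neutral) blast
        also have "(\<Sum>q<i. coeff (2 * A * ?tm q) n) =
            (\<Sum>q<i. if q = 0 \<and> n = k + i then 2 * of_nat k * \<psi> $ (i - 1) else 0)"
          using n by (intro sum.cong refl lead) auto
        also have "\<dots> = (if n = k + i then 2 * of_nat k * \<psi> $ (i - 1) else 0)"
          using i by (cases "n = k + i") simp_all
        also have "\<dots> - 0 = \<dots>" by simp
        finally show ?thesis .
      qed
      have "coeff (- (R f i mod J)) n = 0" if "n \<ge> k" for n
        using degree_mod_less[OF J0, of "R f i"] that by (auto simp: degJ intro: coeff_eq_0)
      then obtain p where p: "\<forall>n\<ge>k. coeff p n = 0" "jacobi_op l m p - smult ?e p = - (R f i mod J)"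
        using jacobi_op_solve[OF order_refl k, of "- (R f i mod J)"] by blast
      let ?w = "R f i div J"
      have wJ: "?w * J = R f i - R f i mod J" by (simp add: minus_mod_eq_div_mult)
      have cw: "coeff (?w * J) n = coeff (R f i) n" if "n \<ge> k + i" for n
        using degree_mod_less[OF J0, of "R f i"] that i unfolding wJ
        by (auto simp: degJ intro!: coeff_eq_0)
      have degw: "degree ?w \<le> i"
      proof (rule ccontr)
        assume c: "\<not> degree ?w \<le> i"
        then have "?w \<noteq> 0" by auto
        then have "degree (?w * J) = degree ?w + k" using J0 degJ by (simp add: degree_mult_eq)
        moreover have "coeff (?w * J) (degree (?w * J)) \<noteq> 0" using \<open>?w \<noteq> 0\<close> J0 by simp
        ultimately have "degree ?w + k > k + i" "coeff (?w * J) (degree ?w + k) \<noteq> 0"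
          using c by simp_all
        then show False using cw[of "degree ?w + k"] Rc[of "degree ?w + k"] by simp
      qed
      have "coeff ?w i = 2 * of_nat k * \<psi> $ (i - 1)"
        using coeff_mult_top[OF degw J(2)] cw[of "i + k"] Rc[of "i + k"] J(3) by (simp add: add.commute)
      moreover have "jacobi_op l m p - smult ?e p + R f i = ?w * J" by (simp add: p(2) wJ)
      ultimately have "good f i (p, ?w)" using i p(1) degw by (simp add: good_def)
      then show ?thesis ..
    qed
  qed
  then obtain f where f: "\<And>i. good f i (f i)" by blast
  define P where "P = Abs_fps (\<lambda>i. fst (f i))"
  define W where "W = Abs_fps (\<lambda>i. snd (f i))"
  have f0: "f 0 = (J, [:?e:])" using f[of 0] by (simp add: good_def)
  have "fps_const A * fps_pderiv (fps_pderiv P) - fps_const B * fps_pderiv P +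
      fps_X * (fps_const (2 * A) * (fps_pderiv P * Abs_fps (\<lambda>i. monom (\<psi> $ i) i))) = W * P"
  proof (rule fps_ext)
    fix i
    let ?S = "fps_pderiv P * Abs_fps (\<lambda>i. monom (\<psi> $ i) i)"
    have L: "(fps_const A * fps_pderiv (fps_pderiv P) - fps_const B * fps_pderiv P +
      fps_X * (fps_const (2 * A) * ?S)) $ i = jacobi_op l m (fst (f i)) + (if i = 0 then 0 else 2 * A * ?S $ (i - 1))"
      by (simp add: jac P_def fps_X_mult_nth)
    show "(fps_const A * fps_pderiv (fps_pderiv P) - fps_const B * fps_pderiv P +
      fps_X * (fps_const (2 * A) * ?S)) $ i = (W * P) $ i"
    proof (cases "i = 0")
      case True
      then show ?thesis unfolding L by (simp add: f0 J(1) W_def P_def)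
    next
      case i: False
      have S: "?S $ (i - 1) = (\<Sum>q<i. pderiv (fst (f q)) * monom (\<psi> $ (i - 1 - q)) (i - 1 - q))"
      proof -
        have "{0..i - 1} = {..<i}" using i by auto
        then show ?thesis by (simp add: fps_mult_nth P_def)
      qed
      have "{0..i} = insert 0 (insert i {1..<i})" using i by auto
      then have "(W * P) $ i = snd (f 0) * fst (f i) + (snd (f i) * fst (f 0) + (\<Sum>q\<in>{1..<i}. snd (f q) * fst (f (i - q))))"
        using i by (simp add: fps_mult_nth W_def P_def)
      also have "snd (f i) * fst (f 0) = jacobi_op l m (fst (f i)) - smult ?e (fst (f i)) + R f i"
        using f[of i] i by (simp add: good_def f0)
      finally show ?thesis unfolding L S using i by (simp add: R_def f0)
    qed
  qed
  moreover have "degree (W $ i) \<le> i" for i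
    using f[of i] by (auto simp: good_def W_def split: if_splits)
  moreover have "coeff (W $ i) i = (if i = 0 then ?e else 2 * of_nat k * \<psi> $ (i - 1))" for i
    using f[of i] by (auto simp: good_def W_def split: if_splits)
  moreover have "poly (P $ 0) 0 \<noteq> 0" "poly (P $ 0) 1 \<noteq> 0" using J by (simp_all add: P_def f0)
  ultimately show ?thesis unfolding A_def B_def by blast
qed

section \<open>Lifting points of the special fibre\<close>

text \<open>\<open>P exp(\<integral>\<psi>)\<close> solves the linear equation, so its logarithmic derivative \<open>\<psi> + P'/P\<close> solves the
Riccati equation. The latter is regular at the point \<open>c\<close>: the value of \<open>P\<close> there is a power series in
\<open>a\<close> with nonzero constant term.\<close>

lemma riccati_scaled_expand:
  fixes P W \<Psi> :: "complex poly fps" and l m :: nat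
  defines "A \<equiv> [:0, 1:] * [:-1, 1:]" and "B \<equiv> of_nat l * [:-1, 1:] + of_nat m * [:0, 1:]"
  assumes ode: "fps_const A * fps_pderiv (fps_pderiv P) - fps_const B * fps_pderiv P +
      fps_X * (fps_const (2 * A) * (fps_pderiv P * \<Psi>)) = W * P"
    and P0: "poly (P $ 0) c \<noteq> 0"
    and T: "T = fps_X + fps_const (fls_const c * fls_X)"
    and S: "S = fps_X + fps_const (fls_const (c - 1) * fls_X)"
  shows "\<exists>\<eta>. riccati l m T S \<eta> = scaled_expand c
    (fps_const A * (fps_X * fps_pderiv \<Psi> + fps_X\<^sup>2 * \<Psi>\<^sup>2) - fps_const B * (fps_X * \<Psi>) + W)"
proof -
  let ?sc = "scaled_expand c"
  let ?a = "fps_const fls_X :: complex fls fps"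
  define p where "p = ?sc P"
  define q where "q = fps_deriv p * inverse p"
  define b where "b = of_nat l * S + of_nat m * T"
  define \<psi> where "\<psi> = ?sc \<Psi>"
  define w where "w = ?sc W"
  note hom = is_ring_homD[OF is_ring_hom_scaled_expand[of c]]
  have fc: "is_ring_hom (fps_const :: complex poly \<Rightarrow> _)" by (simp add: is_ring_hom_def)
  note hom' = is_ring_homD[OF is_ring_hom_comp[OF fc is_ring_hom_scaled_expand[of c]]]
  have T': "T = ?a * ?sc (fps_const [:0, 1:])" and S': "S = ?a * ?sc (fps_const [:-1, 1:])"
    unfolding scaled_expand_linear T S by simp_all
  have A: "?a * ?a * ?sc (fps_const A) = T * S"
    unfolding A_def T' S' hom'(3) by (simp only: mult_ac)
  have B: "?a * ?sc (fps_const B) = b"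
    unfolding B_def b_def T' S' hom'(2,3,10) by (simp only: distrib_left mult_ac)
  have A2: "?sc (fps_const (2 * A)) = 2 * ?sc (fps_const A)"
    using hom'(2)[of A A] by (simp only: mult_2)
  have D: "?sc (fps_pderiv F) = ?a * fps_deriv (?sc F)" for F
    unfolding fps_pderiv_def by (rule scaled_expand_deriv)
  have a': "fps_deriv (?a * f) = ?a * fps_deriv f" for f by simp
  have "?sc (fps_const A * fps_pderiv (fps_pderiv P) - fps_const B * fps_pderiv P +
      fps_X * (fps_const (2 * A) * (fps_pderiv P * \<Psi>))) =
    (?a * ?a * ?sc (fps_const A)) * fps_deriv (fps_deriv p) - (?a * ?sc (fps_const B)) * fps_deriv p
      + 2 * (?a * ?a * ?sc (fps_const A)) * (fps_deriv p * \<psi>)"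
    unfolding hom(2,3,6) D a' A2 scaled_expand_X p_def[symmetric] \<psi>_def[symmetric]
    by (simp only: mult_ac)
  then have eq: "T * S * fps_deriv (fps_deriv p) - b * fps_deriv p + 2 * (T * S) * (fps_deriv p * \<psi>) = w * p"
    unfolding ode A B hom(3) p_def[symmetric] w_def[symmetric] by simp
  have G: "?sc (fps_const A * (fps_X * fps_pderiv \<Psi> + fps_X\<^sup>2 * \<Psi>\<^sup>2) - fps_const B * (fps_X * \<Psi>) + W) =
      T * S * (fps_deriv \<psi> + \<psi>\<^sup>2) - b * \<psi> + w"
    unfolding hom(2,3,6,7) D scaled_expand_X \<psi>_def[symmetric] w_def[symmetric] A[symmetric] B[symmetric]
    by (simp only: power2_eq_square distrib_left mult_ac)
  have "p $ 0 = fps_to_fls (Abs_fps (\<lambda>i. coeff (pcompose (P $ i) [:c, 1:]) 0))"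
    by (simp add: p_def scaled_expand_def)
  moreover have "coeff (pcompose (P $ 0) [:c, 1:]) 0 = poly (P $ 0) c"
    by (simp add: poly_pcompose flip: poly_0_coeff_0)
  then have "Abs_fps (\<lambda>i. coeff (pcompose (P $ i) [:c, 1:]) 0) \<noteq> 0"
    using P0 by (intro fps_nonzeroI[of _ 0]) simp
  ultimately have p0: "p $ 0 \<noteq> 0" by simp
  then have pn: "p \<noteq> 0" by auto
  have qp: "q * p = fps_deriv p"
    using inverse_mult_eq_1[OF p0] by (simp add: q_def mult.assoc)
  have "fps_deriv (fps_deriv p) = fps_deriv (q * p)" by (simp only: qp)
  also have "\<dots> = fps_deriv q * p + q * fps_deriv p" by (simp add: add.commute mult.commute)
  finally have q': "fps_deriv (fps_deriv p) = fps_deriv q * p + q * (q * p)" by (simp only: qp)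
  have "riccati l m T S (\<psi> + q) * p = (T * S * (fps_deriv \<psi> + \<psi>\<^sup>2) - b * \<psi>) * p +
      (T * S * (fps_deriv q * p + q * (q * p)) - b * (q * p) + 2 * (T * S) * (q * p * \<psi>))"
    unfolding riccati_def b_def[symmetric] by (simp add: power2_eq_square algebra_simps)
  also have "\<dots> = (T * S * (fps_deriv \<psi> + \<psi>\<^sup>2) - b * \<psi>) * p +
      (T * S * fps_deriv (fps_deriv p) - b * fps_deriv p + 2 * (T * S) * (fps_deriv p * \<psi>))"
    unfolding q' by (simp only: qp)
  also have "\<dots> = (T * S * (fps_deriv \<psi> + \<psi>\<^sup>2) - b * \<psi> + w) * p"
    unfolding eq by (simp only: distrib_right)
  finally have "riccati l m T S (\<psi> + q) = T * S * (fps_deriv \<psi> + \<psi>\<^sup>2) - b * \<psi> + w"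
    using pn by simp
  then show ?thesis unfolding G by blast
qed

lemma pair_series_add_const:
  fixes Z :: "'k::idom fps"
  assumes "Z $ 0 = 0"
  shows "pair_series Z S (\<lambda>n. \<alpha> n + (if n = 0 then c else 0)) \<beta> = pair_series Z S \<alpha> \<beta> + fps_const c"
proof -
  have "Abs_fps (\<lambda>n. \<alpha> n + (if n = 0 then c else 0)) = Abs_fps \<alpha> + fps_const c"
    by (rule fps_ext) simp
  then show ?thesis by (simp add: pair_series_def fps_compose_add_distrib)
qed

text \<open>Only top coefficients survive at \<open>a = 0\<close>. Those of the first two terms of \<open>G\<close> give
\<open>t\<^sup>2(\<psi>\<^sup>2 + \<psi>') - (\<lambda> + \<mu>)t\<psi>\<close>, and \<open>W\<close> adds \<open>2kt\<psi>\<close>, which turns \<open>\<lambda> + \<mu>\<close> into \<open>\<nu>\<close>.\<close>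

lemma bethe_series_top:
  fixes \<psi> :: "complex fps" and W :: "complex poly fps" and l m :: nat
  defines "A \<equiv> [:0, 1:] * [:-1, 1:]" and "B \<equiv> of_nat l * [:-1, 1:] + of_nat m * [:0, 1:]"
    and "\<Psi> \<equiv> Abs_fps (\<lambda>i. monom (\<psi> $ i) i)"
  assumes \<nu>: "\<nu> + 2 * k = l + m"
    and W: "\<And>i. degree (W $ i) \<le> i"
      "\<And>i. coeff (W $ i) i = (if i = 0 then oper_diag l m k else 2 * of_nat k * \<psi> $ (i - 1))"
    and G: "G = fps_const A * (fps_X * fps_pderiv \<Psi> + fps_X\<^sup>2 * \<Psi>\<^sup>2) - fps_const B * (fps_X * \<Psi>) + W"
  shows "degree (G $ i) \<le> i \<and> coeff (G $ i) i + (if i = 0 then oper_exponent (l + m) else 0) =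
    fls_nth (Op1_elem id \<nu> \<psi>) (int i - 2)"
proof (cases "i = 0")
  case True
  have "G $ 0 = W $ 0" by (simp add: G)
  moreover note oper_diag_eq_A_coeff[OF \<nu>]
  ultimately show ?thesis using True W[of 0] by (simp add: Op1_elem_nth)
next
  case False
  then obtain j where i: "i = Suc j" by (cases i) auto
  define \<Sigma> where "\<Sigma> = (\<Sum>q<j. \<psi> $ q * \<psi> $ (j - 1 - q))"
  have dA: "degree A \<le> 2" "coeff A 2 = 1" and dB: "degree B \<le> 1" "coeff B 1 = of_nat l + of_nat m"
  proof -
    have "A = [:0, -1, 1:]" "B = [:- of_nat l, of_nat l + of_nat m:]"
      by (simp_all add: A_def B_def of_nat_poly)
    then show "degree A \<le> 2" "coeff A 2 = 1" "degree B \<le> 1" "coeff B 1 = of_nat l + of_nat m"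
      by (simp_all add: numeral_2_eq_2)
  qed
  have Gi: "G $ i = A * (monom (of_nat j * \<psi> $ j) (j - 1) + monom \<Sigma> (j - 1)) - B * monom (\<psi> $ j) j + W $ i"
  proof -
    have "(fps_X * fps_pderiv \<Psi>) $ i = monom (of_nat j * \<psi> $ j) (j - 1)"
      by (simp add: i fps_X_mult_nth \<Psi>_def pderiv_monom)
    moreover have "(fps_X\<^sup>2 * \<Psi>\<^sup>2) $ i = monom \<Sigma> (j - 1)"
    proof (cases j)
      case 0
      then show ?thesis by (simp add: i fps_X_power_mult_nth \<Sigma>_def)
    next
      case (Suc n)
      have "(\<Psi>\<^sup>2) $ n = (\<Sum>q=0..n. monom (\<psi> $ q * \<psi> $ (n - q)) n)"
        by (simp add: power2_eq_square fps_mult_nth \<Psi>_def mult_monom)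
      also have "\<dots> = monom (\<Sum>q=0..n. \<psi> $ q * \<psi> $ (n - q)) n" by (simp add: monom_sum)
      also have "{0..n} = {..<j}" using Suc by auto
      finally show ?thesis using Suc by (simp add: i fps_X_power_mult_nth \<Sigma>_def)
    qed
    moreover have "(fps_X * \<Psi>) $ i = monom (\<psi> $ j) j" by (simp add: i fps_X_mult_nth \<Psi>_def)
    ultimately show ?thesis by (simp add: G)
  qed
  have A: "degree (A * monom z (j - 1)) \<le> i \<and> coeff (A * monom z (j - 1)) i = z" if "j = 0 \<Longrightarrow> z = 0" for z
  proof (cases "j = 0")
    case True then show ?thesis using that by simp
  next
    case False
    have d: "degree (monom z (j - 1)) \<le> j - 1" by (rule degree_monom_le)
    have "i = 2 + (j - 1)" using False i by simp
    then show ?thesis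
      using degree_mult_le[of A "monom z (j - 1)"] d dA coeff_mult_top[OF dA(1) d] by auto
  qed
  have B: "degree (B * monom z j) \<le> i \<and> coeff (B * monom z j) i = (of_nat l + of_nat m) * z" for z
  proof -
    have d: "degree (monom z j) \<le> j" by (rule degree_monom_le)
    have "i = 1 + j" using i by simp
    then show ?thesis
      using degree_mult_le[of B "monom z j"] d dB coeff_mult_top[OF dB(1) d] by auto
  qed
  note A1 = A[of "of_nat j * \<psi> $ j"] and A2 = A[of \<Sigma>]
  have \<Sigma>0: "j = 0 \<Longrightarrow> \<Sigma> = 0" by (simp add: \<Sigma>_def)
  have "degree (G $ i) \<le> i"
    unfolding Gi distrib_left
    by (intro degree_add_le degree_diff_le) (use A1 A2 \<Sigma>0 B W(1) in auto)
  have "coeff (G $ i) i = of_nat j * \<psi> $ j + \<Sigma> - (of_nat l + of_nat m) * \<psi> $ j + 2 * of_nat k * \<psi> $ j"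
    unfolding Gi distrib_left coeff_add coeff_diff using A1 A2 \<Sigma>0 B[of "\<psi> $ j"] W(2)[of i] i by simp
  also have "of_nat l + of_nat m = (of_nat \<nu> + 2 * of_nat k :: complex)"
    using arg_cong[OF \<nu>, of "of_nat :: nat \<Rightarrow> complex"] by simp
  also have "of_nat j * \<psi> $ j + \<Sigma> - (of_nat \<nu> + 2 * of_nat k) * \<psi> $ j + 2 * of_nat k * \<psi> $ j =
      (of_nat j - of_nat \<nu>) * \<psi> $ j + \<Sigma>" by (simp add: algebra_simps)
  finally have "coeff (G $ i) i = (of_nat j - of_nat \<nu>) * \<psi> $ j + \<Sigma>" .
  moreover have "degree (G $ i) \<le> i" by fact
  moreover have "fls_nth (Op1_elem id \<nu> \<psi>) (int i - 2) = (of_nat j - of_nat \<nu>) * \<psi> $ j + \<Sigma>"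
    using Op1_elem_nth(3)[of id \<nu> \<psi> j] by (simp add: i \<Sigma>_def)
  ultimately show ?thesis using False by simp
qed

text \<open>The lift is the oper with solution \<open>P exp(\<integral>\<psi>)\<close>. Its coefficients lie in \<open>\<complex>[[a]]\<close> by the degree bound
on \<open>G\<close>, and their constant terms are the top coefficients of \<open>G\<close>.\<close>

theorem Op1_point_lifts:
  fixes \<psi> :: "complex fps"
  assumes k: "k \<le> l" "k \<le> m" and \<nu>: "\<nu> + 2 * k = l + m"
  shows "\<exists>x :: op2_var \<Rightarrow> complex fps.
    E_t id (\<lambda>v. fps_to_fls (x v)) \<in> Op1_points fls_const l \<and>
    E_s id (\<lambda>v. fps_to_fls (x v)) \<in> Op1_points fls_const m \<and>
    (\<forall>n. x (Avar n) $ 0 = Op1_coord 4 (Op1_elem id \<nu> \<psi>) (2 * n)) \<and>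
    (\<forall>n. x (Bvar n) $ 0 = Op1_coord 4 (Op1_elem id \<nu> \<psi>) (2 * n + 1))"
proof -
  let ?A = "[:0, 1:] * [:-1, 1:] :: complex poly"
  let ?B = "of_nat l * [:-1, 1:] + of_nat m * [:0, 1:] :: complex poly"
  let ?\<Psi> = "Abs_fps (\<lambda>i. monom (\<psi> $ i) i)"
  let ?f = "Op1_elem id \<nu> \<psi>"
  obtain P W where PW: "fps_const ?A * fps_pderiv (fps_pderiv P) - fps_const ?B * fps_pderiv P +
      fps_X * (fps_const (2 * ?A) * (fps_pderiv P * ?\<Psi>)) = W * P"
    and W: "\<And>i. degree (W $ i) \<le> i"
      "\<And>i. coeff (W $ i) i = (if i = 0 then oper_diag l m k else 2 * of_nat k * \<psi> $ (i - 1))"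
    and P0: "poly (P $ 0) 0 \<noteq> 0" "poly (P $ 0) 1 \<noteq> 0"
    using bethe_series_exists[OF k, of \<psi>] by blast
  define G where "G = fps_const ?A * (fps_X * fps_pderiv ?\<Psi> + fps_X\<^sup>2 * ?\<Psi>\<^sup>2) - fps_const ?B * (fps_X * ?\<Psi>) + W"
  note top = bethe_series_top[OF \<nu> W G_def]
  have "\<forall>i. \<exists>\<gamma>. G $ i = (\<Sum>j\<le>i. smult (\<gamma> j) (pair_basis j)) \<and> \<gamma> i = coeff (G $ i) i"
    using pair_basis_span top by blast
  then obtain \<gamma> where \<gamma>: "\<And>i. G $ i = (\<Sum>j\<le>i. smult (\<gamma> i j) (pair_basis j))"
      "\<And>i. \<gamma> i i = coeff (G $ i) i" by metis
  define g where "g j = Abs_fps (\<lambda>n. \<gamma> (n + j) j)" for j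
  define x where "x v = (case v of
      Avar n \<Rightarrow> (case n of 0 \<Rightarrow> fps_X\<^sup>2 * fps_const (oper_exponent m)
        | Suc n \<Rightarrow> g (2 * n) + (if n = 0 then fps_const (oper_exponent (l + m)) else 0))
    | Bvar n \<Rightarrow> (case n of 0 \<Rightarrow> fps_X * fps_const (oper_exponent m - oper_exponent l)
        | Suc n \<Rightarrow> g (2 * n + 1)))" for v
  let ?y = "\<lambda>v. fps_to_fls (x v)"
  have oe: "fls_const (oper_exponent n) = (oper_exponent n :: complex fls)" for n
    using fls_const_A_coeff[of n] by (simp add: A_coeff_def oper_exponent_def)
  have tail: "\<exists>\<eta>. riccati l m T S \<eta> = Op2_tail l m ?y T S"
    if c: "c = 0 \<or> c = 1" and P0: "poly (P $ 0) c \<noteq> 0"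
      and T: "T = fps_X + fps_const (fls_const c * fls_X)"
      and S: "S = fps_X + fps_const (fls_const (c - 1) * fls_X)" for c T S
  proof -
    have TS0: "(T * S) $ 0 = 0" using c by (auto simp: T S)
    have "(\<lambda>n. ?y (Avar (Suc n))) = (\<lambda>n. fps_to_fls (g (2 * n)) + (if n = 0 then oper_exponent (l + m) else 0))"
      "(\<lambda>n. ?y (Bvar (Suc n))) = (\<lambda>n. fps_to_fls (g (2 * n + 1)))"
      by (auto simp: x_def oe)
    then have "Op2_tail l m ?y T S = pair_series (T * S) S (\<lambda>n. fps_to_fls (g (2 * n))) (\<lambda>n. fps_to_fls (g (2 * n + 1)))"
      by (simp only: Op2_tail_def pair_series_add_const[OF TS0]) simp
    also have "\<dots> = scaled_expand c G"
      by (rule pair_series_eq_scaled_expand[OF c \<gamma>(1) T S, of "\<lambda>j. fps_to_fls (g j)"]) (simp add: g_def)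
    finally show ?thesis
      using riccati_scaled_expand[OF PW P0 T S] by (simp add: G_def)
  qed
  have "E_t id ?y \<in> Op1_points fls_const l \<and> E_s id ?y \<in> Op1_points fls_const m"
    unfolding Op2_points_iff_riccati
  proof (intro conjI)
    show "?y (Avar 0) = fls_X\<^sup>2 * oper_exponent m"
      by (simp add: x_def fls_times_fps_to_fls fps_to_fls_power oe)
    show "?y (Bvar 0) = fls_X * (oper_exponent m - oper_exponent l)"
      by (simp add: x_def fls_times_fps_to_fls oe flip: fls_minus_const)
    show "\<exists>\<eta>. riccati l m fps_X (fps_X - fps_const fls_X) \<eta> = Op2_tail l m ?y fps_X (fps_X - fps_const fls_X)"
      using P0 by (intro tail[of 0]) (simp_all add: fls_const_uminus)
    show "\<exists>\<eta>. riccati l m (fps_X + fps_const fls_X) fps_X \<eta> = Op2_tail l m ?y (fps_X + fps_const fls_X) fps_X"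
      using P0 by (intro tail[of 1]) simp_all
  qed
  moreover have "x (Avar n) $ 0 = Op1_coord 4 ?f (2 * n)" for n
  proof (cases n)
    case 0
    then show ?thesis by (simp add: x_def Op1_coord_def Op1_elem_nth)
  next
    case (Suc j)
    have "int (2 * n) - int 4 = int (2 * j) - 2" by (simp add: Suc)
    moreover have "x (Avar n) $ 0 = coeff (G $ (2 * j)) (2 * j) + (if 2 * j = 0 then oper_exponent (l + m) else 0)"
      by (simp add: x_def Suc g_def \<gamma>(2))
    ultimately show ?thesis using top[of "2 * j"] by (simp add: Op1_coord_def)
  qed
  moreover have "x (Bvar n) $ 0 = Op1_coord 4 ?f (2 * n + 1)" for n
  proof (cases n)
    case 0
    then show ?thesis by (simp add: x_def Op1_coord_def Op1_elem_nth)
  next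
    case (Suc j)
    have "int (2 * n + 1) - int 4 = int (2 * j + 1) - 2" by (simp add: Suc)
    moreover have "x (Bvar n) $ 0 = coeff (G $ (2 * j + 1)) (2 * j + 1)"
      by (simp add: x_def Suc g_def \<gamma>(2))
    ultimately show ?thesis using top[of "2 * j + 1"] by (simp add: Op1_coord_def)
  qed
  ultimately show ?thesis by blast
qed

text \<open>A polynomial of the closure vanishes at every lift, and the constant term in \<open>a\<close> of its value there
is the value of the reduced polynomial at the given point.\<close>

theorem Op2_special_ideal_subset:
  assumes k: "k \<le> l" "k \<le> m" and \<nu>: "\<nu> + 2 * k = l + m"
  shows "Op2_special_ideal l m \<subseteq> Op1_ideal 4 \<nu>"
proof
  fix q assume q: "q \<in> Op2_special_ideal l m"
  show "q \<in> Op1_ideal 4 \<nu>"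
    unfolding Op1_ideal_iff[of 4, simplified]
  proof
    fix f assume "f \<in> Op1_points id \<nu>"
    then obtain \<psi> where f: "f = Op1_elem id \<nu> \<psi>" by (auto simp: Op1_points_def)
    obtain x where x: "E_t id (\<lambda>v. fps_to_fls (x v)) \<in> Op1_points fls_const l"
        "E_s id (\<lambda>v. fps_to_fls (x v)) \<in> Op1_points fls_const m"
        "\<And>n. x (Avar n) $ 0 = Op1_coord 4 f (2 * n)" "\<And>n. x (Bvar n) $ 0 = Op1_coord 4 f (2 * n + 1)"
      using Op1_point_lifts[OF k \<nu>, of \<psi>] unfolding f by blast
    let ?ev = "meval id (Op1_coord 4 f)"
    have z: "is_ring_hom (\<lambda>z :: complex fps. z $ 0)" by (simp add: is_ring_hom_def)
    have Sp: "?ev (Sp_var v) = x v $ 0" for v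
      by (cases v) (simp_all add: x(3,4) meval_mvar[OF is_ring_hom_id])
    have "?ev (meval (\<lambda>z. mconst (fps_nth z 0)) Sp_var p) = 0" if "p \<in> Op2_ideal l m" for p
    proof -
      have "0 = meval fps_to_fls (\<lambda>v. fps_to_fls (x v)) p"
        using that x(1,2) unfolding Op2_ideal_iff by simp
      also have "\<dots> = fps_to_fls (meval id x p)"
        by (simp add: ring_hom_meval[OF is_ring_hom_fps_to_fls])
      finally have "meval id x p $ 0 = 0" by simp
      then have "meval (\<lambda>z. z $ 0) (\<lambda>v. x v $ 0) p = 0" by (simp add: ring_hom_meval[OF z])
      then show ?thesis
        by (simp add: ring_hom_meval[OF is_ring_hom_meval[OF is_ring_hom_id]]
            meval_mconst[OF is_ring_hom_id] Sp)
    qed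
    then have "\<forall>p\<in>Op2_special_ideal l m. ?ev p = 0"
      unfolding Op2_special_ideal_def ring_hom_ideal_gen_eq_0[OF is_ring_hom_meval[OF is_ring_hom_id]]
      by blast
    then show "?ev q = 0" using q by blast
  qed
qed

section \<open>The oper as an operator on a module of finite rank\<close>

text \<open>Vectors are coordinates with respect to a Newton basis \<open>E\<^sub>0 = 1\<close>, \<open>E\<^bsub>j+1\<^esub> = (t - z\<^sub>j)E\<^sub>j\<close>. Multiplication
by \<open>t + e\<close> is given by the same formula with \<open>z\<^sub>j\<close> replaced by \<open>z\<^sub>j + e\<close>.\<close>

definition newton_mul :: "(nat \<Rightarrow> 'r::comm_ring_1) \<Rightarrow> (nat \<Rightarrow> 'r) \<Rightarrow> nat \<Rightarrow> 'r" where
  "newton_mul z v i = (if i = 0 then 0 else v (i - 1)) + z i * v i"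

text \<open>The node \<open>t = a\<close>, that is \<open>s = 0\<close>, is used \<open>m + 1\<close> times and then \<open>t = 0\<close>. So \<open>E\<^bsub>m+1\<^esub> = s\<^bsup>m+1\<^esup>\<close> and
\<open>E\<^bsub>l+m+2\<^esub> = s\<^bsup>m+1\<^esup>t\<^bsup>l+1\<^esup>\<close>, and both ideals are spanned by final segments of the basis.\<close>

definition newton_node :: "'r::comm_ring_1 \<Rightarrow> nat \<Rightarrow> nat \<Rightarrow> 'r" where
  "newton_node a m i = (if i \<le> m then a else 0)"

definition newton_mul_ts :: "'r::comm_ring_1 \<Rightarrow> nat \<Rightarrow> (nat \<Rightarrow> 'r) \<Rightarrow> nat \<Rightarrow> 'r" where
  "newton_mul_ts a m v =
     newton_mul (\<lambda>i. newton_node a m i + 0) (newton_mul (\<lambda>i. newton_node a m i + - a) v)"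

text \<open>Multiplication by \<open>(ts)\<^sup>n\<close> for \<open>j = 2n\<close> and by \<open>(ts)\<^sup>n(s + b)\<close> for \<open>j = 2n + 1\<close>. The shift \<open>b\<close> is \<open>0\<close>,
except when the two points exchange roles, \<open>(t, s, a)\<close> becoming \<open>(s, t, -a)\<close>: then the old \<open>s\<close> is the new
\<open>t\<close>, which is the new \<open>s\<close> plus the new \<open>a\<close>.\<close>

definition pair_action :: "'r::comm_ring_1 \<Rightarrow> 'r \<Rightarrow> nat \<Rightarrow> nat \<Rightarrow> (nat \<Rightarrow> 'r) \<Rightarrow> nat \<Rightarrow> 'r" where
  "pair_action a b m j v = (newton_mul_ts a m ^^ (j div 2))
     (if even j then v else newton_mul (\<lambda>i. newton_node a m i + (b - a)) v)"

text \<open>\<open>a\<close> times this is the coefficient of \<open>E\<^bsub>j-1\<^esub>\<close> in \<open>ts\<partial>\<^sup>2 - (\<lambda>s + \<mu>t)\<partial>\<close> applied to \<open>E\<^sub>j\<close>. It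
vanishes at \<open>j = m + 1\<close> and \<open>j = l + m + 2\<close>, which makes the two ideals above invariant.\<close>

definition oper_offdiag :: "nat \<Rightarrow> nat \<Rightarrow> nat \<Rightarrow> 'r::comm_ring_1" where
  "oper_offdiag l m j = (if j \<le> m + 1 then of_nat j * (of_nat j - 1 - of_nat m)
     else - (of_nat (j - (m + 1)) * (of_nat (j - (m + 1)) - 1 - of_nat l)))"

text \<open>The operator \<open>ts\<partial>\<^sup>2 - (\<lambda>s + \<mu>t)\<partial> - G\<close> modulo \<open>s\<^bsup>m+1\<^esup>t\<^bsup>l+1\<^esup>\<close>. The series \<open>G\<close> is cut off where \<open>(ts)\<^sup>n\<close>
is divisible by this modulus.\<close>

definition oper_action ::
  "'r::comm_ring_1 \<Rightarrow> 'r \<Rightarrow> nat \<Rightarrow> nat \<Rightarrow> (nat \<Rightarrow> 'r) \<Rightarrow> (nat \<Rightarrow> 'r) \<Rightarrow> nat \<Rightarrow> 'r" where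
  "oper_action a b l m g v i = oper_diag l m i * v i + a * oper_offdiag l m (i + 1) * v (i + 1)
     - (\<Sum>j<2 * (l + m + 2). g j * pair_action a b m j v i)"

definition oper_entry :: "'r::comm_ring_1 \<Rightarrow> 'r \<Rightarrow> nat \<Rightarrow> nat \<Rightarrow> (nat \<Rightarrow> 'r) \<Rightarrow> nat \<Rightarrow> nat \<Rightarrow> 'r" where
  "oper_entry a b l m g i j = oper_action a b l m g (\<lambda>k. if k = j then 1 else 0) i"

lemma newton_mul_linear:
  "newton_mul z (\<lambda>k. \<Sum>j\<in>X. c j * u j k) = (\<lambda>k. \<Sum>j\<in>X. c j * newton_mul z (u j) k)"
  by (rule ext) (simp add: newton_mul_def sum_distrib_left sum.distrib algebra_simps)

lemma newton_mul_ts_funpow_linear: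
  "(newton_mul_ts a m ^^ n) (\<lambda>k. \<Sum>j\<in>X. c j * u j k) = (\<lambda>k. \<Sum>j\<in>X. c j * (newton_mul_ts a m ^^ n) (u j) k)"
  by (induction n) (simp_all add: newton_mul_ts_def newton_mul_linear)

lemma pair_action_linear:
  "pair_action a b m n (\<lambda>k. \<Sum>j\<in>X. c j * u j k) = (\<lambda>k. \<Sum>j\<in>X. c j * pair_action a b m n (u j) k)"
  by (simp add: pair_action_def newton_mul_linear newton_mul_ts_funpow_linear)

lemma oper_action_linear:
  "oper_action a b l m g (\<lambda>k. \<Sum>j\<in>X. c j * u j k) i = (\<Sum>j\<in>X. c j * oper_action a b l m g (u j) i)"
proof -
  have "(\<Sum>n<2 * (l + m + 2). g n * (\<Sum>j\<in>X. c j * pair_action a b m n (u j) i)) =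
      (\<Sum>j\<in>X. c j * (\<Sum>n<2 * (l + m + 2). g n * pair_action a b m n (u j) i))"
    unfolding sum_distrib_left by (subst sum.swap) (simp add: mult_ac)
  then show ?thesis
    unfolding oper_action_def pair_action_linear
    by (simp add: sum_distrib_left sum.distrib sum_subtractf algebra_simps)
qed

lemma oper_action_eq_entries:
  assumes "\<And>j. j \<ge> N \<Longrightarrow> v j = 0"
  shows "oper_action a b l m g v i = (\<Sum>j<N. oper_entry a b l m g i j * v j)"
proof -
  have "v k = (\<Sum>j<N. v j * (if k = j then 1 else 0))" for k
  proof -
    have "(\<Sum>j<N. v j * (if k = j then 1 else 0)) = (\<Sum>j<N. if j = k then v k else 0)"
      by (intro sum.cong) auto
    then show ?thesis using assms[of k] by (cases "k < N") simp_all
  qed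
  then have "v = (\<lambda>k. \<Sum>j<N. v j * (if k = j then 1 else 0))" by blast
  then have "oper_action a b l m g v i = oper_action a b l m g (\<lambda>k. \<Sum>j<N. v j * (if k = j then 1 else 0)) i"
    by (rule arg_cong)
  then show ?thesis unfolding oper_action_linear oper_entry_def by (simp add: mult.commute)
qed

text \<open>The construction is natural in the base ring.\<close>

lemma ring_hom_newton_mul:
  assumes "is_ring_hom h"
  shows "(\<lambda>i. h (newton_mul z v i)) = newton_mul (\<lambda>i. h (z i)) (\<lambda>i. h (v i))"
  by (rule ext) (simp add: newton_mul_def is_ring_homD[OF assms])

lemma ring_hom_pair_action:
  assumes h: "is_ring_hom h"
  shows "h (pair_action a b m j v i) = pair_action (h a) (h b) m j (\<lambda>i. h (v i)) i"
proof -
  have node: "(\<lambda>i. h (newton_node a m i)) = newton_node (h a) m"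
    by (rule ext) (simp add: newton_node_def is_ring_homD[OF h])
  note node' = fun_cong[OF node]
  have mul: "(\<lambda>i. h (newton_mul (\<lambda>i. newton_node a m i + e) v i)) =
      newton_mul (\<lambda>i. newton_node (h a) m i + h e) (\<lambda>i. h (v i))" for e v
    unfolding ring_hom_newton_mul[OF h] by (simp add: is_ring_homD[OF h] node')
  have ts: "(\<lambda>i. h (newton_mul_ts a m v i)) = newton_mul_ts (h a) m (\<lambda>i. h (v i))" for v
    unfolding newton_mul_ts_def mul by (simp add: is_ring_homD[OF h])
  have pow: "(\<lambda>i. h ((newton_mul_ts a m ^^ n) v i)) = (newton_mul_ts (h a) m ^^ n) (\<lambda>i. h (v i))" for n v
    by (induction n) (simp_all add: ts)
  have "(\<lambda>i. h (pair_action a b m j v i)) = pair_action (h a) (h b) m j (\<lambda>i. h (v i))"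
    unfolding pair_action_def pow by (simp add: mul is_ring_homD[OF h])
  then show ?thesis by (rule fun_cong)
qed

lemma ring_hom_oper_entry:
  assumes h: "is_ring_hom h"
  shows "h (oper_entry a b l m g i j) = oper_entry (h a) (h b) l m (\<lambda>j. h (g j)) i j"
proof -
  have u: "(\<lambda>k. h (if k = j then 1 else 0)) = (\<lambda>k. if k = j then 1 else 0)"
    by (rule ext) (simp add: is_ring_homD[OF h])
  have two: "h 2 = 2" using is_ring_homD(2)[OF h, of 1 1] by (simp add: is_ring_homD(1)[OF h])
  have d: "h (oper_diag l m i) = oper_diag l m i" "h (oper_offdiag l m n) = oper_offdiag l m n" for n
    by (simp_all add: oper_diag_def oper_offdiag_def is_ring_homD[OF h] two)
  show ?thesis
    unfolding oper_entry_def oper_action_def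
    by (simp add: is_ring_homD[OF h] ring_hom_pair_action[OF h] u d)
qed

lemma pair_action_vanishes_below:
  assumes "\<And>k. k \<le> i \<Longrightarrow> v k = 0"
  shows "pair_action a b m j v i = 0"
proof -
  have mul: "\<forall>k\<le>i. newton_mul z v k = 0" if "\<forall>k\<le>i. v k = 0" for z v
    using that by (auto simp: newton_mul_def)
  have "\<forall>k\<le>i. (newton_mul_ts a m ^^ n) v k = 0" if "\<forall>k\<le>i. v k = 0" for n v
    by (induction n) (use that in \<open>simp_all add: newton_mul_ts_def mul\<close>)
  then show ?thesis using assms by (simp add: pair_action_def mul)
qed

lemma oper_entry_block:
  assumes "i \<le> m" "m < j"
  shows "oper_entry a b l m g i j = 0"
proof -
  have "pair_action a b m n (\<lambda>k. if k = j then 1 else 0) i = 0" for n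
    by (rule pair_action_vanishes_below) (use assms in auto)
  moreover have "oper_offdiag l m (i + 1) * (if i + 1 = j then 1 else 0) = (0 :: 'a)"
  proof (cases "i + 1 = j")
    case True
    then have "i = m" using assms by linarith
    then show ?thesis by (simp add: oper_offdiag_def)
  qed simp
  ultimately show ?thesis using assms by (simp add: oper_entry_def oper_action_def mult.assoc)
qed

lemma pair_action_special: "pair_action 0 0 m j v i = (if j \<le> i then v (i - j) else 0)"
proof -
  have mul: "newton_mul (\<lambda>i. newton_node 0 m i + (0 - 0)) v = (\<lambda>i. if 1 \<le> i then v (i - 1) else 0)"
    "newton_mul (\<lambda>i. newton_node 0 m i + 0) v = (\<lambda>i. if 1 \<le> i then v (i - 1) else 0)"
    "newton_mul (\<lambda>i. newton_node 0 m i + - 0) v = (\<lambda>i. if 1 \<le> i then v (i - 1) else 0)" for v :: "nat \<Rightarrow> 'a"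
    by (auto simp: newton_mul_def newton_node_def fun_eq_iff)
  have pow: "(newton_mul_ts 0 m ^^ n) v = (\<lambda>i. if 2 * n \<le> i then v (i - 2 * n) else 0)" for n and v :: "nat \<Rightarrow> 'a"
  proof (induction n)
    case (Suc n)
    have "(newton_mul_ts 0 m ^^ Suc n) v = newton_mul_ts 0 m (\<lambda>i. if 2 * n \<le> i then v (i - 2 * n) else 0)"
      using Suc by simp
    also have "\<dots> = (\<lambda>i. if 2 * Suc n \<le> i then v (i - 2 * Suc n) else 0)"
      unfolding newton_mul_ts_def mul by (rule ext) (auto simp: numeral_2_eq_2 intro: arg_cong)
    finally show ?case .
  qed simp
  show ?thesis
  proof (cases "even j")
    case True
    then show ?thesis by (simp add: pair_action_def pow)
  next
    case False
    then obtain q where j: "j = 2 * q + 1" by (rule oddE)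
    then show ?thesis unfolding pair_action_def pow mul by auto
  qed
qed

text \<open>At \<open>a = 0\<close> all nodes coincide, the basis is \<open>t\<^sup>j\<close>, and \<open>G\<close> multiplies by \<open>\<Sum>\<^sub>j g\<^sub>j t\<^sup>j\<close>.\<close>

lemma oper_entry_special:
  assumes "i < l + m + 2"
  shows "oper_entry 0 0 l m g i j = (if i = j then oper_diag l m i else 0) - (if j \<le> i then g (i - j) else 0)"
proof -
  have "(\<Sum>n<2 * (l + m + 2). g n * (if n \<le> i then if i - n = j then 1 else 0 else 0)) =
      (\<Sum>n<2 * (l + m + 2). if n = i - j then (if j \<le> i then g (i - j) else 0) else 0)"
    by (intro sum.cong) auto
  also have "\<dots> = (if j \<le> i then g (i - j) else 0)"
  proof -
    have "(\<Sum>n<K. if n = i - j then c else 0) = c" if "i < K" for K and c :: 'a using that by simp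
    from this[of "2 * (l + m + 2)"] show ?thesis using assms by simp
  qed
  finally show ?thesis
    unfolding oper_entry_def oper_action_def pair_action_special by simp
qed

section \<open>The operator at the two singular points\<close>

definition newton_basis :: "'k::field_char_0 fps \<Rightarrow> 'k \<Rightarrow> nat \<Rightarrow> nat \<Rightarrow> 'k fps" where
  "newton_basis T a m j = (\<Prod>i<j. T - fps_const (newton_node a m i))"

definition newton_series :: "'k::field_char_0 fps \<Rightarrow> 'k \<Rightarrow> nat \<Rightarrow> nat \<Rightarrow> (nat \<Rightarrow> 'k) \<Rightarrow> 'k fps" where
  "newton_series T a m N v = (\<Sum>j<N. fps_const (v j) * newton_basis T a m j)"

lemma is_ring_hom_fps_const: "is_ring_hom (fps_const :: 'k::comm_ring_1 \<Rightarrow> _)"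
  by (simp add: is_ring_hom_def)

lemma newton_basis_low: "j \<le> m + 1 \<Longrightarrow> newton_basis (S + fps_const a) a m j = S ^ j"
  by (induction j) (auto simp: newton_basis_def newton_node_def)

lemma newton_basis_high:
  "newton_basis (S + fps_const a) a m (m + 1 + i) = S ^ (m + 1) * (S + fps_const a) ^ i"
proof (induction i)
  case 0
  then show ?case using newton_basis_low[of "m + 1" m S a] by simp
next
  case (Suc i)
  have "newton_basis (S + fps_const a) a m (m + 1 + Suc i) =
      newton_basis (S + fps_const a) a m (m + 1 + i) * (S + fps_const a)"
    by (simp add: newton_basis_def newton_node_def)
  then show ?case by (simp only: Suc power_Suc mult_ac)
qed

lemma newton_series_split:
  "newton_series (S + fps_const a) a m (l + m + 2) v = (\<Sum>j\<le>m. fps_const (v j) * S ^ j) +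
     S ^ (m + 1) * (\<Sum>i\<le>l. fps_const (v (m + 1 + i)) * (S + fps_const a) ^ i)"
proof -
  let ?E = "newton_basis (S + fps_const a) a m"
  have "{..<l + m + 2} = {..m} \<union> (\<lambda>i. m + 1 + i) ` {..l}"
  proof -
    have "x \<le> m \<or> x \<in> (\<lambda>i. m + 1 + i) ` {..l}" if "x < l + m + 2" for x
    proof (cases "x \<le> m")
      case False
      then have "x = m + 1 + (x - (m + 1))" "x - (m + 1) \<le> l" using that by linarith+
      then show ?thesis by blast
    qed simp
    then show ?thesis by auto
  qed
  moreover have "{..m} \<inter> (\<lambda>i. m + 1 + i) ` {..l} = {}" by auto
  ultimately have "newton_series (S + fps_const a) a m (l + m + 2) v =
      (\<Sum>j\<le>m. fps_const (v j) * ?E j) + (\<Sum>j\<in>(\<lambda>i. m + 1 + i) ` {..l}. fps_const (v j) * ?E j)"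
    unfolding newton_series_def by (simp add: sum.union_disjoint)
  also have "(\<Sum>j\<in>(\<lambda>i. m + 1 + i) ` {..l}. fps_const (v j) * ?E j) =
      (\<Sum>i\<le>l. fps_const (v (m + 1 + i)) * ?E (m + 1 + i))"
    by (subst sum.reindex) (auto simp: inj_on_def)
  finally show ?thesis
    unfolding newton_basis_high by (simp add: newton_basis_low sum_distrib_left mult_ac)
qed

lemma newton_series_mul:
  "newton_series T a m (Suc N) (newton_mul (\<lambda>i. newton_node a m i + e) v) + fps_const (v N) * newton_basis T a m (Suc N) =
    (T + fps_const e) * newton_series T a m (Suc N) v"
proof (induction N)
  case 0
  then show ?case by (simp add: newton_series_def newton_mul_def newton_basis_def algebra_simps flip: fps_const_add fps_const_mult)
next
  case (Suc N)
  have step: "newton_series T a m (Suc (Suc N)) u = newton_series T a m (Suc N) u + fps_const (u (Suc N)) * newton_basis T a m (Suc N)" for u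
    by (simp add: newton_series_def)
  have b: "newton_basis T a m (Suc (Suc N)) = newton_basis T a m (Suc N) * (T - fps_const (newton_node a m (Suc N)))"
    by (simp add: newton_basis_def)
  show ?case
    unfolding step[of v] distrib_left Suc.IH[symmetric] step[of "newton_mul _ v"] b
    by (simp add: newton_mul_def algebra_simps flip: fps_const_add fps_const_mult)
qed

lemma newton_series_mul_dvd:
  assumes "N > 0"
  shows "newton_basis T a m N dvd (T + fps_const e) * newton_series T a m N v -
    newton_series T a m N (newton_mul (\<lambda>i. newton_node a m i + e) v)"
proof -
  obtain M where N: "N = Suc M" using assms by (cases N) auto
  show ?thesis unfolding N newton_series_mul[symmetric] by simp
qed

text \<open>The coordinate formulas compute products exactly except for the component that overflows into
\<open>E\<^sub>N\<close>, which is why they hold only modulo \<open>E\<^sub>N\<close>.\<close>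

lemma newton_series_pair_action_dvd:
  assumes N: "N > 0" and T: "T = S + fps_const a"
  shows "newton_basis T a m N dvd (T * S) ^ (j div 2) * (S + fps_const b) ^ (j mod 2) * newton_series T a m N v -
    newton_series T a m N (pair_action a b m j v)"
proof -
  let ?E = "newton_basis T a m N" and ?s = "newton_series T a m N"
  have trans: "?E dvd (h * f) * p - ?s w'" if "?E dvd f * p - ?s w" "?E dvd h * ?s w - ?s w'" for h f p w w'
  proof -
    have eq: "(h * f) * p - ?s w' = h * (f * p - ?s w) + (h * ?s w - ?s w')" by (simp add: algebra_simps)
    show ?thesis unfolding eq by (rule dvd_add[OF dvd_mult[OF that(1)] that(2)])
  qed
  have S: "T + fps_const (- a) = S" "T + fps_const 0 = T" "T + fps_const (b - a) = S + fps_const b"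
    by (simp_all add: T flip: fps_const_sub)
  have ts: "?E dvd (T * S) * ?s w - ?s (newton_mul_ts a m w)" for w
    unfolding newton_mul_ts_def
    by (rule trans[OF newton_series_mul_dvd[OF N, of T a m "- a", unfolded S]
          newton_series_mul_dvd[OF N, of T a m 0, unfolded S]])
  have pow: "?E dvd ((T * S) ^ n * f) * ?s v - ?s ((newton_mul_ts a m ^^ n) w)" if "?E dvd f * ?s v - ?s w" for n f w
  proof (induction n)
    case (Suc n)
    show ?case using trans[OF Suc ts] by (simp add: mult.assoc)
  qed (use that in simp)
  show ?thesis
  proof (cases "even j")
    case True
    have "?E dvd 1 * ?s v - ?s v" by simp
    from pow[OF this, of "j div 2"] show ?thesis using True by (simp add: pair_action_def)
  next
    case False
    have "?E dvd (S + fps_const b) * ?s v - ?s (newton_mul (\<lambda>i. newton_node a m i + (b - a)) v)"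
      using newton_series_mul_dvd[OF N, of T a m "b - a" v] unfolding S .
    moreover have "j mod 2 = 1" using False by presburger
    ultimately show ?thesis using pow[of "S + fps_const b"] False by (simp add: pair_action_def)
  qed
qed

text \<open>The derivative part of the operator, on power series at one of the two points.\<close>

definition oper_deriv :: "nat \<Rightarrow> nat \<Rightarrow> 'k::field_char_0 fps \<Rightarrow> 'k fps \<Rightarrow> 'k fps \<Rightarrow> 'k fps" where
  "oper_deriv l m T S y = T * S * fps_deriv (fps_deriv y) - (of_nat l * S + of_nat m * T) * fps_deriv y"

lemma oper_deriv_newton_basis:
  fixes S :: "'k::field_char_0 fps"
  assumes S: "fps_deriv S = 1" and T: "T = S + fps_const a"
  shows "oper_deriv l m T S (newton_basis T a m j) = fps_const (oper_diag l m j) * newton_basis T a m j +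
    fps_const (a * oper_offdiag l m j) * newton_basis T a m (j - 1)"
proof -
  have T': "fps_deriv T = 1" by (simp add: T S)
  have D: "fps_deriv (S ^ n) = of_nat n * S ^ (n - 1)" "fps_deriv (T ^ n) = of_nat n * T ^ (n - 1)" for n
    by (simp_all add: fps_deriv_power' S T')
  have up: "S * (of_nat n * S ^ (n - 1)) = of_nat n * S ^ n" "T * (of_nat n * T ^ (n - 1)) = of_nat n * T ^ n" for n
    by (cases n; simp)+
  have nat: "fps_const (of_nat n) = (of_nat n :: 'k fps)" for n by (simp add: fps_of_nat)
  have c: "fps_deriv (of_nat n * f) = of_nat n * fps_deriv f" for n and f :: "'k fps"
    by (simp flip: nat)
  show ?thesis
  proof (cases "j \<le> m + 1")
    case True
    show ?thesis
    proof (cases j)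
      case 0
      then show ?thesis by (simp add: oper_deriv_def newton_basis_def oper_diag_def oper_offdiag_def)
    next
      case (Suc i)
      have d1: "fps_deriv (S ^ j) = of_nat j * S ^ i" by (simp only: D Suc diff_Suc_1)
      have "fps_deriv (fps_deriv (S ^ j)) = of_nat j * (of_nat i * S ^ (i - 1))"
        by (subst d1) (simp only: c D)
      then have "T * S * fps_deriv (fps_deriv (S ^ j)) = of_nat j * T * (S * (of_nat i * S ^ (i - 1)))"
        by (simp add: mult_ac)
      also have "\<dots> = of_nat j * of_nat i * (T * S ^ i)" unfolding up by (simp add: mult_ac)
      finally have "oper_deriv l m T S (S ^ j) = of_nat j * of_nat i * (T * S ^ i) -
          (of_nat l * S + of_nat m * T) * (of_nat j * S ^ i)"
        by (simp only: oper_deriv_def d1)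
      also have "\<dots> = of_nat j * (of_nat j - 1 - of_nat l - of_nat m) * S ^ j +
          fps_const a * (of_nat j * (of_nat j - 1 - of_nat m)) * S ^ i"
        by (simp add: T Suc algebra_simps del: fps_const_mult)
      also have "\<dots> = fps_const (oper_diag l m j) * S ^ j + fps_const (a * oper_offdiag l m j) * S ^ i"
        using True by (simp add: oper_diag_def oper_offdiag_def nat flip: fps_const_mult fps_const_sub)
      finally show ?thesis using True Suc by (simp add: T newton_basis_low)
    qed
  next
    case False
    then obtain k where j: "j = m + 1 + Suc k" by (metis add_Suc_right less_imp_Suc_add not_le)
    define y where "y = S ^ (m + 1) * T ^ Suc k"
    define p where "p = S ^ m * T ^ k"
    have y: "newton_basis T a m j = y" "newton_basis T a m (j - 1) = S * p"
      using newton_basis_high[of S a m "Suc k"] newton_basis_high[of S a m k]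
      by (simp_all add: j y_def p_def T)
    have y': "fps_deriv y = of_nat (m + 1) * (S ^ m * T ^ Suc k) + of_nat (Suc k) * (S ^ (m + 1) * T ^ k)"
      unfolding y_def fps_deriv_mult D by (simp add: mult_ac)
    have d1: "S * fps_deriv (S ^ m * T ^ Suc k) = of_nat m * (S ^ m * T ^ Suc k) + of_nat (Suc k) * (S ^ (m + 1) * T ^ k)"
    proof -
      have "S * fps_deriv (S ^ m * T ^ Suc k) = S * (of_nat m * S ^ (m - 1)) * T ^ Suc k + S * S ^ m * (of_nat (Suc k) * T ^ k)"
        unfolding fps_deriv_mult D by (simp add: algebra_simps)
      then show ?thesis unfolding up by (simp add: mult_ac)
    qed
    have d2: "T * fps_deriv (S ^ (m + 1) * T ^ k) = of_nat (m + 1) * (S ^ m * T ^ Suc k) + of_nat k * (S ^ (m + 1) * T ^ k)"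
    proof -
      have "T * fps_deriv (S ^ (m + 1) * T ^ k) = S ^ (m + 1) * (T * (of_nat k * T ^ (k - 1))) + T * T ^ k * (of_nat (m + 1) * S ^ m)"
        unfolding fps_deriv_mult D by (simp add: algebra_simps)
      then show ?thesis unfolding up by (simp add: mult_ac)
    qed
    have "T * S * fps_deriv (fps_deriv y) =
        of_nat (m + 1) * T * (S * fps_deriv (S ^ m * T ^ Suc k)) + of_nat (Suc k) * S * (T * fps_deriv (S ^ (m + 1) * T ^ k))"
      unfolding y' fps_deriv_add c by (simp add: algebra_simps)
    also have "\<dots> = of_nat (m + 1) * of_nat m * (T * T * p) + 2 * (of_nat (m + 1) * of_nat (Suc k)) * (S * T * p) +
        of_nat (Suc k) * of_nat k * (S * S * p)"
      unfolding d1 d2 p_def by (simp add: algebra_simps)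
    finally have "oper_deriv l m T S y = of_nat (m + 1) * of_nat m * (T * T * p) +
        2 * (of_nat (m + 1) * of_nat (Suc k)) * (S * T * p) + of_nat (Suc k) * of_nat k * (S * S * p) -
        (of_nat l * S + of_nat m * T) * (of_nat (m + 1) * (T * p) + of_nat (Suc k) * (S * p))"
      unfolding oper_deriv_def y' p_def by (simp add: mult_ac)
    also have "\<dots> = of_nat j * (of_nat j - 1 - of_nat l - of_nat m) * (S * T * p) +
        fps_const a * - (of_nat (Suc k) * (of_nat (Suc k) - 1 - of_nat l)) * (S * p)"
      by (simp add: T j algebra_simps del: fps_const_mult)
    also have "\<dots> = fps_const (oper_diag l m j) * y + fps_const (a * oper_offdiag l m j) * (S * p)"
    proof -
      have "oper_offdiag l m j = (- (of_nat (Suc k) * (of_nat (Suc k) - 1 - of_nat l)) :: 'k)"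
        by (simp add: oper_offdiag_def j)
      moreover have "S * T * p = y" by (simp add: p_def y_def mult_ac)
      ultimately show ?thesis
        by (simp only: oper_diag_def nat flip: fps_const_mult fps_const_sub fps_const_neg)
          (simp add: nat flip: fps_const_mult fps_const_sub fps_const_neg)
    qed
    finally show ?thesis unfolding y .
  qed
qed

lemma oper_deriv_newton_series:
  fixes S :: "'k::field_char_0 fps"
  assumes S: "fps_deriv S = 1" and T: "T = S + fps_const a"
  shows "oper_deriv l m T S (newton_series T a m (l + m + 2) v) =
    newton_series T a m (l + m + 2) (\<lambda>i. oper_diag l m i * v i + a * oper_offdiag l m (i + 1) * v (i + 1))"
proof -
  let ?E = "newton_basis T a m"
  have lin: "oper_deriv l m T S (\<Sum>j<N. fps_const (v j) * ?E j) = (\<Sum>j<N. fps_const (v j) * oper_deriv l m T S (?E j))" for N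
    by (induction N) (simp_all add: oper_deriv_def algebra_simps)
  have shift: "(\<Sum>j<N. fps_const (v j) * (fps_const (oper_diag l m j) * ?E j + fps_const (a * oper_offdiag l m j) * ?E (j - 1)))
      + fps_const (a * oper_offdiag l m N * v N) * ?E (N - 1)
    = (\<Sum>j<N. fps_const (oper_diag l m j * v j + a * oper_offdiag l m (j + 1) * v (j + 1)) * ?E j)
      + (if N = 0 then 0 else 0)" if "N > 0" for N
    using that
  proof (induction N rule: nat_induct_non_zero)
    case 1
    show ?case by (simp add: oper_offdiag_def algebra_simps
          flip: fps_const_add fps_const_mult fps_const_sub fps_const_neg)
  next
    case (Suc N)
    then show ?case by (simp add: algebra_simps flip: fps_const_add fps_const_mult)
  qed
  have "oper_offdiag l m (l + m + 2) = (0 :: 'k)" by (simp add: oper_offdiag_def)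
  then show ?thesis
    unfolding newton_series_def lin oper_deriv_newton_basis[OF S T] using shift[of "l + m + 2"] by simp
qed

lemma fps_X_power_dvd_iff: "fps_X ^ n dvd f \<longleftrightarrow> (\<forall>i<n. f $ i = 0)"
  for f :: "'k::comm_ring_1 fps"
proof
  assume "fps_X ^ n dvd f"
  then show "\<forall>i<n. f $ i = 0" by (auto simp: fps_X_power_mult_nth elim!: dvdE)
next
  assume "\<forall>i<n. f $ i = 0"
  then have "f = fps_X ^ n * fps_shift n f" by (intro fps_ext) (simp add: fps_X_power_mult_nth)
  then show "fps_X ^ n dvd f" by (rule dvdI)
qed

lemma oper_deriv_swap: "oper_deriv l m T S = oper_deriv m l S T"
  by (rule ext) (simp add: oper_deriv_def algebra_simps)

text \<open>\<open>0\<close> and \<open>m + 1\<close> are the exponents of the operator at \<open>s = 0\<close>: the term of order \<open>m\<close> produced from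
\<open>s\<^bsup>m+1\<^esup>\<close> cancels.\<close>

lemma oper_deriv_preserves_order:
  fixes f :: "'k::field_char_0 fps"
  assumes "fps_X ^ (m + 1) dvd f"
  shows "fps_X ^ (m + 1) dvd oper_deriv l m T fps_X f"
proof -
  obtain h where f: "f = fps_X ^ (m + 1) * h" using assms by (rule dvdE)
  have f': "fps_deriv f = of_nat (m + 1) * (fps_X ^ m * h) + fps_X ^ (m + 1) * fps_deriv h"
    unfolding f fps_deriv_mult by (simp add: fps_deriv_power' mult_ac add_ac del: power_Suc)
  have c: "fps_deriv (of_nat n * f) = of_nat n * fps_deriv f" for n and f :: "'k fps"
    by (simp flip: fps_of_nat)
  have up: "fps_X * (of_nat n * fps_X ^ (n - 1)) = (of_nat n * fps_X ^ n :: 'k fps)" for n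
    by (cases n) simp_all
  have "fps_X * fps_deriv (fps_X ^ m * h) = fps_X * (of_nat m * fps_X ^ (m - 1)) * h + fps_X ^ (m + 1) * fps_deriv h"
    unfolding fps_deriv_mult by (simp add: fps_deriv_power' algebra_simps)
  then have d1: "fps_X * fps_deriv (fps_X ^ m * h) = of_nat m * (fps_X ^ m * h) + fps_X ^ (m + 1) * fps_deriv h"
    unfolding up by (simp add: mult_ac)
  have d2: "fps_deriv (fps_X ^ (m + 1) * fps_deriv h) = of_nat (m + 1) * (fps_X ^ m * fps_deriv h) + fps_X ^ (m + 1) * fps_deriv (fps_deriv h)"
    unfolding fps_deriv_mult by (simp add: fps_deriv_power' mult_ac add_ac del: power_Suc)
  have "fps_X * fps_deriv (fps_deriv f) - of_nat m * fps_deriv f =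
      of_nat (m + 1) * (fps_X * fps_deriv (fps_X ^ m * h)) + fps_X * fps_deriv (fps_X ^ (m + 1) * fps_deriv h)
      - of_nat m * fps_deriv f"
    unfolding f' fps_deriv_add c by (simp add: algebra_simps)
  also have "\<dots> = fps_X ^ (m + 1) * (of_nat (m + 2) * fps_deriv h + fps_X * fps_deriv (fps_deriv h))"
    unfolding d1 d2 f' by (simp add: algebra_simps)
  finally have 1: "fps_X * fps_deriv (fps_deriv f) - of_nat m * fps_deriv f =
      fps_X ^ (m + 1) * (of_nat (m + 2) * fps_deriv h + fps_X * fps_deriv (fps_deriv h))" .
  have 2: "fps_X * fps_deriv f = fps_X ^ (m + 1) * (of_nat (m + 1) * h + fps_X * fps_deriv h)"
    unfolding f' by (simp add: algebra_simps)
  have "oper_deriv l m T fps_X f =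
      T * (fps_X * fps_deriv (fps_deriv f) - of_nat m * fps_deriv f) - of_nat l * (fps_X * fps_deriv f)"
    by (simp add: oper_deriv_def algebra_simps)
  also have "\<dots> = fps_X ^ (m + 1) * (T * (of_nat (m + 2) * fps_deriv h + fps_X * fps_deriv (fps_deriv h)) -
      of_nat l * (of_nat (m + 1) * h + fps_X * fps_deriv h))"
    unfolding 1 2 by (simp only: right_diff_distrib mult.left_commute)
  finally show ?thesis by (rule dvdI)
qed

definition pair_polynomial :: "'k::comm_ring_1 fps \<Rightarrow> 'k fps \<Rightarrow> nat \<Rightarrow> (nat \<Rightarrow> 'k) \<Rightarrow> 'k fps" where
  "pair_polynomial Z S N g = (\<Sum>j<2 * N. fps_const (g j) * (Z ^ (j div 2) * S ^ (j mod 2)))"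

lemma pair_series_minus_polynomial_dvd:
  fixes Z :: "'k::comm_ring_1 fps"
  assumes "Z $ 0 = 0" "n \<le> N"
  shows "fps_X ^ n dvd pair_series Z S (\<lambda>k. g (2 * k)) (\<lambda>k. g (2 * k + 1)) - pair_polynomial Z S N g"
  unfolding fps_X_power_dvd_iff
proof (intro allI impI)
  fix i assume "i < n"
  then obtain M where N: "N = Suc M" "i \<le> M" using assms(2) by (cases N) auto
  have "pair_polynomial Z S N g = (\<Sum>j\<le>2 * M + 1. fps_const (g j) * (Z ^ (j div 2) * S ^ (j mod 2)))"
    unfolding pair_polynomial_def N by (rule sum.cong) auto
  also have "\<dots> = (\<Sum>k\<le>M. fps_const (g (2 * k)) * (Z ^ (2 * k div 2) * S ^ (2 * k mod 2)) +
      fps_const (g (2 * k + 1)) * (Z ^ ((2 * k + 1) div 2) * S ^ ((2 * k + 1) mod 2)))"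
    by (rule sum_even_odd[symmetric])
  also have "\<dots> = (\<Sum>k\<le>M. (fps_const (g (2 * k)) + fps_const (g (2 * k + 1)) * S) * Z ^ k)"
  proof (intro sum.cong refl)
    fix k :: nat
    have d: "(2 * k + 1) div 2 = k" "(2 * k + 1) mod 2 = 1" "2 * k div 2 = k" "2 * k mod 2 = 0" by simp_all
    show "fps_const (g (2 * k)) * (Z ^ (2 * k div 2) * S ^ (2 * k mod 2)) +
        fps_const (g (2 * k + 1)) * (Z ^ ((2 * k + 1) div 2) * S ^ ((2 * k + 1) mod 2)) =
        (fps_const (g (2 * k)) + fps_const (g (2 * k + 1)) * S) * Z ^ k"
      unfolding d by (simp add: algebra_simps)
  qed
  finally show "(pair_series Z S (\<lambda>k. g (2 * k)) (\<lambda>k. g (2 * k + 1)) - pair_polynomial Z S N g) $ i = 0"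
    using pair_series_nth_truncate[OF assms(1) N(2), of S "\<lambda>k. g (2 * k)" "\<lambda>k. g (2 * k + 1)"] by simp
qed

lemma newton_series_oper_action_dvd:
  fixes S :: "'k::field_char_0 fps" and l m :: nat
  assumes S: "fps_deriv S = 1" and T: "T = S + fps_const a"
  defines "N \<equiv> l + m + 2"
  shows "newton_basis T a m N dvd oper_deriv l m T S (newton_series T a m N v) -
    pair_polynomial (T * S) (S + fps_const b) N g * newton_series T a m N v -
    newton_series T a m N (oper_action a b l m g v)"
proof -
  let ?s = "newton_series T a m N" and ?B = "\<lambda>j. (T * S) ^ (j div 2) * (S + fps_const b) ^ (j mod 2)"
  have "?s (oper_action a b l m g v) = ?s (\<lambda>i. oper_diag l m i * v i + a * oper_offdiag l m (i + 1) * v (i + 1)) -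
      (\<Sum>i<N. \<Sum>j<2 * N. fps_const (g j) * (fps_const (pair_action a b m j v i) * newton_basis T a m i))"
    unfolding newton_series_def oper_action_def N_def[symmetric] sum_subtractf[symmetric]
    by (intro sum.cong refl)
      (simp add: left_diff_distrib sum_distrib_right is_ring_homD(8)[OF is_ring_hom_fps_const] mult.assoc
        flip: fps_const_sub fps_const_mult)
  also have "(\<Sum>i<N. \<Sum>j<2 * N. fps_const (g j) * (fps_const (pair_action a b m j v i) * newton_basis T a m i)) =
      (\<Sum>j<2 * N. fps_const (g j) * ?s (pair_action a b m j v))"
    unfolding newton_series_def sum_distrib_left by (rule sum.swap)
  finally have "oper_deriv l m T S (?s v) - pair_polynomial (T * S) (S + fps_const b) N g * ?s v -
      ?s (oper_action a b l m g v) =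
      - (\<Sum>j<2 * N. fps_const (g j) * (?B j * ?s v - ?s (pair_action a b m j v)))"
    unfolding oper_deriv_newton_series[OF S T, of l m v, folded N_def]
    by (simp add: pair_polynomial_def sum_distrib_right right_diff_distrib sum_subtractf mult.assoc)
  also have "newton_basis T a m N dvd \<dots>"
    unfolding dvd_minus_iff
    by (intro dvd_sum dvd_mult newton_series_pair_action_dvd[OF _ T]) (simp add: N_def)
  finally show ?thesis .
qed

text \<open>Compatibility of the global operator with a local solution \<open>y\<close>: if a vector represents a multiple
of \<open>y\<close> to the required order, its image vanishes to that order.\<close>

lemma newton_series_kernel_order:
  fixes S :: "'k::field_char_0 fps" and l m :: nat
  assumes S: "fps_deriv S = 1" and T: "T = S + fps_const a"
  defines "N \<equiv> l + m + 2"
  assumes Z: "(T * S) $ 0 = 0" "n \<le> N" and basis: "fps_X ^ n dvd newton_basis T a m N"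
    and preserve: "\<And>f. fps_X ^ n dvd f \<Longrightarrow> fps_X ^ n dvd oper_deriv l m T S f"
    and y: "oper_deriv l m T S y =
      pair_series (T * S) (S + fps_const b) (\<lambda>k. g (2 * k)) (\<lambda>k. g (2 * k + 1)) * y"
    and v: "fps_X ^ n dvd newton_series T a m N v - fps_const c * y"
  shows "fps_X ^ n dvd newton_series T a m N (oper_action a b l m g v)"
proof -
  let ?s = "newton_series T a m N" and ?D = "oper_deriv l m T S"
  let ?G = "pair_series (T * S) (S + fps_const b) (\<lambda>k. g (2 * k)) (\<lambda>k. g (2 * k + 1))"
  let ?P = "pair_polynomial (T * S) (S + fps_const b) N g"
  let ?R = "?D (?s v) - ?P * ?s v - ?s (oper_action a b l m g v)"
  have D: "?D (p - fps_const c * q) = ?D p - fps_const c * ?D q" for p q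
    by (simp add: oper_deriv_def algebra_simps)
  have "?s (oper_action a b l m g v) = ?D (?s v - fps_const c * y) - ?P * (?s v - fps_const c * y)
      + fps_const c * y * (?G - ?P) - ?R"
    unfolding D y by (simp add: algebra_simps)
  moreover have "fps_X ^ n dvd ?R"
    unfolding N_def by (rule dvd_trans[OF basis[unfolded N_def] newton_series_oper_action_dvd[OF S T]])
  moreover have "fps_X ^ n dvd ?D (?s v - fps_const c * y)" by (rule preserve[OF v])
  moreover have "fps_X ^ n dvd ?P * (?s v - fps_const c * y)" by (rule dvd_mult[OF v])
  moreover have "fps_X ^ n dvd fps_const c * y * (?G - ?P)"
    by (rule dvd_mult[OF pair_series_minus_polynomial_dvd[OF Z]])
  ultimately show ?thesis by (metis dvd_add dvd_diff)
qed

lemma newton_series_first_point_nth: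
  assumes "i \<le> m"
  shows "newton_series (fps_X + fps_const a) a m (l + m + 2) v $ i = v i"
proof -
  have "(\<Sum>j\<le>m. fps_const (v j) * fps_X ^ j) $ i = (\<Sum>j\<le>m. if j = i then v j else 0)"
    unfolding fps_sum_nth by (intro sum.cong refl) (simp add: fps_X_power_nth)
  also have "\<dots> = v i" using assms by simp
  finally show ?thesis using assms unfolding newton_series_split
    by (simp add: fps_X_power_mult_nth del: power_Suc)
qed

text \<open>By the Chinese remainder theorem a vector is determined by its expansions modulo \<open>s\<^bsup>m+1\<^esup>\<close> at the first
point and modulo \<open>t\<^bsup>l+1\<^esup>\<close> at the second. The vector \<open>A\<close> is zero at the first point and the local solution
\<open>w\<close> at the second; \<open>B\<close> is the local solution \<open>y\<close> at the first point and zero at the second.\<close>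

lemma oper_kernel_vectors:
  fixes a b :: "'k::field_char_0" and l m :: nat
  assumes a: "a \<noteq> 0"
    and y: "y $ 0 = 1" "oper_deriv l m (fps_X + fps_const a) fps_X y =
      pair_series ((fps_X + fps_const a) * fps_X) (fps_X + fps_const b) (\<lambda>k. g (2 * k)) (\<lambda>k. g (2 * k + 1)) * y"
    and w: "w $ 0 = 1" "oper_deriv l m fps_X (fps_X - fps_const a) w =
      pair_series (fps_X * (fps_X - fps_const a)) (fps_X - fps_const a + fps_const b)
        (\<lambda>k. g (2 * k)) (\<lambda>k. g (2 * k + 1)) * w"
  defines "N \<equiv> l + m + 2"
  shows "\<exists>A B. (\<forall>i<N. oper_action a b l m g A i = 0) \<and> (\<forall>i<N. oper_action a b l m g B i = 0) \<and>
    (\<forall>j\<ge>N. A j = 0) \<and> (\<forall>j\<ge>N. B j = 0) \<and> A 0 = 0 \<and> A (m + 1) \<noteq> 0 \<and> B 0 \<noteq> 0"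
proof -
  let ?S = "fps_X - fps_const a"
  define U where "U = ?S ^ (m + 1)"
  have U0: "U $ 0 \<noteq> 0" using a by (simp add: U_def fps_nth_power_0 del: power_Suc)
  have U: "U * inverse U = 1" using inverse_mult_eq_1[OF U0] by (simp add: mult.commute)
  let ?s1 = "newton_series (fps_X + fps_const a) a m N" and ?s2 = "newton_series fps_X a m N"
  have T2: "fps_X = ?S + fps_const a" by simp
  have s2: "?s2 v = (\<Sum>j\<le>m. fps_const (v j) * ?S ^ j) + U * (\<Sum>i\<le>l. fps_const (v (m + 1 + i)) * fps_X ^ i)" for v
    using newton_series_split[of ?S a m l v] by (simp add: N_def U_def)
  have poly_nth: "(\<Sum>i\<le>l. fps_const (c i) * fps_X ^ i) $ k = (if k \<le> l then c k else 0)" for c :: "nat \<Rightarrow> 'k" and k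
  proof -
    have "(\<Sum>i\<le>l. fps_const (c i) * fps_X ^ i) $ k = (\<Sum>i\<le>l. if i = k then c i else 0)"
      unfolding fps_sum_nth by (intro sum.cong refl) (simp add: fps_X_power_nth)
    then show ?thesis by simp
  qed
  have kernel: "oper_action a b l m g v i = 0"
    if v1: "fps_X ^ (m + 1) dvd ?s1 v - fps_const c1 * y"
      and v2: "fps_X ^ (l + 1) dvd ?s2 v - fps_const c2 * w" and i: "i < N" for v c1 c2 i
  proof -
    let ?u = "oper_action a b l m g v"
    have N1: "N = m + 1 + (l + 1)" by (simp add: N_def)
    have 1: "fps_X ^ (m + 1) dvd ?s1 ?u"
      unfolding N_def
    proof (rule newton_series_kernel_order[OF _ refl _ _ _ _ y(2)])
      show "fps_X ^ (m + 1) dvd newton_basis (fps_X + fps_const a) a m (l + m + 2)"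
        using newton_basis_high[of fps_X a m "l + 1"] by (simp add: add_ac)
    qed (use v1 oper_deriv_preserves_order in \<open>simp_all add: N_def del: power_Suc\<close>)
    have 2: "fps_X ^ (l + 1) dvd ?s2 ?u"
      unfolding N_def
    proof (rule newton_series_kernel_order[OF _ T2 _ _ _ _ w(2)])
      show "fps_X ^ (l + 1) dvd newton_basis fps_X a m (l + m + 2)"
        using newton_basis_high[of ?S a m "l + 1"] by (simp add: add_ac del: power_Suc)
      show "fps_X ^ (l + 1) dvd oper_deriv l m fps_X ?S f" if "fps_X ^ (l + 1) dvd f" for f
        unfolding oper_deriv_swap[of l] by (rule oper_deriv_preserves_order[OF that])
    qed (use v2 in \<open>simp_all add: N_def del: power_Suc\<close>)
    have low: "?u i = 0" if "i \<le> m" for i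
      using 1 newton_series_first_point_nth[OF that, of a l ?u] that
      unfolding fps_X_power_dvd_iff N_def by auto
    have "?s2 ?u = U * (\<Sum>i\<le>l. fps_const (?u (m + 1 + i)) * fps_X ^ i)"
      unfolding s2 by (simp add: low)
    then have "(\<Sum>i\<le>l. fps_const (?u (m + 1 + i)) * fps_X ^ i) = inverse U * ?s2 ?u"
      using U by (simp add: mult.assoc[symmetric] mult.commute[of _ U])
    then have "fps_X ^ (l + 1) dvd (\<Sum>i\<le>l. fps_const (?u (m + 1 + i)) * fps_X ^ i)"
      using dvd_mult[OF 2] by simp
    then have high: "?u (m + 1 + k) = 0" if "k \<le> l" for k
      using that unfolding fps_X_power_dvd_iff poly_nth by fastforce
    show ?thesis
    proof (cases "i \<le> m")
      case False
      then have "i = m + 1 + (i - (m + 1))" "i - (m + 1) \<le> l" using i by (simp_all add: N_def)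
      then show ?thesis using high by metis
    qed (use low in simp)
  qed
  (* coefficients p modulo s^(m+1) at the first point, and the series
     sum p_j s^j + s^(m+1) h modulo t^(l+1) at the second *)
  define glue where "glue p h j = (if j \<le> m then p j else if j < N then fps_nth h (j - (m + 1)) else 0)"
    for p :: "nat \<Rightarrow> 'k" and h j
  have glue1: "fps_X ^ (m + 1) dvd ?s1 (glue p h) - f" if "\<And>i. i \<le> m \<Longrightarrow> p i = f $ i" for p h f
    unfolding fps_X_power_dvd_iff N_def
  proof (intro allI impI)
    fix i assume "i < m + 1"
    then have "i \<le> m" by simp
    then show "(newton_series (fps_X + fps_const a) a m (l + m + 2) (glue p h) - f) $ i = 0"
      using that[of i] newton_series_first_point_nth[of i m a l "glue p h"] by (simp add: glue_def)
  qed
  have glue2: "fps_X ^ (l + 1) dvd ?s2 (glue p h) - ((\<Sum>j\<le>m. fps_const (p j) * ?S ^ j) + U * h)" for p h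
  proof -
    have "fps_X ^ (l + 1) dvd (\<Sum>i\<le>l. fps_const (glue p h (m + 1 + i)) * fps_X ^ i) - h"
      unfolding fps_X_power_dvd_iff by (auto simp: poly_nth glue_def N_def)
    then have "fps_X ^ (l + 1) dvd U * ((\<Sum>i\<le>l. fps_const (glue p h (m + 1 + i)) * fps_X ^ i) - h)"
      by (rule dvd_mult)
    also have "U * ((\<Sum>i\<le>l. fps_const (glue p h (m + 1 + i)) * fps_X ^ i) - h) =
        ?s2 (glue p h) - ((\<Sum>j\<le>m. fps_const (p j) * ?S ^ j) + U * h)"
      unfolding s2 by (simp add: glue_def right_diff_distrib)
    finally show ?thesis .
  qed
  define A where "A = glue (\<lambda>_. 0) (inverse U * w)"
  define Q where "Q = (\<Sum>j\<le>m. fps_const (y $ j) * ?S ^ j)"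
  define B where "B = glue (fps_nth y) (inverse U * - Q)"
  have A: "oper_action a b l m g A i = 0" if "i < N" for i
  proof (rule kernel[OF _ _ that])
    show "fps_X ^ (m + 1) dvd ?s1 A - fps_const 0 * y" unfolding A_def by (rule glue1) simp
    show "fps_X ^ (l + 1) dvd ?s2 A - fps_const 1 * w"
      using glue2[of "\<lambda>_. 0" "inverse U * w"] U by (simp add: A_def mult.assoc[symmetric] del: power_Suc)
  qed
  have B: "oper_action a b l m g B i = 0" if "i < N" for i
  proof (rule kernel[OF _ _ that])
    show "fps_X ^ (m + 1) dvd ?s1 B - fps_const 1 * y" unfolding B_def by (rule glue1) simp
    have Z: "Q + U * (inverse U * - Q) = 0" unfolding mult.assoc[symmetric] U by simp
    show "fps_X ^ (l + 1) dvd ?s2 B - fps_const 0 * w"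
      using glue2[of "fps_nth y" "inverse U * - Q", folded Q_def, unfolded Z] unfolding B_def by simp
  qed
  have "A (m + 1) = inverse (U $ 0)" using U0 by (simp add: A_def glue_def N_def w(1))
  moreover have "A j = 0 \<and> B j = 0" if "j \<ge> N" for j using that by (simp add: A_def B_def glue_def N_def)
  moreover have "A 0 = 0" "B 0 = 1" by (simp_all add: A_def B_def glue_def y(1))
  ultimately show ?thesis using A B U0 by (intro exI[of _ A] exI[of _ B]) auto
qed

section \<open>Two families of determinants\<close>

lemma det_eq_0_if_kernel:
  fixes M :: "nat \<Rightarrow> nat \<Rightarrow> 'k::field"
  assumes "\<And>i. i < n \<Longrightarrow> (\<Sum>j<n. M i j * v j) = 0" "k < n" "v k \<noteq> 0"
  shows "det (mat n n (\<lambda>(i, j). M i j)) = 0"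
proof -
  let ?A = "mat n n (\<lambda>(i, j). M i j)"
  have "?A *\<^sub>v vec n v = 0\<^sub>v n"
    by (rule eq_vecI) (simp_all add: scalar_prod_def assms(1) atLeast0LessThan)
  moreover have "vec n v \<noteq> 0\<^sub>v n" using assms(2,3) by (metis index_vec index_zero_vec(1))
  ultimately show ?thesis
    by (subst det_0_iff_vec_prod_zero_field[of _ n]) (auto intro!: exI[of _ "vec n v"])
qed

text \<open>The first block is the action on the quotient by \<open>s\<^bsup>m+1\<^esup>\<close>, where \<open>B\<close> survives. For the corner
determinant, the span of \<open>A\<close> and \<open>B\<close> contains a nonzero vector whose coordinate \<open>n'\<close> is zero; the extra entry
does not see it.\<close>

lemma oper_determinants_vanish:
  fixes a b :: "'k::field_char_0"
  assumes A: "\<And>i. i < N \<Longrightarrow> oper_action a b l m g A i = 0" "\<And>j. j \<ge> N \<Longrightarrow> A j = 0"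
    and B: "\<And>i. i < N \<Longrightarrow> oper_action a b l m g B i = 0" "\<And>j. j \<ge> N \<Longrightarrow> B j = 0"
    and indep: "A 0 = 0" "A (m + 1) \<noteq> 0" "B 0 \<noteq> 0" and N: "N = l + m + 2"
  shows "det (mat (m + 1) (m + 1) (\<lambda>(i, j). oper_entry a b l m g i j)) = 0"
    and "n' < N \<Longrightarrow> det (mat N N (\<lambda>(i, j). oper_entry a b l m g i j + (if i = n \<and> j = n' then 1 else 0))) = 0"
proof -
  let ?e = "oper_entry a b l m g"
  have A': "(\<Sum>j<N. ?e i j * A j) = 0" and B': "(\<Sum>j<N. ?e i j * B j) = 0" if "i < N" for i
    using A B that by (simp_all flip: oper_action_eq_entries)
  show "det (mat (m + 1) (m + 1) (\<lambda>(i, j). ?e i j)) = 0"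
  proof (rule det_eq_0_if_kernel[where v = B and k = 0])
    fix i assume i: "i < m + 1"
    have "(\<Sum>j<m + 1. ?e i j * B j) = (\<Sum>j<N. ?e i j * B j)"
      using i N by (intro sum.mono_neutral_left) (auto simp: oper_entry_block)
    then show "(\<Sum>j<m + 1. ?e i j * B j) = 0" using B'[of i] i N by simp
  qed (use indep in auto)
  assume n': "n' < N"
  have corner: "det (mat N N (\<lambda>(i, j). ?e i j + (if i = n \<and> j = n' then 1 else 0))) = 0"
    if v: "\<And>i. i < N \<Longrightarrow> (\<Sum>j<N. ?e i j * v j) = 0" and "v n' = 0" "k < N" "v k \<noteq> 0" for v k
  proof (rule det_eq_0_if_kernel[where v = v and k = k])
    fix i assume i: "i < N"
    have "(\<Sum>j<N. (?e i j + (if i = n \<and> j = n' then 1 else 0)) * v j) = (\<Sum>j<N. ?e i j * v j)"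
      using that(2) by (intro sum.cong) auto
    then show "(\<Sum>j<N. (?e i j + (if i = n \<and> j = n' then 1 else 0)) * v j) = 0" using v[OF i] by simp
  qed (use that in auto)
  show "det (mat N N (\<lambda>(i, j). ?e i j + (if i = n \<and> j = n' then 1 else 0))) = 0"
  proof (cases "A n' = 0")
    case True
    show ?thesis by (rule corner[OF A' True, of "m + 1"]) (use indep N in auto)
  next
    case False
    let ?v = "\<lambda>j. B n' * A j - A n' * B j"
    have "(\<Sum>j<N. ?e i j * ?v j) = B n' * (\<Sum>j<N. ?e i j * A j) - A n' * (\<Sum>j<N. ?e i j * B j)" for i
      by (simp add: sum_distrib_left right_diff_distrib sum_subtractf mult_ac)
    then show ?thesis
      by (intro corner[where v = ?v and k = 0]) (use indep False A' B' N in auto)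
  qed
qed

definition block_det :: "'r::comm_ring_1 \<Rightarrow> 'r \<Rightarrow> nat \<Rightarrow> nat \<Rightarrow> (nat \<Rightarrow> 'r) \<Rightarrow> 'r" where
  "block_det a b l m g = det (mat (m + 1) (m + 1) (\<lambda>(i, j). oper_entry a b l m g i j))"

definition corner_det :: "'r::comm_ring_1 \<Rightarrow> 'r \<Rightarrow> nat \<Rightarrow> nat \<Rightarrow> (nat \<Rightarrow> 'r) \<Rightarrow> nat \<Rightarrow> nat \<Rightarrow> 'r" where
  "corner_det a b l m g n n' = det (mat (l + m + 2) (l + m + 2)
     (\<lambda>(i, j). oper_entry a b l m g i j + (if i = n \<and> j = n' then 1 else 0)))"

lemma ring_hom_det_mat:
  assumes "is_ring_hom h"
  shows "h (det (mat n n (\<lambda>(i, j). M i j))) = det (mat n n (\<lambda>(i, j). h (M i j)))"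
proof -
  interpret comm_ring_hom h by unfold_locales (simp_all add: is_ring_homD[OF assms])
  have "map_mat h (mat n n (\<lambda>(i, j). M i j)) = mat n n (\<lambda>(i, j). h (M i j))" by (rule eq_matI) auto
  then show ?thesis using hom_det[of "mat n n (\<lambda>(i, j). M i j)"] by simp
qed

lemma ring_hom_block_det:
  assumes "is_ring_hom h"
  shows "h (block_det a b l m g) = block_det (h a) (h b) l m (\<lambda>j. h (g j))"
  unfolding block_det_def ring_hom_det_mat[OF assms] ring_hom_oper_entry[OF assms] ..

lemma ring_hom_corner_det:
  assumes "is_ring_hom h"
  shows "h (corner_det a b l m g n n') = corner_det (h a) (h b) l m (\<lambda>j. h (g j)) n n'"
proof -
  have "h (x + (if c then 1 else 0)) = h x + (if c then 1 else 0)" for x c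
    by (simp add: is_ring_homD[OF assms])
  then show ?thesis
    unfolding corner_det_def ring_hom_det_mat[OF assms] ring_hom_oper_entry[OF assms, symmetric] by simp
qed

text \<open>The coefficients \<open>g\<^sub>j\<close> of \<open>G\<close> in the basis \<open>1, s, ts, ts\<^sup>2, \<dots>\<close>; the constant \<open>c\<close> subtracted from
\<open>a\<^bsub>-1\<^esub>\<close> will be \<open>A\<^bsub>\<lambda>+\<mu>\<^esub>\<close>.\<close>

definition oper_coeffs :: "'r::comm_ring_1 \<Rightarrow> (op2_var \<Rightarrow> 'r) \<Rightarrow> nat \<Rightarrow> 'r" where
  "oper_coeffs c x j = (if even j then x (Avar (Suc (j div 2))) else x (Bvar (Suc (j div 2))))
     - (if j = 0 then c else 0)"

lemma Op2_tail_eq: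
  assumes "(T * S) $ 0 = 0"
  shows "Op2_tail l m x T S = pair_series (T * S) S
    (\<lambda>k. oper_coeffs (oper_exponent (l + m)) x (2 * k)) (\<lambda>k. oper_coeffs (oper_exponent (l + m)) x (2 * k + 1))"
proof -
  have "(\<lambda>k. oper_coeffs (oper_exponent (l + m)) x (2 * k)) =
      (\<lambda>k. x (Avar (Suc k)) + (if k = 0 then - oper_exponent (l + m) else 0))"
    "(\<lambda>k. oper_coeffs (oper_exponent (l + m)) x (2 * k + 1)) = (\<lambda>k. x (Bvar (Suc k)))"
    by (auto simp: oper_coeffs_def)
  then show ?thesis by (simp only: pair_series_add_const[OF assms] Op2_tail_def) simp
qed

lemma riccati_solution:
  assumes "riccati l m T S \<eta> = G"
  shows "\<exists>y. y $ 0 = 1 \<and> oper_deriv l m T S y = G * y"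
proof -
  define y where "y = fps_exp 1 oo fps_integral0 \<eta>"
  have y': "fps_deriv y = y * \<eta>" by (simp add: y_def fps_compose_deriv fps_deriv_fps_integral)
  have "oper_deriv l m T S y = riccati l m T S \<eta> * y"
    by (simp add: oper_deriv_def riccati_def y' power2_eq_square algebra_simps)
  moreover have "y $ 0 = 1" by (simp add: y_def)
  ultimately show ?thesis using assms by blast
qed

text \<open>The first and third determinants start the Newton basis at \<open>s = 0\<close>, the others start it at \<open>t = 0\<close>.\<close>

lemma Op2_point_determinants:
  assumes x: "E_t id x \<in> Op1_points fls_const l \<and> E_s id x \<in> Op1_points fls_const m"
  defines "g \<equiv> oper_coeffs (oper_exponent (l + m)) x"
  shows "block_det fls_X 0 l m g = 0" "block_det (- fls_X) (- fls_X) m l g = 0"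
    "n' < l + m + 2 \<Longrightarrow> corner_det fls_X 0 l m g n n' = 0"
    "n' < l + m + 2 \<Longrightarrow> corner_det (- fls_X) (- fls_X) m l g n n' = 0"
proof -
  let ?a = "fls_X :: complex fls"
  obtain \<eta>1 \<eta>2 where \<eta>: "riccati l m fps_X (fps_X - fps_const ?a) \<eta>1 = Op2_tail l m x fps_X (fps_X - fps_const ?a)"
    "riccati l m (fps_X + fps_const ?a) fps_X \<eta>2 = Op2_tail l m x (fps_X + fps_const ?a) fps_X"
    using x unfolding Op2_points_iff_riccati by blast
  obtain w where w: "w $ 0 = 1" "oper_deriv l m fps_X (fps_X - fps_const ?a) w =
      pair_series (fps_X * (fps_X - fps_const ?a)) (fps_X - fps_const ?a) (\<lambda>k. g (2 * k)) (\<lambda>k. g (2 * k + 1)) * w"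
    using riccati_solution[OF \<eta>(1)] by (subst (asm) Op2_tail_eq) (auto simp: g_def)
  obtain y where y: "y $ 0 = 1" "oper_deriv l m (fps_X + fps_const ?a) fps_X y =
      pair_series ((fps_X + fps_const ?a) * fps_X) fps_X (\<lambda>k. g (2 * k)) (\<lambda>k. g (2 * k + 1)) * y"
    using riccati_solution[OF \<eta>(2)] by (subst (asm) Op2_tail_eq) (auto simp: g_def)
  have 1: "\<exists>A B. (\<forall>i<l + m + 2. oper_action ?a 0 l m g A i = 0) \<and> (\<forall>i<l + m + 2. oper_action ?a 0 l m g B i = 0) \<and>
    (\<forall>j\<ge>l + m + 2. A j = 0) \<and> (\<forall>j\<ge>l + m + 2. B j = 0) \<and> A 0 = 0 \<and> A (m + 1) \<noteq> 0 \<and> B 0 \<noteq> 0"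
    by (rule oper_kernel_vectors[where y = y and w = w]) (simp_all add: w y)
  have 2: "\<exists>A B. (\<forall>i<m + l + 2. oper_action (- ?a) (- ?a) m l g A i = 0) \<and>
    (\<forall>i<m + l + 2. oper_action (- ?a) (- ?a) m l g B i = 0) \<and>
    (\<forall>j\<ge>m + l + 2. A j = 0) \<and> (\<forall>j\<ge>m + l + 2. B j = 0) \<and> A 0 = 0 \<and> A (l + 1) \<noteq> 0 \<and> B 0 \<noteq> 0"
  proof (rule oper_kernel_vectors[where y = w and w = y])
    have e: "fps_X + fps_const (- ?a) = fps_X - fps_const ?a" "fps_X - fps_const (- ?a) = fps_X + fps_const ?a"
      "fps_X + fps_const ?a + fps_const (- ?a) = fps_X"
      by (simp_all flip: fps_const_neg)
    show "oper_deriv m l (fps_X + fps_const (- ?a)) fps_X w =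
      pair_series ((fps_X + fps_const (- ?a)) * fps_X) (fps_X + fps_const (- ?a)) (\<lambda>k. g (2 * k)) (\<lambda>k. g (2 * k + 1)) * w"
      unfolding e oper_deriv_swap[of m] w(2) by (simp only: mult.commute)
    show "oper_deriv m l fps_X (fps_X - fps_const (- ?a)) y =
      pair_series (fps_X * (fps_X - fps_const (- ?a))) (fps_X - fps_const (- ?a) + fps_const (- ?a))
        (\<lambda>k. g (2 * k)) (\<lambda>k. g (2 * k + 1)) * y"
      unfolding e oper_deriv_swap[of m] y(2) by (simp only: mult.commute)
  qed (simp_all add: w y)
  show "block_det fls_X 0 l m g = 0" "n' < l + m + 2 \<Longrightarrow> corner_det fls_X 0 l m g n n' = 0"
    using 1 oper_determinants_vanish[of "l + m + 2" ?a 0 l m g] unfolding block_det_def corner_det_def by blast+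
  show "block_det (- fls_X) (- fls_X) m l g = 0" "n' < l + m + 2 \<Longrightarrow> corner_det (- fls_X) (- fls_X) m l g n n' = 0"
    using 2 oper_determinants_vanish[of "m + l + 2" "- ?a" "- ?a" m l g]
    unfolding block_det_def corner_det_def add.commute[of l m] by blast+
qed

section \<open>The determinants on the special fibre\<close>

text \<open>The reduction of \<open>oper_coeffs\<close> under \<open>a \<mapsto> 0\<close>: variable number \<open>j + 2\<close> is \<open>c\<^bsub>j-2\<^esub>\<close>.\<close>

definition special_coeffs :: "nat \<Rightarrow> nat \<Rightarrow> nat \<Rightarrow> (nat, complex) mpoly" where
  "special_coeffs l m j = mvar (j + 2) - (if j = 0 then mconst (oper_exponent (l + m)) else 0)"

lemma special_determinants_in_ideal:
  "block_det 0 0 l m (special_coeffs l m) \<in> Op2_special_ideal l m" (is ?A)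
  "block_det 0 0 m l (special_coeffs l m) \<in> Op2_special_ideal l m" (is ?B)
  "n' < l + m + 2 \<Longrightarrow> corner_det 0 0 l m (special_coeffs l m) n n' \<in> Op2_special_ideal l m"
  "n' < l + m + 2 \<Longrightarrow> corner_det 0 0 m l (special_coeffs l m) n n' \<in> Op2_special_ideal l m"
  "mvar 0 \<in> Op2_special_ideal l m" "mvar 1 \<in> Op2_special_ideal l m"
proof -
  define g :: "nat \<Rightarrow> (op2_var, complex fps) mpoly" where
    "g = oper_coeffs (mconst (fps_const (oper_exponent (l + m)))) mvar"
  let ?X = "mconst fps_X :: (op2_var, complex fps) mpoly"
  let ?red = "meval (\<lambda>z. mconst (fps_nth z 0)) Sp_var"
  have z: "is_ring_hom (\<lambda>z :: complex fps. mconst (fps_nth z 0))"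
    by (rule is_ring_hom_comp[OF _ is_ring_hom_mconst]) (simp add: is_ring_hom_def)
  note red = is_ring_hom_meval[OF z, of Sp_var]
  have rc: "?red (mconst c) = mconst (fps_nth c 0)" "?red (mvar v) = Sp_var v" for c v
    by (simp_all add: meval_mconst[OF z] meval_mvar[OF z])
  have m0: "mconst 0 = (0 :: (nat, complex) mpoly)" by (rule is_ring_homD(4)[OF is_ring_hom_mconst])
  have rX: "?red ?X = 0" "?red (- ?X) = 0" "?red 0 = 0"
    by (simp_all add: is_ring_homD[OF red] rc m0)
  have rg: "(\<lambda>j. ?red (g j)) = special_coeffs l m"
  proof
    fix j
    show "?red (g j) = special_coeffs l m j"
    proof (cases "even j")
      case True
      then have "2 * Suc (j div 2) = j + 2" by auto
      then show ?thesis using True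
        by (simp add: g_def oper_coeffs_def special_coeffs_def is_ring_homD[OF red] rc)
    next
      case False
      then have "2 * Suc (j div 2) + 1 = j + 2" by presburger
      then show ?thesis using False
        by (auto simp: g_def oper_coeffs_def special_coeffs_def is_ring_homD[OF red] rc)
    qed
  qed
  have mem: "?red p \<in> Op2_special_ideal l m" if "p \<in> Op2_ideal l m" for p
    using that unfolding Op2_special_ideal_def by (intro ideal_gen_base imageI)
  have oe: "fls_const (oper_exponent n) = (oper_exponent n :: complex fls)" for n
    using fls_const_A_coeff[of n] by (simp add: A_coeff_def oper_exponent_def)
  have ev: "is_ring_hom (meval fps_to_fls x)" "meval fps_to_fls x (mconst c) = fps_to_fls c"
    "meval fps_to_fls x (mvar v) = x v" for x :: "op2_var \<Rightarrow> complex fls" and c v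
    by (rule is_ring_hom_meval[OF is_ring_hom_fps_to_fls])
      (simp_all add: meval_mconst[OF is_ring_hom_fps_to_fls] meval_mvar[OF is_ring_hom_fps_to_fls])
  have evX: "meval fps_to_fls x ?X = fls_X" "meval fps_to_fls x (- ?X) = - fls_X" "meval fps_to_fls x 0 = 0"
    for x :: "op2_var \<Rightarrow> complex fls"
    by (simp_all add: is_ring_homD[OF ev(1)] ev)
  have evg: "(\<lambda>j. meval fps_to_fls x (g j)) = oper_coeffs (oper_exponent (l + m)) x" for x
    by (rule ext) (simp add: g_def oper_coeffs_def is_ring_homD[OF ev(1)] ev oe)
  have "block_det ?X 0 l m g \<in> Op2_ideal l m" "block_det (- ?X) (- ?X) m l g \<in> Op2_ideal l m"
    unfolding Op2_ideal_iff ring_hom_block_det[OF ev(1)] evX evg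
    using Op2_point_determinants(1,2) by blast+
  from this[THEN mem] show ?A ?B unfolding ring_hom_block_det[OF red] rX rg by simp_all
  have "corner_det ?X 0 l m g n n' \<in> Op2_ideal l m" "corner_det (- ?X) (- ?X) m l g n n' \<in> Op2_ideal l m"
    if "n' < l + m + 2"
    unfolding Op2_ideal_iff ring_hom_corner_det[OF ev(1)] evX evg
    using Op2_point_determinants(3,4) that by blast+
  from this[THEN mem]
  show "n' < l + m + 2 \<Longrightarrow> corner_det 0 0 l m (special_coeffs l m) n n' \<in> Op2_special_ideal l m"
    "n' < l + m + 2 \<Longrightarrow> corner_det 0 0 m l (special_coeffs l m) n n' \<in> Op2_special_ideal l m"
    unfolding ring_hom_corner_det[OF red] rX rg by simp_all
  have "mvar (Avar 0) - mconst (fps_X\<^sup>2 * fps_const (oper_exponent m)) \<in> Op2_ideal l m"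
    "mvar (Bvar 0) - mconst (fps_X * fps_const (oper_exponent m - oper_exponent l)) \<in> Op2_ideal l m"
    unfolding Op2_ideal_iff Op2_points_iff_riccati
    by (auto simp: is_ring_homD[OF ev(1)] ev fls_times_fps_to_fls fps_to_fls_power oe simp flip: fls_minus_const)
  from this[THEN mem] show "mvar 0 \<in> Op2_special_ideal l m" "mvar 1 \<in> Op2_special_ideal l m"
    by (simp_all add: is_ring_homD[OF red] rc m0)
qed

lemma block_det_special:
  "block_det 0 0 l m g = (\<Prod>i\<le>m. oper_diag l m i - g 0)"
proof -
  let ?A = "mat (m + 1) (m + 1) (\<lambda>(i, j). oper_entry 0 0 l m g i j)"
  have "det ?A = prod_list (diag_mat ?A)"
    by (rule det_lower_triangular[where n = "m + 1"]) (auto simp: oper_entry_block oper_entry_special)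
  also have "\<dots> = (\<Prod>i=0..<m + 1. ?A $$ (i, i))" by (simp add: prod_list_diag_prod)
  also have "\<dots> = (\<Prod>i\<le>m. oper_diag l m i - g 0)"
    by (intro prod.cong) (auto simp: oper_entry_special)
  finally show ?thesis by (simp add: block_det_def)
qed

text \<open>At \<open>a = 0\<close> the matrix is lower triangular with zeros in the diagonal positions \<open>n\<close> and \<open>n'\<close>, up to the
corner entry in position \<open>(n, n')\<close>. The vector \<open>z\<close>, placed from index \<open>n\<close> on, is mapped to a multiple of the
\<open>n'\<close>th unit vector; after it replaces column \<open>n\<close> and columns \<open>n\<close> and \<open>n'\<close> are exchanged, the matrix is
triangular.\<close>

lemma corner_det_special:
  fixes g :: "nat \<Rightarrow> 'k::field"
  assumes n: "n < n'" "n' < l + m + 2"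
    and diag: "oper_diag l m n = g 0" "oper_diag l m n' = g 0"
    and z: "z 0 = 1" "z (n' - n) = 0"
      "\<And>j. 0 < j \<Longrightarrow> j \<noteq> n' - n \<Longrightarrow> n + j < l + m + 2 \<Longrightarrow>
        (oper_diag l m (n + j) - g 0) * z j = (\<Sum>i<j. g (j - i) * z i)"
  shows "corner_det 0 0 l m g n n' =
    (\<Sum>i<n' - n. g (n' - n - i) * z i) * (\<Prod>j\<in>{..<l + m + 2} - {n, n'}. oper_diag l m j - g 0)"
proof -
  define N where "N = l + m + 2"
  define \<omega> where "\<omega> = (\<Sum>i<n' - n. g (n' - n - i) * z i)"
  let ?d = "oper_diag l m :: nat \<Rightarrow> 'k"
  define M where "M i j = (if i = j then ?d i else 0) - (if j \<le> i then g (i - j) else 0)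
      + (if i = n \<and> j = n' then 1 else 0)" for i j
  define v where "v j = (if j < n then 0 else z (j - n))" for j
  (* The column exchange below moves v to column n', where its image meets only the diagonal. *)
  define U where "U = mat N N (\<lambda>(i, j). if j = n then v i else if i = j then 1 else (0 :: 'k))"
  have cdet: "corner_det 0 0 l m g n n' = det (mat N N (\<lambda>(i, j). M i j))"
    unfolding corner_det_def N_def[symmetric]
    by (intro arg_cong[where f = det] eq_matI) (auto simp: M_def N_def oper_entry_special)
  have nN: "n < N" "n' < N" using n by (simp_all add: N_def)
  have Uc: "U \<in> carrier_mat N N" by (simp add: U_def)
  have vn: "v n = 1" "v n' = 0" using n by (simp_all add: v_def z)
  have "det U = prod_list (diag_mat U)"
    by (rule det_lower_triangular[OF _ Uc]) (auto simp: U_def v_def)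
  also have "\<dots> = (\<Prod>i=0..<N. U $$ (i, i))" by (simp add: prod_list_diag_prod U_def)
  also have "\<dots> = 1" by (intro prod.neutral) (auto simp: U_def vn)
  finally have detU: "det (swapcols n n' U) = -1" using det_swapcols[OF nN _ Uc] n by simp
  have U2: "swapcols n n' U $$ (k, j) = (if j = n then (if k = n' then 1 else 0) else
      if j = n' then v k else if k = j then 1 else 0)" if "k < N" "j < N" for k j
    using that n nN by (auto simp: U_def mat_swapcols_def)
  have Mv: "(\<Sum>k<N. M i k * v k) = (if i = n' then - \<omega> else 0)" if i: "i < N" for i
  proof -
    have "(\<Sum>k<N. M i k * v k) = (\<Sum>k<N. (if k = i then ?d i * v i else 0) - (if k \<in> {..i} then g (i - k) * v k else 0))"
      using n by (intro sum.cong refl) (auto simp: M_def vn algebra_simps)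
    also have "\<dots> = ?d i * v i - (\<Sum>k\<in>{..<N} \<inter> {..i}. g (i - k) * v k)"
      using i by (subst sum.inter_restrict) (simp_all add: sum_subtractf)
    also have "{..<N} \<inter> {..i} = {..i}" using i by auto
    finally have eq: "(\<Sum>k<N. M i k * v k) = ?d i * v i - (\<Sum>k\<le>i. g (i - k) * v k)" .
    show ?thesis
    proof (cases "i < n")
      case True
      then show ?thesis using n unfolding eq by (simp add: v_def)
    next
      case False
      define r where "r = i - n"
      have ir: "i = n + r" using False by (simp add: r_def)
      have "(\<Sum>k\<le>i. g (i - k) * v k) = (\<Sum>k\<in>(\<lambda>q. n + q) ` {..r}. g (i - k) * v k)"
      proof (rule sum.mono_neutral_right)
        show "\<forall>k\<in>{..i} - (\<lambda>q. n + q) ` {..r}. g (i - k) * v k = 0"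
        proof
          fix k assume k: "k \<in> {..i} - (\<lambda>q. n + q) ` {..r}"
          have "k < n"
          proof (rule ccontr)
            assume "\<not> k < n"
            then have "k = n + (k - n)" "k - n \<le> r" using k ir by auto
            then show False using k by blast
          qed
          then show "g (i - k) * v k = 0" by (simp add: v_def)
        qed
      qed (auto simp: ir)
      also have "\<dots> = (\<Sum>q\<le>r. g (r - q) * z q)"
        by (subst sum.reindex) (auto simp: inj_on_def ir v_def)
      also have "\<dots> = (\<Sum>q<r. g (r - q) * z q) + g 0 * z r"
        by (simp add: lessThan_Suc_atMost[symmetric])
      finally have eq2: "(\<Sum>k<N. M i k * v k) = (?d i - g 0) * z r - (\<Sum>q<r. g (r - q) * z q)"
        unfolding eq by (simp add: ir v_def algebra_simps)
      consider "r = 0" | "r = n' - n" "r > 0" | "0 < r" "r \<noteq> n' - n" by blast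
      then show ?thesis
      proof cases
        case 1
        then show ?thesis using n unfolding eq2 by (simp add: ir diag)
      next
        case 2
        then show ?thesis using n unfolding eq2 by (simp add: ir z \<omega>_def)
      next
        case 3
        then show ?thesis using n z(3)[of r] i unfolding eq2 by (auto simp: ir N_def)
      qed
    qed
  qed
  define Tr where "Tr = mat N N (\<lambda>(i, j). M i j) * swapcols n n' U"
  have U2c: "swapcols n n' U \<in> carrier_mat N N" using Uc by (simp only: swapcols_carrier)
  have Trc: "Tr \<in> carrier_mat N N" unfolding Tr_def by (rule mult_carrier_mat[OF _ U2c]) simp
  have Tr: "Tr $$ (i, j) = (if j = n then M i n' else if j = n' then (if i = n' then - \<omega> else 0) else M i j)"
    if "i < N" "j < N" for i j
  proof -
    have "Tr $$ (i, j) = (\<Sum>k<N. M i k * swapcols n n' U $$ (k, j))"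
      using that Uc by (simp add: Tr_def scalar_prod_def atLeast0LessThan)
    also have "\<dots> = (\<Sum>k<N. if j = n then (if k = n' then M i n' else 0) else
        if j = n' then M i k * v k else if k = j then M i j else 0)"
      using that by (intro sum.cong) (auto simp: U2)
    finally show ?thesis using that nN Mv[OF that(1)] by (simp cong: if_cong)
  qed
  have "det Tr = prod_list (diag_mat Tr)"
    by (rule det_lower_triangular[OF _ Trc]) (use n in \<open>auto simp: Tr M_def\<close>)
  also have "\<dots> = (\<Prod>i=0..<N. Tr $$ (i, i))" using Trc by (simp add: prod_list_diag_prod)
  also have "\<dots> = (\<Prod>i\<in>{..<N}. Tr $$ (i, i))" by (simp add: atLeast0LessThan)
  also have "\<dots> = Tr $$ (n, n) * (Tr $$ (n', n') * (\<Prod>i\<in>{..<N} - {n} - {n'}. Tr $$ (i, i)))"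
    using n nN by (subst prod.remove[of _ n], simp, simp, subst prod.remove[of _ n'], simp_all)
  also have "(\<Prod>i\<in>{..<N} - {n} - {n'}. Tr $$ (i, i)) = (\<Prod>j\<in>{..<N} - {n, n'}. ?d j - g 0)"
    by (intro prod.cong) (auto simp: Tr M_def)
  also have "Tr $$ (n, n) = 1" using n nN by (simp add: Tr M_def)
  also have "Tr $$ (n', n') = - \<omega>" using n nN by (simp add: Tr)
  finally have "det Tr = - \<omega> * (\<Prod>j\<in>{..<N} - {n, n'}. ?d j - g 0)" by simp
  moreover have "det Tr = det (mat N N (\<lambda>(i, j). M i j)) * det (swapcols n n' U)"
    unfolding Tr_def by (rule det_mult[OF _ U2c]) simp
  ultimately show ?thesis unfolding cdet \<omega>_def[symmetric] N_def[symmetric] by (simp add: detU)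
qed

section \<open>The Frobenius recursion\<close>

text \<open>The coefficients of the solution \<open>t\<^bsup>-\<nu>/2\<^esup>(1 + \<dots>)\<close> of \<open>y'' = fy\<close>, with \<open>g\<^sub>j = c\<^bsub>j-2\<^esub>\<close>. At the resonance \<open>j = \<nu> + 1\<close>
the denominator is zero, and the value of the quotient is zero by convention.\<close>

function frobenius :: "nat \<Rightarrow> (nat \<Rightarrow> complex) \<Rightarrow> nat \<Rightarrow> complex" where
  "frobenius \<nu> g j = (if j = 0 then 1 else
     (\<Sum>i\<in>{..<j}. g (j - i) * frobenius \<nu> g i) / (of_nat j * (of_nat j - 1 - of_nat \<nu>)))"
  by pat_completeness auto
termination by (relation "measure (\<lambda>(\<nu>, g, j). j)") auto

declare frobenius.simps [simp del]

lemma frobenius_0: "frobenius \<nu> g 0 = 1"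
  by (subst frobenius.simps) simp

lemma frobenius_resonance: "frobenius \<nu> g (\<nu> + 1) = 0"
  by (subst frobenius.simps) simp

lemma resonance_factor:
  assumes "0 < j" "j \<noteq> \<nu> + 1"
  shows "of_nat j * (of_nat j - 1 - of_nat \<nu>) \<noteq> (0 :: complex)"
proof -
  have "of_nat j - 1 - of_nat \<nu> = (of_nat j - of_nat (\<nu> + 1) :: complex)" by simp
  then show ?thesis using assms by (simp only: mult_eq_0_iff right_minus_eq of_nat_eq_iff) simp
qed

lemma frobenius_rec:
  assumes "0 < j" "j \<noteq> \<nu> + 1"
  shows "of_nat j * (of_nat j - 1 - of_nat \<nu>) * frobenius \<nu> g j = (\<Sum>i<j. g (j - i) * frobenius \<nu> g i)"
proof -
  have "of_nat j * (of_nat j - 1 - of_nat \<nu>) \<noteq> (0 :: complex)" using assms by (rule resonance_factor)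
  then show ?thesis using assms(1) by (subst frobenius.simps) simp
qed

lemma frobenius_cong:
  assumes "\<And>i. 0 < i \<Longrightarrow> i \<le> j \<Longrightarrow> g i = h i"
  shows "frobenius \<nu> g j = frobenius \<nu> h j"
  using assms
proof (induction j rule: less_induct)
  case (less j)
  have "(\<Sum>i<j. g (j - i) * frobenius \<nu> g i) = (\<Sum>i<j. h (j - i) * frobenius \<nu> h i)"
    by (intro sum.cong refl arg_cong2[where f = "(*)"] less.IH less.prems) auto
  then show ?case by (subst (1 2) frobenius.simps) simp
qed

text \<open>For a point of \<open>Op\<^sub>1\<^sup>\<nu>\<close> the recursion is solved by \<open>exp(\<integral>\<psi>)\<close>, so there is no obstruction at the
resonance.\<close>

lemma frobenius_obstruction_vanishes:
  assumes g: "\<And>j. 0 < j \<Longrightarrow> g j = fls_nth (Op1_elem id \<nu> \<psi>) (int j - 2)"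
  shows "(\<Sum>i<\<nu> + 1. g (\<nu> + 1 - i) * frobenius \<nu> g i) = 0"
proof -
  define y where "y = fps_exp 1 oo fps_integral0 \<psi>"
  have y': "fps_deriv y = y * \<psi>" by (simp add: y_def fps_compose_deriv fps_deriv_fps_integral)
  define F where "F = fps_X * (fps_deriv \<psi> + \<psi>\<^sup>2) - of_nat \<nu> * \<psi>"
  have F: "F $ k = g (k + 1)" for k
  proof -
    have nu: "(of_nat \<nu> * \<psi>) $ k = of_nat \<nu> * \<psi> $ k" by (simp flip: fps_of_nat)
    have "F $ k = (of_nat k - of_nat \<nu>) * \<psi> $ k + (\<Sum>i<k. \<psi> $ i * \<psi> $ (k - 1 - i))"
    proof (cases k)
      case 0
      then show ?thesis using nu by (simp add: F_def)
    next
      case (Suc j)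
      then show ?thesis using nu
        by (simp add: F_def power2_eq_square fps_mult_nth[of \<psi> \<psi>] atLeast0AtMost lessThan_Suc_atMost algebra_simps)
    qed
    then show ?thesis using Op1_elem_nth(3)[of id \<nu> \<psi> k] by (simp add: g)
  qed
  have ode: "fps_X * fps_deriv (fps_deriv y) - of_nat \<nu> * fps_deriv y = F * y"
    by (simp add: F_def y' power2_eq_square algebra_simps)
  have rec: "of_nat j * (of_nat j - 1 - of_nat \<nu>) * y $ j = (\<Sum>i<j. g (j - i) * y $ i)" if "0 < j" for j
  proof -
    from that obtain k where j: "j = Suc k" by (auto simp: gr0_conv_Suc)
    have nu: "(of_nat \<nu> * fps_deriv y) $ k = of_nat \<nu> * (of_nat (k + 1) * y $ (k + 1))"
      by (simp flip: fps_of_nat)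
    have "(fps_X * fps_deriv (fps_deriv y)) $ k = of_nat k * of_nat (k + 1) * y $ (k + 1)"
      by (cases k) simp_all
    then have "of_nat k * of_nat (k + 1) * y $ (k + 1) - of_nat \<nu> * (of_nat (k + 1) * y $ (k + 1)) = (F * y) $ k"
      using arg_cong[OF ode, of "\<lambda>f. f $ k"] nu by simp
    also have "(F * y) $ k = (\<Sum>i\<le>k. y $ i * F $ (k - i))"
      by (subst mult.commute) (simp add: fps_mult_nth atLeast0AtMost)
    also have "\<dots> = (\<Sum>i<j. g (j - i) * y $ i)"
      unfolding j lessThan_Suc_atMost by (intro sum.cong refl) (simp add: F Suc_diff_le)
    finally show ?thesis by (simp add: j algebra_simps)
  qed
  have "frobenius \<nu> g j = y $ j" if "j \<le> \<nu>" for j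
    using that
  proof (induction j rule: less_induct)
    case (less j)
    show ?case
    proof (cases "j = 0")
      case True
      then show ?thesis by (simp add: frobenius_0 y_def)
    next
      case False
      have nz: "of_nat j * (of_nat j - 1 - of_nat \<nu>) \<noteq> (0 :: complex)"
        using False less.prems by (intro resonance_factor) auto
      have "of_nat j * (of_nat j - 1 - of_nat \<nu>) * frobenius \<nu> g j = of_nat j * (of_nat j - 1 - of_nat \<nu>) * y $ j"
        using False less by (simp add: frobenius_rec rec)
      then show ?thesis using nz by simp
    qed
  qed
  then have "(\<Sum>i<\<nu> + 1. g (\<nu> + 1 - i) * frobenius \<nu> g i) = (\<Sum>i<\<nu> + 1. g (\<nu> + 1 - i) * y $ i)"
    by (intro sum.cong) auto
  also have "\<dots> = 0" using rec[of "\<nu> + 1"] by simp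
  finally show ?thesis .
qed

text \<open>The obstruction is \<open>g\<^bsub>\<nu>+1\<^esub>\<close> plus a polynomial in lower coefficients. Replacing \<open>g\<^bsub>\<nu>+1\<^esub>\<close> by its forced
value makes the obstruction vanish, which identifies that polynomial.\<close>

lemma frobenius_obstruction:
  "(\<Sum>i<\<nu> + 1. g (\<nu> + 1 - i) * frobenius \<nu> g i) = g (\<nu> + 1) - Op1_value id \<nu> (\<lambda>i. g (nat (i + 2)))"
proof -
  define c where "c i = g (nat (i + 2))" for i
  define h where "h = g(\<nu> + 1 := Op1_value id \<nu> c)"
  let ?f = "fls_of_coeffs (Op1_retract id \<nu> c)"
  have "?f \<in> Op1_points id \<nu>"
    by (rule retract_in_Op1_points[OF is_ring_hom_id]) (rule fls_of_retract_nth)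
  then obtain \<psi> where f: "?f = Op1_elem id \<nu> \<psi>" by (auto simp: Op1_points_def)
  have h: "h j = fls_nth (Op1_elem id \<nu> \<psi>) (int j - 2)" if "0 < j" for j
    using that by (auto simp: fls_of_retract_nth Op1_retract_def h_def c_def simp flip: f)
  have split: "(\<Sum>i<\<nu> + 1. u (\<nu> + 1 - i) * frobenius \<nu> g i) = u (\<nu> + 1) +
      (\<Sum>i<\<nu>. g (\<nu> + 1 - Suc i) * frobenius \<nu> g (Suc i))" if "\<And>i. i \<le> \<nu> \<Longrightarrow> u i = g i" for u
    using that by (simp add: sum.lessThan_Suc_shift frobenius_0 del: sum.lessThan_Suc)
  have "0 = (\<Sum>i<\<nu> + 1. h (\<nu> + 1 - i) * frobenius \<nu> h i)"
    using frobenius_obstruction_vanishes[OF h] by simp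
  also have "\<dots> = (\<Sum>i<\<nu> + 1. h (\<nu> + 1 - i) * frobenius \<nu> g i)"
    by (intro sum.cong refl arg_cong2[where f = "(*)"] frobenius_cong) (auto simp: h_def)
  also have "\<dots> = Op1_value id \<nu> c + (\<Sum>i<\<nu>. g (\<nu> + 1 - Suc i) * frobenius \<nu> g (Suc i))"
    by (subst split) (auto simp: h_def)
  finally have "(\<Sum>i<\<nu>. g (\<nu> + 1 - Suc i) * frobenius \<nu> g (Suc i)) = - Op1_value id \<nu> c"
    by (simp add: eq_neg_iff_add_eq_0 add.commute)
  then show ?thesis using split[of g] by (simp add: c_def[abs_def])
qed

section \<open>The special fibre\<close>

lemma A_coeff_inj: "A_coeff i = A_coeff j \<longleftrightarrow> i = j"
proof
  assume "A_coeff i = A_coeff j"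
  (* 4 A_n + 1 = (n + 1)^2 *)
  then have "4 * A_coeff i + 1 = 4 * A_coeff j + 1" by simp
  moreover have "4 * A_coeff n + 1 = of_nat ((n + 1)\<^sup>2)" for n
    by (simp add: A_coeff_def power2_eq_square algebra_simps)
  ultimately have "(i + 1)\<^sup>2 = (j + 1)\<^sup>2" using of_nat_eq_iff by metis
  then show "i = j" using power_inject_base[of "i + 1" 1 "j + 1"] by (simp add: numeral_2_eq_2)
qed simp

text \<open>At the component \<open>\<nu>\<close> the corner determinant is the equation of \<open>Op\<^sub>1\<^sup>\<nu>\<close>, up to a nonzero constant.\<close>

lemma corner_det_value:
  assumes n: "2 * n \<le> l + m" and \<nu>: "\<nu> + 2 * n = l + m" and g: "g 0 = oper_diag l m n"
  shows "corner_det 0 0 l m g n (l + m + 1 - n) = (g (\<nu> + 1) - Op1_value id \<nu> (\<lambda>i. g (nat (i + 2)))) *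
      (\<Prod>j\<in>{..<l + m + 2} - {n, l + m + 1 - n}. oper_diag l m j - oper_diag l m n)"
    and "(\<Prod>j\<in>{..<l + m + 2} - {n, l + m + 1 - n}. oper_diag l m j - oper_diag l m n) \<noteq> (0 :: complex)"
proof -
  have d: "l + m + 1 - n - n = \<nu> + 1" using \<nu> by linarith
  have diag: "oper_diag l m (n + j) - g 0 = of_nat j * (of_nat j - 1 - of_nat \<nu>)" for j
  proof -
    have "of_nat l + of_nat m = (of_nat \<nu> + 2 * of_nat n :: complex)"
      using arg_cong[OF \<nu>, of "of_nat :: nat \<Rightarrow> complex"] by simp
    then have "of_nat l = (of_nat \<nu> + 2 * of_nat n - of_nat m :: complex)" by (simp add: algebra_simps)
    then show ?thesis by (simp add: g oper_diag_def algebra_simps)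
  qed
  have "corner_det 0 0 l m g n (l + m + 1 - n) =
      (\<Sum>i<\<nu> + 1. g (\<nu> + 1 - i) * frobenius \<nu> g i) *
      (\<Prod>j\<in>{..<l + m + 2} - {n, l + m + 1 - n}. oper_diag l m j - g 0)"
  proof (subst corner_det_special[where z = "frobenius \<nu> g"])
    show "n < l + m + 1 - n" "l + m + 1 - n < l + m + 2" using n \<nu> by linarith+
    show "oper_diag l m (l + m + 1 - n) = g 0" unfolding g oper_diag_eq_iff using n by simp
    show "(oper_diag l m (n + j) - g 0) * frobenius \<nu> g j = (\<Sum>i<j. g (j - i) * frobenius \<nu> g i)"
      if "0 < j" "j \<noteq> l + m + 1 - n - n" for j
      unfolding diag using that d by (intro frobenius_rec) simp_all
  qed (simp_all only: d frobenius_0 frobenius_resonance g)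
  then show "corner_det 0 0 l m g n (l + m + 1 - n) = (g (\<nu> + 1) - Op1_value id \<nu> (\<lambda>i. g (nat (i + 2)))) *
      (\<Prod>j\<in>{..<l + m + 2} - {n, l + m + 1 - n}. oper_diag l m j - oper_diag l m n)"
    unfolding frobenius_obstruction g .
  show "(\<Prod>j\<in>{..<l + m + 2} - {n, l + m + 1 - n}. oper_diag l m j - oper_diag l m n) \<noteq> (0 :: complex)"
    by (auto simp: oper_diag_eq_iff)
qed

text \<open>It suffices to test membership in a colon ideal on generators.\<close>

lemma ideal_gen_colon:
  assumes "w \<in> ideal_gen S" "\<And>s. s \<in> S \<Longrightarrow> c * s \<in> ideal_gen J"
  shows "c * w \<in> ideal_gen J"
proof -
  have "Modules.module.subspace (*) {w. c * w \<in> ideal_gen J}"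
    unfolding Modules.module.subspace_def[OF module_self]
    by (auto simp: ideal_gen_zero distrib_left ideal_gen_add mult.left_commute intro: ideal_gen_mult)
  then show ?thesis
    using assms Modules.module.span_minimal[OF module_self, of S "{w. c * w \<in> ideal_gen J}"]
    unfolding ideal_gen_def by blast
qed

definition components :: "nat \<Rightarrow> nat \<Rightarrow> nat set" where
  "components l m = {\<nu>. \<bar>int m - int l\<bar> \<le> int \<nu> \<and> \<nu> \<le> l + m \<and> \<nu> mod 2 = (l + m) mod 2}"

lemma components_eq: "components l m = (\<lambda>n. l + m - 2 * n) ` {..min l m}"
proof -
  have "\<nu> \<in> (\<lambda>n. l + m - 2 * n) ` {..min l m}" if \<nu>: "\<nu> \<in> components l m" for \<nu>
  proof -
    have p: "\<nu> mod 2 = (l + m) mod 2" "\<nu> \<le> l + m" "\<bar>int m - int l\<bar> \<le> int \<nu>"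
      using \<nu> by (auto simp: components_def)
    have "even (l + m - \<nu>)" using mod_eq_dvd_iff_nat[OF p(2), of 2] p(1) by simp
    then obtain k where k: "l + m - \<nu> = 2 * k" by (rule evenE)
    then have "int l + int m = int \<nu> + 2 * int k" using p(2) by linarith
    then have "k \<le> min l m" using p(3) by linarith
    moreover have "\<nu> = l + m - 2 * k" using k p(2) by linarith
    ultimately show ?thesis by blast
  qed
  moreover have "l + m - 2 * n \<in> components l m" if "n \<le> min l m" for n
  proof -
    have "2 * n \<le> l + m" using that by linarith
    then have "(l + m - 2 * n) mod 2 = (l + m) mod 2"
      using mod_eq_dvd_iff_nat[of "l + m - 2 * n" "l + m" 2] by simp
    then show ?thesis using that by (auto simp: components_def)
  qed
  ultimately show ?thesis by blast
qed

text \<open>Up to the constant \<open>component_scale\<close> and modulo \<open>\<Prod>\<^sub>\<nu>(A\<^sub>\<nu> - c\<^bsub>-2\<^esub>)\<close>, the idempotent of the component \<open>\<nu>\<close>.\<close>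

definition component_factor :: "nat set \<Rightarrow> nat \<Rightarrow> (nat, complex) mpoly" where
  "component_factor C \<nu> = (\<Prod>\<kappa>\<in>C - {\<nu>}. mconst (A_coeff \<kappa>) - mvar 2)"

definition component_scale :: "nat set \<Rightarrow> nat \<Rightarrow> complex" where
  "component_scale C \<nu> = inverse (\<Prod>\<kappa>\<in>C - {\<nu>}. A_coeff \<kappa> - A_coeff \<nu>)"

lemma meval_component_factor:
  "meval id c (component_factor C \<nu>) = (\<Prod>\<kappa>\<in>C - {\<nu>}. A_coeff \<kappa> - c 2)"
  by (simp add: component_factor_def is_ring_homD[OF is_ring_hom_meval[OF is_ring_hom_id]]
      meval_mconst[OF is_ring_hom_id] meval_mvar[OF is_ring_hom_id])

lemma component_scale_nonzero:
  assumes "finite C"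
  shows "component_scale C \<nu> * (\<Prod>\<kappa>\<in>C - {\<nu>}. A_coeff \<kappa> - A_coeff \<nu>) = 1"
proof -
  have "(\<Prod>\<kappa>\<in>C - {\<nu>}. A_coeff \<kappa> - A_coeff \<nu>) \<noteq> 0" using assms by (auto simp: A_coeff_inj)
  then show ?thesis by (simp add: component_scale_def)
qed

lemma lagrange_at_node:
  assumes "finite C" "\<kappa> \<in> C" "\<nu> \<in> C" "c 2 = A_coeff \<kappa>"
  shows "component_scale C \<nu> * meval id c (component_factor C \<nu>) = (if \<nu> = \<kappa> then 1 else 0)"
proof (cases "\<nu> = \<kappa>")
  case True
  then show ?thesis using component_scale_nonzero[OF assms(1)] by (simp add: meval_component_factor assms(4))
next
  case False
  then have "(\<Prod>i\<in>C - {\<nu>}. A_coeff i - c 2) = 0" using assms by (intro prod_zero) auto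
  then show ?thesis using False by (simp add: meval_component_factor)
qed

text \<open>Both sides are polynomials in \<open>c\<^bsub>-2\<^esub>\<close> of degree less than the number of components, and they agree at
all \<open>A\<^sub>\<nu>\<close>.\<close>

lemma component_factors_sum:
  assumes C: "finite C" "C \<noteq> {}"
  shows "(\<Sum>\<nu>\<in>C. mconst (component_scale C \<nu>) * component_factor C \<nu>) = 1"
proof -
  note ev = is_ring_homD[OF is_ring_hom_meval[OF is_ring_hom_id]]
  define D where "D = (\<Sum>\<nu>\<in>C. smult (component_scale C \<nu>) (\<Prod>\<kappa>\<in>C - {\<nu>}. [:A_coeff \<kappa>, -1:])) - 1"
  have D: "poly D z = (\<Sum>\<nu>\<in>C. component_scale C \<nu> * meval id (\<lambda>_. z) (component_factor C \<nu>)) - 1" for z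
    by (simp add: D_def poly_sum poly_prod meval_component_factor)
  have "poly D (A_coeff \<kappa>) = 0" if "\<kappa> \<in> C" for \<kappa>
    unfolding D using that C by (simp add: lagrange_at_node cong: sum.cong)
  then have roots: "A_coeff ` C \<subseteq> {z. poly D z = 0}" by auto
  have "degree (smult (component_scale C \<nu>) (\<Prod>\<kappa>\<in>C - {\<nu>}. [:A_coeff \<kappa>, -1:])) \<le> card C - 1" if "\<nu> \<in> C" for \<nu>
  proof -
    have "degree (\<Prod>\<kappa>\<in>C - {\<nu>}. [:A_coeff \<kappa>, -1:]) \<le> (\<Sum>\<kappa>\<in>C - {\<nu>}. degree [:A_coeff \<kappa>, -1:])"
      using degree_prod_sum_le[of "C - {\<nu>}" "\<lambda>\<kappa>. [:A_coeff \<kappa>, -1:]"] C by (simp add: o_def)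
    also have "\<dots> = card C - 1" using that C by simp
    finally show ?thesis using degree_smult_le order_trans by blast
  qed
  then have "degree D \<le> card C - 1" unfolding D_def by (intro degree_diff_le degree_sum_le) (use C in auto)
  moreover have "card C > 0" using C by (simp add: card_gt_0_iff)
  moreover have "card (A_coeff ` C) = card C" by (rule card_image) (simp add: inj_on_def A_coeff_inj)
  moreover have "card (A_coeff ` C) \<le> degree D" if "D \<noteq> 0"
    using card_mono[OF poly_roots_finite[OF that] roots] card_poly_roots_bound[OF that] by linarith
  ultimately have "D = 0" by linarith
  have "meval id c (\<Sum>\<nu>\<in>C. mconst (component_scale C \<nu>) * component_factor C \<nu>) = 1" for c
  proof -
    have "(\<Sum>\<nu>\<in>C. component_scale C \<nu> * meval id c (component_factor C \<nu>)) = poly D (c 2) + 1"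
      unfolding D by (simp add: meval_component_factor)
    then show ?thesis by (simp add: \<open>D = 0\<close> ev meval_mconst[OF is_ring_hom_id])
  qed
  then have "meval id c ((\<Sum>\<nu>\<in>C. mconst (component_scale C \<nu>) * component_factor C \<nu>) - 1) = 0" for c
    by (simp add: ev)
  then show ?thesis using mpoly_eq_0_if_vanishes by fastforce
qed

lemma special_determinants_at_component:
  assumes \<nu>: "\<nu> \<in> components l m"
  shows "\<exists>p \<kappa>. p \<in> Op2_special_ideal l m \<and> \<kappa> \<noteq> 0 \<and> (\<forall>c. c 2 = A_coeff \<nu> \<longrightarrow>
    meval id c p = \<kappa> * (c (\<nu> + 3) - Op1_value id \<nu> (\<lambda>i. c (nat (i + 4)))))"
proof -
  obtain n where n: "n \<le> min l m" "\<nu> = l + m - 2 * n" using \<nu> unfolding components_eq by auto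
  have n2: "2 * n \<le> l + m" "\<nu> + 2 * n = l + m" using n by linarith+
  define p where "p = corner_det 0 0 l m (special_coeffs l m) n (l + m + 1 - n)"
  define \<kappa> where "\<kappa> = (\<Prod>j\<in>{..<l + m + 2} - {n, l + m + 1 - n}. oper_diag l m j - oper_diag l m n :: complex)"
  have "p \<in> Op2_special_ideal l m" unfolding p_def by (rule special_determinants_in_ideal) simp
  moreover have "\<kappa> \<noteq> 0" unfolding \<kappa>_def by (rule corner_det_value(2)[OF n2 refl])
  moreover have "meval id c p = \<kappa> * (c (\<nu> + 3) - Op1_value id \<nu> (\<lambda>i. c (nat (i + 4))))" if c: "c 2 = A_coeff \<nu>" for c
  proof -
    note ev = is_ring_hom_meval[OF is_ring_hom_id, of c]
    define g where "g j = meval id c (special_coeffs l m j)" for j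
    have g: "g j = c (j + 2) - (if j = 0 then oper_exponent (l + m) else 0)" for j
      by (simp add: g_def special_coeffs_def is_ring_homD[OF ev] meval_mvar[OF is_ring_hom_id] meval_mconst[OF is_ring_hom_id])
    have g0: "g 0 = oper_diag l m n"
      using oper_diag_eq_A_coeff[OF n2(2)] c by (simp add: g numeral_2_eq_2 diff_eq_eq)
    have "meval id c p = corner_det 0 0 l m g n (l + m + 1 - n)"
      unfolding p_def ring_hom_corner_det[OF ev] by (simp add: is_ring_homD[OF ev] g_def[abs_def])
    also have "\<dots> = (g (\<nu> + 1) - Op1_value id \<nu> (\<lambda>i. g (nat (i + 2)))) * \<kappa>"
      unfolding \<kappa>_def by (rule corner_det_value(1)[where g = g, OF n2 g0])
    also have "Op1_value id \<nu> (\<lambda>i. g (nat (i + 2))) = Op1_value id \<nu> (\<lambda>i. c (nat (i + 4)))"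
    proof (rule Op1_value_cong)
      fix i :: int assume "-1 \<le> i"
      then have "nat (i + 2) \<noteq> 0" "nat (i + 2) + 2 = nat (i + 4)" by linarith+
      then show "g (nat (i + 2)) = c (nat (i + 4))" by (simp add: g)
    qed
    also have "g (\<nu> + 1) = c (\<nu> + 3)" by (simp add: g numeral_3_eq_3)
    finally show ?thesis by (simp add: id_def mult.commute)
  qed
  ultimately show ?thesis by blast
qed

text \<open>The block determinant has one factor for each \<open>n\<close> from \<open>0\<close> to the parameter, \<open>l\<close> or \<open>m\<close>, of the point
at which the Newton basis starts. It is started at the point with the smaller parameter, so that \<open>n\<close> runs
up to \<open>min l m\<close>.\<close>

lemma special_product_in_ideal:
  "(\<Prod>\<nu>\<in>components l m. mconst (A_coeff \<nu>) - mvar 2) \<in> Op2_special_ideal l m"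
proof -
  have inj: "inj_on (\<lambda>n. l + m - 2 * n) {..min l m}" by (auto simp: inj_on_def)
  have eq: "block_det 0 0 l' m' (special_coeffs l m) = (\<Prod>\<nu>\<in>components l m. mconst (A_coeff \<nu>) - mvar 2)"
    if lm: "l' + m' = l + m" "m' = min l m" for l' m'
  proof -
    have "oper_diag l' m' n - special_coeffs l m 0 = mconst (A_coeff (l + m - 2 * n)) - mvar 2" if "n \<le> m'" for n
    proof -
      have F1: "mconst (oper_diag l' m' n) = (oper_diag l' m' n :: (nat, complex) mpoly)"
        by (simp add: oper_diag_def is_ring_homD[OF is_ring_hom_mconst])
      have "l + m - 2 * n + 2 * n = l' + m'" using that lm by linarith
      from oper_diag_eq_A_coeff[OF this]
      have F2: "mconst (A_coeff (l + m - 2 * n)) = mconst (oper_diag l' m' n) + mconst (oper_exponent (l + m))"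
        using lm by (simp flip: is_ring_homD(2)[OF is_ring_hom_mconst])
      have "special_coeffs l m 0 = mvar 2 - mconst (oper_exponent (l + m))"
        by (simp add: special_coeffs_def numeral_2_eq_2)
      then show ?thesis unfolding F2 F1 by simp
    qed
    then show ?thesis
      unfolding block_det_special components_eq prod.reindex[OF inj] using lm(2) by (auto intro!: prod.cong)
  qed
  show ?thesis
  proof (cases "m \<le> l")
    case True
    then show ?thesis using eq[of l m] special_determinants_in_ideal(1)[where l = l and m = m] by simp
  next
    case False
    then show ?thesis using eq[of m l] special_determinants_in_ideal(2)[where l = l and m = m] by simp
  qed
qed

text \<open>Multiplied by the idempotent of the component \<open>\<nu>\<close>, each generator of the ideal of \<open>Op\<^sub>1\<^sup>\<nu>\<close> lies in the
special ideal: \<open>c\<^bsub>-2\<^esub> - A\<^sub>\<nu>\<close> because of the product, and the equation for \<open>c\<^bsub>\<nu>-1\<^esub>\<close> because of the corner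
determinant, in which \<open>c\<^bsub>-2\<^esub>\<close> may be replaced by \<open>A\<^sub>\<nu>\<close>.\<close>

theorem Op2_special_ideal_superset:
  "(\<Inter>\<nu>\<in>components l m. Op1_ideal 4 \<nu>) \<subseteq> Op2_special_ideal l m"
proof
  fix q assume q: "q \<in> (\<Inter>\<nu>\<in>components l m. Op1_ideal 4 \<nu>)"
  let ?C = "components l m"
  obtain S where J: "Op2_special_ideal l m = ideal_gen S" unfolding Op2_special_ideal_def by blast
  have C: "finite ?C" "?C \<noteq> {}" by (simp_all add: components_eq)
  have "component_factor ?C \<nu> * q \<in> ideal_gen S" if \<nu>: "\<nu> \<in> ?C" for \<nu>
  proof -
    let ?L = "component_factor ?C \<nu>"
    let ?h = "mvar (\<nu> + 3) - Op1_value mconst \<nu> (Op1_var 4)"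
    have two: "?L * (mvar 2 - mconst (A_coeff \<nu>)) \<in> ideal_gen S"
    proof -
      have "(mconst (A_coeff \<nu>) - mvar 2) * ?L \<in> ideal_gen S"
        using special_product_in_ideal[of l m] unfolding J component_factor_def
        by (subst prod.remove[OF C(1) \<nu>, symmetric])
      then have "- 1 * ((mconst (A_coeff \<nu>) - mvar 2) * ?L) \<in> ideal_gen S" by (rule ideal_gen_mult)
      then show ?thesis by (simp add: algebra_simps)
    qed
    have top: "?L * ?h \<in> ideal_gen S"
    proof -
      obtain p \<kappa> where p: "p \<in> ideal_gen S" "\<kappa> \<noteq> 0" "\<And>c. c 2 = A_coeff \<nu> \<Longrightarrow>
          meval id c p = \<kappa> * (c (\<nu> + 3) - Op1_value id \<nu> (\<lambda>i. c (nat (i + 4))))"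
        using special_determinants_at_component[OF \<nu>] unfolding J by blast
      define \<rho> where "\<rho> v = (if v = 2 then mconst (A_coeff \<nu>) else mvar v)" for v :: nat
      have "?L * (p - meval mconst \<rho> p) \<in> ideal_gen S"
      proof (rule ideal_gen_colon[OF mpoly_substitution_ideal])
        show "?L * s \<in> ideal_gen S" if "s \<in> range (\<lambda>v. mvar v - \<rho> v)" for s
          using that two by (auto simp: \<rho>_def ideal_gen_zero)
      qed
      moreover have "meval mconst \<rho> p - mconst \<kappa> * ?h = 0"
      proof (rule mpoly_eq_0_if_vanishes)
        fix c :: "nat \<Rightarrow> complex"
        note ev = is_ring_hom_meval[OF is_ring_hom_id, of c]
        have evc: "meval id c (mconst z) = z" "meval id c (mvar v) = c v" for z v
          by (simp_all add: meval_mconst[OF is_ring_hom_id] meval_mvar[OF is_ring_hom_id])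
        have "meval id c (meval mconst \<rho> p) = meval id (c(2 := A_coeff \<nu>)) p"
        proof -
          have "(\<lambda>v. meval id c (\<rho> v)) = c(2 := A_coeff \<nu>)" by (auto simp: \<rho>_def evc)
          then show ?thesis unfolding ring_hom_meval[OF ev] evc by (simp add: id_def)
        qed
        also have "\<dots> = \<kappa> * (c (\<nu> + 3) - Op1_value id \<nu> (\<lambda>i. (c(2 := A_coeff \<nu>)) (nat (i + 4))))"
          using p(3)[of "c(2 := A_coeff \<nu>)"] by simp
        also have "Op1_value id \<nu> (\<lambda>i. (c(2 := A_coeff \<nu>)) (nat (i + 4))) = meval id c (Op1_value mconst \<nu> (Op1_var 4))"
        proof -
          have "meval id c (Op1_value mconst \<nu> (Op1_var 4)) = Op1_value id \<nu> (\<lambda>i. meval id c (Op1_var 4 i))"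
            unfolding ring_hom_Op1_value[OF ev] evc by (simp add: id_def)
          also have "\<dots> = Op1_value id \<nu> (\<lambda>i. (c(2 := A_coeff \<nu>)) (nat (i + 4)))"
          proof (rule Op1_value_cong)
            fix i :: int assume "-1 \<le> i"
            then have "nat (i + 4) \<noteq> 2" "\<not> i < -4" by linarith+
            then show "meval id c (Op1_var 4 i) = (c(2 := A_coeff \<nu>)) (nat (i + 4))"
              by (simp add: Op1_var_def evc)
          qed
          finally show ?thesis by simp
        qed
        finally have "meval id c (meval mconst \<rho> p) =
            \<kappa> * (c (\<nu> + 3) - meval id c (Op1_value mconst \<nu> (Op1_var 4)))"
          unfolding id_def .
        then show "meval id c (meval mconst \<rho> p - mconst \<kappa> * ?h) = 0"
          by (simp add: is_ring_homD[OF ev] evc)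
      qed
      ultimately have "?L * p - ?L * (p - mconst \<kappa> * ?h) \<in> ideal_gen S"
        by (intro ideal_gen_diff ideal_gen_mult[OF p(1)]) simp
      then have "mconst (inverse \<kappa>) * (?L * p - ?L * (p - mconst \<kappa> * ?h)) \<in> ideal_gen S" by (rule ideal_gen_mult)
      also have "mconst (inverse \<kappa>) * (?L * p - ?L * (p - mconst \<kappa> * ?h)) =
          (mconst (inverse \<kappa>) * mconst \<kappa>) * (?L * ?h)" by (simp add: algebra_simps)
      also have "mconst (inverse \<kappa>) * mconst \<kappa> = (1 :: (nat, complex) mpoly)"
        using p(2) by (simp add: is_ring_homD(1)[OF is_ring_hom_mconst] flip: is_ring_homD(3)[OF is_ring_hom_mconst])
      finally show ?thesis by simp
    qed
    have "q \<in> Op1_ideal 4 \<nu>" using q \<nu> by blast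
    then have "q \<in> ideal_gen (range (\<lambda>v. mvar v - Op1_retract mconst \<nu> (Op1_var 4) (int v - int 4)))"
      by (intro Op1_ideal_generators) simp_all
    then show ?thesis
    proof (rule ideal_gen_colon)
      fix s assume "s \<in> range (\<lambda>v. mvar v - Op1_retract mconst \<nu> (Op1_var 4) (int v - int 4))"
      then obtain v where s: "s = mvar v - Op1_retract mconst \<nu> (Op1_var 4) (int v - int 4)" by blast
      consider "v = 0" | "v = 1" | "v = 2" | "v = \<nu> + 3" | "v > 2" "v \<noteq> \<nu> + 3" by linarith
      then show "?L * s \<in> ideal_gen S"
      proof cases
        case 1
        then show ?thesis using special_determinants_in_ideal(5)[of l m]
          by (simp add: s Op1_retract_def ideal_gen_mult J)
      next
        case 2
        then show ?thesis using special_determinants_in_ideal(6)[of l m]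
          by (simp add: s Op1_retract_def ideal_gen_mult J)
      next
        case 3
        then show ?thesis using two by (simp add: s Op1_retract_def)
      next
        case 4
        then have "s = ?h" by (simp add: s Op1_retract_def)
        then show ?thesis using top by simp
      next
        case 5
        then have "s = 0" by (simp add: s Op1_retract_def Op1_var_def)
        then show ?thesis by (simp add: ideal_gen_zero)
      qed
    qed
  qed
  then have "(\<Sum>\<nu>\<in>?C. mconst (component_scale ?C \<nu>) * (component_factor ?C \<nu> * q)) \<in> ideal_gen S"
    by (intro ideal_gen_sum) (rule ideal_gen_mult)
  also have "(\<Sum>\<nu>\<in>?C. mconst (component_scale ?C \<nu>) * (component_factor ?C \<nu> * q)) =
      (\<Sum>\<nu>\<in>?C. mconst (component_scale ?C \<nu>) * component_factor ?C \<nu>) * q"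
    by (simp add: sum_distrib_right mult.assoc)
  finally show "q \<in> Op2_special_ideal l m" by (simp add: component_factors_sum[OF C] J)
qed

lemma components_comaximal:
  "\<exists>p. \<forall>\<nu>\<in>components l m. p - q \<nu> \<in> Op1_ideal 4 \<nu>"
proof -
  let ?C = "components l m"
  have C: "finite ?C" by (simp add: components_eq)
  define p where "p = (\<Sum>\<nu>\<in>?C. mconst (component_scale ?C \<nu>) * component_factor ?C \<nu> * q \<nu>)"
  have "p - q \<kappa> \<in> Op1_ideal 4 \<kappa>" if \<kappa>: "\<kappa> \<in> ?C" for \<kappa>
    unfolding Op1_ideal_iff[of 4, simplified]
  proof
    fix f assume "f \<in> Op1_points id \<kappa>"
    then have c2: "Op1_coord 4 f 2 = A_coeff \<kappa>"
      by (simp add: Op1_coord_def Op1_points_iff[OF is_ring_hom_id])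
    let ?c = "Op1_coord 4 f"
    note ev = is_ring_homD[OF is_ring_hom_meval[OF is_ring_hom_id, of ?c]]
    have "meval id ?c p = (\<Sum>\<nu>\<in>?C. (component_scale ?C \<nu> * meval id ?c (component_factor ?C \<nu>)) * meval id ?c (q \<nu>))"
      by (simp add: p_def ev meval_mconst[OF is_ring_hom_id])
    also have "\<dots> = (\<Sum>\<nu>\<in>?C. if \<nu> = \<kappa> then meval id ?c (q \<nu>) else 0)"
      using lagrange_at_node[where c = ?c, OF C \<kappa> _ c2] by (intro sum.cong) auto
    also have "\<dots> = meval id ?c (q \<kappa>)" using C \<kappa> by simp
    finally show "meval id ?c (p - q \<kappa>) = 0" by (simp add: ev)
  qed
  then show ?thesis by blast
qed

theorem theorem2p13:
  fixes l \<mu> :: nat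
  shows "is_closed_coproduct (Op2_special_ideal l \<mu>)
    {\<nu>. \<bar>int \<mu> - int l\<bar> \<le> int \<nu> \<and> \<nu> \<le> l + \<mu> \<and> \<nu> mod 2 = (l + \<mu>) mod 2}
    (Op1_ideal 4)"
proof -
  have "Op2_special_ideal l \<mu> \<subseteq> Op1_ideal 4 \<nu>" if \<nu>: "\<nu> \<in> components l \<mu>" for \<nu>
  proof -
    obtain k where "k \<le> min l \<mu>" "\<nu> = l + \<mu> - 2 * k" using \<nu> unfolding components_eq by auto
    then show ?thesis by (intro Op2_special_ideal_subset[of k]) auto
  qed
  then have "Op2_special_ideal l \<mu> = (\<Inter>\<nu>\<in>components l \<mu>. Op1_ideal 4 \<nu>)"
    using Op2_special_ideal_superset[of l \<mu>] by blast
  moreover have "finite (components l \<mu>)" by (simp add: components_eq)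
  ultimately show ?thesis
    using components_comaximal[of l \<mu>]
    unfolding is_closed_coproduct_def components_def[symmetric] by blast
qed

end
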